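(* Let $N\ge 3$ and let $\Omega=B_1$ be the unit ball of $\mathbb{R}^N$. Suppose that $f$ and $g$ both satisfy: smooth, increasing and convex on $[0,\infty)$, $f(0)=g(0)=1$, and superlinear at $\infty$. Assume $f'(0)>0$, $g'(0)>0$ and $$\liminf_{u\to\infty} f''(u)=\infty,\qquad \liminf_{v\to\infty} g''(v)=\infty.$$ Let $(\lambda^*,\gamma^* )\in\Upsilon$ and let $(u^*,v^* )$ be the extremal solution associated with $(G)_{\lambda^*,\gamma^*}$. Then, writing $r=|x|$: 1. if $N<10$, then $u^*,v^*\in L^\infty(B_1)$; 2. if $N=10$, then there is a constant $C_{\lambda^*,\gamma^*}$ such that $u^*(r),v^*(r)\le C_{\lambda^*,\gamma^*}(1+|\log r|)$ for $r\in(0,1]$; 3. if $N>10$, then there is a constant $C_{\lambda^*,\gamma^*,N}$ such that $u^*(r),v^*(r)\le C_{\lambda^*,\gamma^*,N}\, r^{-\frac N2+\sqrt{N-1}+2}$ for $r\in(0,1]$.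
   Context: For $\lambda,\gamma>0$, $(G)_{\lambda,\gamma}$ denotes the system $$-\Delta u=\lambda f'(u)g(v)\ \text{ in }\Omega,\qquad -\Delta v=\gamma f(u)g'(v)\ \text{ in }\Omega,\qquad u=v=0\ \text{ on }\partial\Omega.$$ Superlinear at $\infty$ means $f(u)/u\to\infty$ as $u\to\infty$. Smooth solutions are classical solutions: nonnegative, smooth in $\Omega$, continuous on $\overline\Omega$, with zero boundary values. Let $\mathcal{Q}=\{(\lambda,\gamma):\lambda,\gamma>0\}$, let $\mathcal{U}$ be the set of $(\lambda,\gamma)\in\mathcal{Q}$ for which $(G)_{\lambda,\gamma}$ has a smooth solution, and let $\Upsilon:=\partial\mathcal{U}\cap\mathcal{Q}$. It is known that $\mathcal U$ is nonempty and bounded, that $(\lambda,\gamma)\in\mathcal U$ implies $(0,\lambda]\times(0,\gamma]\subset\mathcal U$, and that whenever a smooth solution exists there is a (pointwise) minimal smooth solution. Given $(\lambda^*,\gamma^* )\in\Upsilon$, put $\sigma=\gamma^*/\lambda^*$ and, for $\lambda^*/2<\lambda<\lambda^*$, let $(u_\lambda,v_\lambda)$ be the minimal solution of $(G)_{\lambda,\sigma\lambda}$. For each $x\in\Omega$, $u_\lambda(x)$ and $v_\lambda(x)$ are increasing in $\lambda$; the extremal solution associated with $(\lambda^*,\gamma^* )$ is the pair of pointwise limits $u^*(x)=\lim_{\lambda\nearrow\lambda^*}u_\lambda(x)$, $v^*(x)=\lim_{\lambda\nearrow\lambda^*}v_\lambda(x)$. On the ball these functions are radial, and $u^*(r)$,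 $v^*(r)$ denote their values at $|x|=r$. *)

theory Defs
  imports "HOL-Analysis.Analysis" "HOL-Probability.Essential_Supremum"
begin

(* C^k on S, with derivatives taken within S: on an open S this is the usual
   notion, on {0..} the derivatives at 0 are one-sided.  In both cases the
   derivative f' is uniquely determined on S. *)
primrec Ck_on :: "nat \<Rightarrow> 'a::real_normed_vector set \<Rightarrow> ('a \<Rightarrow> 'b::real_normed_vector) \<Rightarrow> bool" where
  "Ck_on 0 S f \<longleftrightarrow> continuous_on S f"
| "Ck_on (Suc k) S f \<longleftrightarrow>
     (\<exists>f'. (\<forall>x\<in>S. (f has_derivative f' x) (at x within S)) \<and> (\<forall>h. Ck_on k S (\<lambda>x. f' x h)))"

definition smooth_on :: "'a::real_normed_vector set \<Rightarrow> ('a \<Rightarrow> 'b::real_normed_vector) \<Rightarrow> bool" where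
  "smooth_on S f \<longleftrightarrow> (\<forall>k. Ck_on k S f)"

(* Derivative of a function on the half line [0,\<infinity>), one-sided at 0; the values of the
   nonlinearities on negative arguments are irrelevant throughout. *)
definition D_half :: "(real \<Rightarrow> real) \<Rightarrow> real \<Rightarrow> real" where
  "D_half f t = vector_derivative f (at t within {0..})"

definition laplacian :: "('a::euclidean_space \<Rightarrow> real) \<Rightarrow> 'a \<Rightarrow> real" where
  "laplacian u x = (\<Sum>b\<in>Basis. (deriv ^^ 2) (\<lambda>t. u (x + t *\<^sub>R b)) 0)"

definition admissible_nonlinearity :: "(real \<Rightarrow> real) \<Rightarrow> bool" where
  "admissible_nonlinearity f \<longleftrightarrow>
     smooth_on {0..} f \<and> mono_on {0..} f \<and> convex_on {0..} f \<and> f 0 = 1 \<and>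
     filterlim (\<lambda>t. f t / t) at_top at_top"

definition smooth_solution ::
  "'a::euclidean_space set \<Rightarrow> (real \<Rightarrow> real) \<Rightarrow> (real \<Rightarrow> real) \<Rightarrow> real \<Rightarrow> real
     \<Rightarrow> ('a \<Rightarrow> real) \<Rightarrow> ('a \<Rightarrow> real) \<Rightarrow> bool" where
  "smooth_solution \<Omega> f g lam gam u v \<longleftrightarrow>
     smooth_on \<Omega> u \<and> smooth_on \<Omega> v \<and>
     continuous_on (closure \<Omega>) u \<and> continuous_on (closure \<Omega>) v \<and>
     (\<forall>x\<in>closure \<Omega>. 0 \<le> u x \<and> 0 \<le> v x) \<and>
     (\<forall>x\<in>\<Omega>. - laplacian u x = lam * D_half f (u x) * g (v x)) \<and>
     (\<forall>x\<in>\<Omega>. - laplacian v x = gam * f (u x) * D_half g (v x)) \<and>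
     (\<forall>x\<in>frontier \<Omega>. u x = 0 \<and> v x = 0)"

definition minimal_solution ::
  "'a::euclidean_space set \<Rightarrow> (real \<Rightarrow> real) \<Rightarrow> (real \<Rightarrow> real) \<Rightarrow> real \<Rightarrow> real
     \<Rightarrow> ('a \<Rightarrow> real) \<Rightarrow> ('a \<Rightarrow> real) \<Rightarrow> bool" where
  "minimal_solution \<Omega> f g lam gam u v \<longleftrightarrow>
     smooth_solution \<Omega> f g lam gam u v \<and>
     (\<forall>w z. smooth_solution \<Omega> f g lam gam w z \<longrightarrow> (\<forall>x\<in>closure \<Omega>. u x \<le> w x \<and> v x \<le> z x))"

definition param_quadrant :: "(real \<times> real) set" where
  "param_quadrant = {(lam, gam). 0 < lam \<and> 0 < gam}"

definition solvable_params ::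
  "'a::euclidean_space set \<Rightarrow> (real \<Rightarrow> real) \<Rightarrow> (real \<Rightarrow> real) \<Rightarrow> (real \<times> real) set" where
  "solvable_params \<Omega> f g =
     {(lam, gam) \<in> param_quadrant. \<exists>u v. smooth_solution \<Omega> f g lam gam u v}"

definition extremal_params ::
  "'a::euclidean_space set \<Rightarrow> (real \<Rightarrow> real) \<Rightarrow> (real \<Rightarrow> real) \<Rightarrow> (real \<times> real) set" where
  "extremal_params \<Omega> f g = frontier (solvable_params \<Omega> f g) \<inter> param_quadrant"

(* The pointwise limits are taken in the extended reals, since they may be infinite at
   some points (e.g. at the centre of a ball).  Minimal solutions, and hence
   the limits, are uniquely determined on closure \<Omega>. *)
definition extremal_solution ::
  "'a::euclidean_space set \<Rightarrow> (real \<Rightarrow> real) \<Rightarrow> (real \<Rightarrow> real) \<Rightarrow> real \<Rightarrow> real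
     \<Rightarrow> ('a \<Rightarrow> ereal) \<Rightarrow> ('a \<Rightarrow> ereal) \<Rightarrow> bool" where
  "extremal_solution \<Omega> f g lam gam us vs \<longleftrightarrow>
     (\<exists>U V. (\<forall>l\<in>{lam/2<..<lam}. minimal_solution \<Omega> f g l (gam / lam * l) (U l) (V l)) \<and>
        (\<forall>x\<in>closure \<Omega>. ((\<lambda>l. ereal (U l x)) \<longlongrightarrow> us x) (at_left lam) \<and>
                        ((\<lambda>l. ereal (V l x)) \<longlongrightarrow> vs x) (at_left lam)))"

(* esssup is infinite on non-measurable functions, but measurability of \<bar>w\<bar> alone does
   not give that of w. *)
definition L_infinity :: "'a::euclidean_space set \<Rightarrow> ('a \<Rightarrow> ereal) \<Rightarrow> bool" where
  "L_infinity \<Omega> w \<longleftrightarrow>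
     w \<in> borel_measurable (lebesgue_on \<Omega>) \<and> esssup (lebesgue_on \<Omega>) (\<lambda>x. \<bar>w x\<bar>) < \<infinity>"

end

theory Submission
  imports Defs "HOL-Real_Asymp.Real_Asymp"
begin

text \<open>
  Monotone iteration from zero, carried out in the variable \<open>t = |x|\<^sup>2\<close>, converges to a radial smooth
  solution below every solution; hence minimal solutions are radial, monotone and left continuous in the
  parameter \<open>l\<close>, and everything reduces to ordinary differential equations in \<open>r = |x|\<close>.

  The differences \<open>p = u\<^sub>l - u\<^sub>k\<close> and \<open>q = v\<^sub>l - v\<^sub>k\<close> with \<open>k < l\<close> are positive supersolutions of a
  system which approaches the linearisation as \<open>k\<close> tends to \<open>l\<close>. Picone's identity, applied with \<open>p\<close>, \<open>q\<close>
  and the test functions \<open>u\<^sub>r \<eta>\<close>, \<open>v\<^sub>r \<eta>\<close>, and the arithmetic-geometric mean inequality for the coupling term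
  then give the inequality of Cabre, Capella and Villegas
  \<open>(N-1) \<integral> (u\<^sub>r\<^sup>2/\<lambda> + v\<^sub>r\<^sup>2/\<gamma>) \<eta>\<^sup>2 r\<^bsup>N-3\<^esup> dr \<le> \<integral> (u\<^sub>r\<^sup>2/\<lambda> + v\<^sub>r\<^sup>2/\<gamma>) \<eta>'\<^sup>2 r\<^bsup>N-1\<^esup> dr\<close>,
  in the form of a Riccati differential inequality. Since \<open>r\<^bsup>N-1\<^esup>|u\<^sub>r|\<close> is
  increasing, it yields \<open>|u\<^sub>r| \<le> C r\<^bsup>-N/2 + sqrt(N-1) + 1\<^esup>\<close> uniformly in \<open>l\<close>; superlinearity bounds the solutions
  away from the centre, and integrating \<open>u\<^sub>r\<close> gives the three cases.
\<close>

section \<open>Functions of class C^k\<close>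

text \<open>The obstacle is that no principal eigenfunction is at hand: stability has to be
  extracted from the branch of solutions itself. Convexity of f and g yields the coupling terms of
  the linearisation, but f' and g' need not be convex, so difference quotients stand where f''(u)
  and g''(v) are wanted. The resulting error depends on the solution, yet it disappears when k tends
  to l with l fixed; only afterwards are the constants made uniform in l up to the extremal
  parameter. Dividing the two equations by \<lambda> and \<gamma> gives both cross terms the same
  coefficient f'(u) g'(v). This is the origin of the weights, and the reason why the mean inequality
  absorbs the coupling completely. The function \<eta> = r^(-sqrt(N-1)) solves (N-1) \<eta>^2 / r^2
  = \<eta>'^2, so it balances the two sides of the stability inequality: the loss is confined to the
  cut-off near the boundary, the gain to the region near the centre. Dimension 10 appears as a zero
  of -N/2 + sqrt(N-1) + 2, whose sign is that of -(N-2)(N-10) for N >= 3.\<close>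

lemma Ck_on_SucI:
  assumes "\<And>x. x \<in> S \<Longrightarrow> (f has_derivative f' x) (at x within S)"
    and "\<And>h. Ck_on k S (\<lambda>x. f' x h)"
  shows "Ck_on (Suc k) S f"
  unfolding Ck_on.simps by (rule exI[of _ f']) (simp add: assms)

lemma Ck_on_SucE:
  assumes "Ck_on (Suc k) S f"
  obtains f' where "\<And>x. x \<in> S \<Longrightarrow> (f has_derivative f' x) (at x within S)"
    "\<And>h. Ck_on k S (\<lambda>x. f' x h)"
  using assms unfolding Ck_on.simps by blast

lemma Ck_on_cong:
  assumes "Ck_on k S f" "\<And>x. x \<in> S \<Longrightarrow> f x = g x"
  shows "Ck_on k S g"
proof (cases k)
  case 0
  then show ?thesis using assms continuous_on_cong[of S S f g] by simp
next
  case (Suc j)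
  with assms(1) obtain f' where f': "\<And>x. x \<in> S \<Longrightarrow> (f has_derivative f' x) (at x within S)"
      "\<And>h. Ck_on j S (\<lambda>x. f' x h)" using Ck_on_SucE by blast
  have "(g has_derivative f' x) (at x within S)" if "x \<in> S" for x
    by (rule has_derivative_transform[OF that _ f'(1)[OF that]]) (simp add: assms(2))
  then show ?thesis unfolding Suc using f'(2) Ck_on_SucI by blast
qed

lemma Ck_on_imp_continuous_on: "Ck_on k S f \<Longrightarrow> continuous_on S f"
proof (cases k)
  case (Suc j)
  assume "Ck_on k S f"
  then obtain f' where "\<And>x. x \<in> S \<Longrightarrow> (f has_derivative f' x) (at x within S)"
    unfolding Suc using Ck_on_SucE by blast
  then show ?thesis using has_derivative_continuous_on by blast
qed simp

lemma Ck_on_SucD: "Ck_on (Suc k) S f \<Longrightarrow> Ck_on k S f"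
proof (induction k arbitrary: f)
  case 0
  then show ?case unfolding Ck_on.simps(1) by (rule Ck_on_imp_continuous_on)
next
  case (Suc k)
  then obtain f' where f': "\<And>x. x \<in> S \<Longrightarrow> (f has_derivative f' x) (at x within S)"
      "\<And>h. Ck_on (Suc k) S (\<lambda>x. f' x h)" using Ck_on_SucE by blast
  show ?case by (rule Ck_on_SucI[OF f'(1)]) (simp_all add: Suc.IH f'(2) del: Ck_on.simps)
qed

lemma Ck_on_const [simp]: "Ck_on k S (\<lambda>x. c)"
proof (induction k arbitrary: c)
  case (Suc k)
  show ?case by (rule Ck_on_SucI[of _ _ "\<lambda>x h. 0"]) (simp_all add: Suc)
qed simp

lemma Ck_on_bounded_linear:
  assumes "bounded_linear L"
  shows "Ck_on k S L"
proof (cases k)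
  case 0
  then show ?thesis using assms by (simp add: linear_continuous_on)
next
  case (Suc j)
  show ?thesis unfolding Suc
    by (rule Ck_on_SucI[of _ _ "\<lambda>x. L"]) (simp_all add: assms bounded_linear_imp_has_derivative)
qed

lemma Ck_on_add:
  assumes "Ck_on k S f" "Ck_on k S g"
  shows "Ck_on k S (\<lambda>x. f x + g x)"
  using assms
proof (induction k arbitrary: f g)
  case (Suc k)
  obtain f' where f': "\<And>x. x \<in> S \<Longrightarrow> (f has_derivative f' x) (at x within S)"
      "\<And>h. Ck_on k S (\<lambda>x. f' x h)" using Ck_on_SucE Suc.prems by blast
  obtain g' where g': "\<And>x. x \<in> S \<Longrightarrow> (g has_derivative g' x) (at x within S)"
      "\<And>h. Ck_on k S (\<lambda>x. g' x h)" using Ck_on_SucE Suc.prems by blast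
  show ?case
    by (rule Ck_on_SucI[of _ _ "\<lambda>x h. f' x h + g' x h"])
       (simp_all add: f' g' Suc.IH has_derivative_add del: Ck_on.simps)
qed (simp add: continuous_on_add)

lemma Ck_on_mult:
  fixes f g :: "'a::real_normed_vector \<Rightarrow> real"
  assumes "Ck_on k S f" "Ck_on k S g"
  shows "Ck_on k S (\<lambda>x. f x * g x)"
  using assms
proof (induction k arbitrary: f g)
  case (Suc k)
  obtain f' where f': "\<And>x. x \<in> S \<Longrightarrow> (f has_derivative f' x) (at x within S)"
      "\<And>h. Ck_on k S (\<lambda>x. f' x h)" using Ck_on_SucE Suc.prems by blast
  obtain g' where g': "\<And>x. x \<in> S \<Longrightarrow> (g has_derivative g' x) (at x within S)"
      "\<And>h. Ck_on k S (\<lambda>x. g' x h)" using Ck_on_SucE Suc.prems by blast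
  have "Ck_on k S f" "Ck_on k S g" using Suc.prems Ck_on_SucD by blast+
  then have "Ck_on k S (\<lambda>x. f x * g' x h + f' x h * g x)" for h
    using Ck_on_add[OF Suc.IH Suc.IH] f' g' by blast
  then show ?case
    by (intro Ck_on_SucI[of _ _ "\<lambda>x h. f x * g' x h + f' x h * g x"])
       (simp_all add: f' g' has_derivative_mult del: Ck_on.simps)
qed (simp add: continuous_on_mult)

text \<open>The derivative of a function on the reals is multiplication by \<open>p y 1\<close>, so
  the chain rule produces a product to which \<open>Ck_on_mult\<close> and the induction hypothesis
  apply. Derivatives within \<open>T\<close> matter: nonlinearities and profiles are differentiated
  only on \<open>{0..}\<close> and \<open>{0..1}\<close>, whose endpoints are attained.\<close>

lemma Ck_on_compose:
  fixes \<phi> :: "real \<Rightarrow> real" and m :: "'a::real_normed_vector \<Rightarrow> real"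
  assumes "Ck_on k T \<phi>" "Ck_on k S m" "m ` S \<subseteq> T"
  shows "Ck_on k S (\<lambda>x. \<phi> (m x))"
  using assms
proof (induction k arbitrary: \<phi>)
  case 0
  then show ?case using continuous_on_compose2 by fastforce
next
  case (Suc k)
  obtain p where p: "\<And>y. y \<in> T \<Longrightarrow> (\<phi> has_derivative p y) (at y within T)"
      "\<And>h. Ck_on k T (\<lambda>y. p y h)" using Suc.prems(1) Ck_on_SucE by blast
  obtain m' where m': "\<And>x. x \<in> S \<Longrightarrow> (m has_derivative m' x) (at x within S)"
      "\<And>h. Ck_on k S (\<lambda>x. m' x h)" using Suc.prems(2) Ck_on_SucE by blast
  have der: "((\<lambda>x. \<phi> (m x)) has_derivative (\<lambda>h. m' x h * p (m x) 1)) (at x within S)"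
    if x: "x \<in> S" for x
  proof -
    have pm: "(\<phi> has_derivative p (m x)) (at (m x) within T)" using p(1) Suc.prems(3) x by auto
    have "((\<lambda>x. \<phi> (m x)) has_derivative (\<lambda>h. p (m x) (m' x h))) (at x within S)"
      by (rule has_derivative_in_compose2[OF p(1) Suc.prems(3) x m'(1)[OF x]])
    moreover have "p (m x) (m' x h) = m' x h * p (m x) 1" for h
      using linear_cmul[OF has_derivative_linear[OF pm], of "m' x h" 1] by simp
    ultimately show ?thesis by simp
  qed
  have "Ck_on k S (\<lambda>x. m' x h * p (m x) 1)" for h
    by (rule Ck_on_mult[OF m'(2) Suc.IH[OF p(2) Ck_on_SucD[OF Suc.prems(2)] Suc.prems(3)]])
  then show ?case
    by (intro Ck_on_SucI[of _ _ "\<lambda>x h. m' x h * p (m x) 1"] der)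
qed

lemma Ck_on_SucI_real:
  fixes f :: "real \<Rightarrow> real"
  assumes "\<And>x. x \<in> S \<Longrightarrow> (f has_real_derivative f' x) (at x within S)" "Ck_on k S f'"
  shows "Ck_on (Suc k) S f"
proof (rule Ck_on_SucI)
  show "(f has_derivative (\<lambda>h. f' x * h)) (at x within S)" if "x \<in> S" for x
    using assms(1)[OF that] by (simp add: has_field_derivative_def)
  show "Ck_on k S (\<lambda>x. f' x * h)" for h
    using Ck_on_mult[OF assms(2) Ck_on_const] .
qed

lemma Ck_on_inner_self: "Ck_on k S (\<lambda>x::'a::real_inner. x \<bullet> x)"
proof (cases k)
  case 0
  then show ?thesis by (auto intro!: continuous_intros)
next
  case (Suc j)
  have "((\<lambda>x. x \<bullet> x) has_derivative (\<lambda>h. x \<bullet> h + h \<bullet> x)) (at x within S)" for x :: 'a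
    by (auto intro!: derivative_eq_intros)
  moreover have "Ck_on j S (\<lambda>x. x \<bullet> h + h \<bullet> x)" for h
    by (intro Ck_on_bounded_linear bounded_linear_add bounded_linear_inner_left bounded_linear_inner_right)
  ultimately show ?thesis unfolding Suc by (rule Ck_on_SucI)
qed

section \<open>One-sided derivatives on the half line\<close>

lemma at_within_atLeast_neq_bot:
  assumes "(t::real) \<ge> 0"
  shows "at t within {0..} \<noteq> bot"
proof
  assume "at t within {0..} = bot"
  moreover have "at_right t \<le> at t within {0..}"
    by (rule at_le) (use assms in auto)
  ultimately show False by (simp add: bot_unique)
qed

lemma has_derivative_D_half:
  assumes "(f has_derivative L) (at t within {0..})" "t \<ge> 0"
  shows "(f has_real_derivative D_half f t) (at t within {0..})" "D_half f t = L 1"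
proof -
  have "L = (\<lambda>h. h *\<^sub>R L 1)"
  proof
    show "L h = h *\<^sub>R L 1" for h
      using linear_cmul[OF has_derivative_linear[OF assms(1)], of h 1] by simp
  qed
  then have "(f has_vector_derivative L 1) (at t within {0..})"
    using assms(1) unfolding has_vector_derivative_def by argo
  moreover from this show "D_half f t = L 1" unfolding D_half_def
    using vector_derivative_within at_within_atLeast_neq_bot assms(2) by blast
  ultimately show "(f has_real_derivative D_half f t) (at t within {0..})"
    by (simp add: has_real_derivative_iff_has_vector_derivative)
qed

lemma has_real_derivative_D_half:
  assumes "smooth_on {0..} f" "t \<ge> 0"
  shows "(f has_real_derivative D_half f t) (at t within {0..})"
proof -
  have "Ck_on (Suc 0) {0..} f" using assms smooth_on_def by blast
  then obtain f' where "\<And>x. x \<in> {0..} \<Longrightarrow> (f has_derivative f' x) (at x within {0..})"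
    using Ck_on_SucE by blast
  then show ?thesis using has_derivative_D_half(1) assms(2) by (metis atLeast_iff)
qed

lemma smooth_on_D_half:
  assumes "smooth_on {0..} f"
  shows "smooth_on {0..} (D_half f)"
  unfolding smooth_on_def
proof
  fix k
  have "Ck_on (Suc k) {0..} f" using assms smooth_on_def by blast
  then obtain f' where f': "\<And>x. x \<in> {0..} \<Longrightarrow> (f has_derivative f' x) (at x within {0..})"
    "\<And>h. Ck_on k {0..} (\<lambda>x. f' x h)" using Ck_on_SucE by blast
  have "f' t 1 = D_half f t" if "t \<in> {0..}" for t
    using has_derivative_D_half(2)[OF f'(1)] that by simp
  then show "Ck_on k {0..} (D_half f)" by (rule Ck_on_cong[OF f'(2)])
qed

lemma smooth_on_imp_continuous_on: "smooth_on S f \<Longrightarrow> continuous_on S f"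
  using Ck_on_imp_continuous_on smooth_on_def by blast

section \<open>The Laplacian along lines and the comparison principle\<close>

text \<open>The outer \<open>deriv\<close> sees the values of the inner one near 0, so the first
  derivative must be known in a neighbourhood, the second one only at 0.\<close>

lemma deriv_deriv_eqI:
  assumes "\<forall>\<^sub>F t in nhds 0. (\<phi> has_real_derivative \<phi>' t) (at t)"
    and "(\<phi>' has_real_derivative D) (at 0)"
  shows "(deriv ^^ 2) \<phi> (0::real) = D"
proof -
  have "\<forall>\<^sub>F t in nhds 0. deriv \<phi> t = \<phi>' t"
    using assms(1) by eventually_elim (rule DERIV_imp_deriv)
  then have "deriv (deriv \<phi>) 0 = deriv \<phi>' 0" by (intro deriv_cong_ev) auto
  then show ?thesis using DERIV_imp_deriv[OF assms(2)] by (simp add: numeral_2_eq_2)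
qed

text \<open>If \<open>D\<close> were positive, \<open>\<phi>'\<close> would vanish at the maximum
  and be positive just to the right of it, and the mean value theorem would give a larger value of
  \<open>\<phi>\<close>.\<close>

lemma second_derivative_nonpos_at_max:
  fixes \<phi> :: "real \<Rightarrow> real"
  assumes "\<forall>\<^sub>F t in nhds 0. (\<phi> has_real_derivative \<phi>' t) (at t)"
    and "(\<phi>' has_real_derivative D) (at 0)"
    and "\<forall>\<^sub>F t in nhds 0. \<phi> t \<le> \<phi> 0"
  shows "D \<le> 0"
proof (rule ccontr)
  assume "\<not> D \<le> 0"
  obtain d where d: "d > 0"
    "\<And>t. \<bar>t\<bar> < d \<Longrightarrow> (\<phi> has_real_derivative \<phi>' t) (at t) \<and> \<phi> t \<le> \<phi> 0"
    using eventually_conj[OF assms(1,3)] unfolding eventually_nhds_metric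
    by (auto simp: dist_real_def)
  have "\<phi>' 0 = 0"
    by (rule DERIV_local_max[of \<phi> _ 0 d]) (use d in \<open>auto simp: abs_minus_commute\<close>)
  obtain e where e: "e > 0" "\<And>h. 0 < h \<Longrightarrow> h < e \<Longrightarrow> \<phi>' 0 < \<phi>' h"
    using DERIV_pos_inc_right[OF assms(2)] \<open>\<not> D \<le> 0\<close> by auto
  define h where "h = min d e / 2"
  have h: "0 < h" "h < d" "h < e" using d(1) e(1) by (auto simp: h_def)
  obtain z where z: "0 < z" "z < h" "\<phi> h - \<phi> 0 = (h - 0) * \<phi>' z"
    using MVT2[of 0 h \<phi> \<phi>'] d(2) h by force
  have "\<phi>' z > 0" using e(2)[of z] z h \<open>\<phi>' 0 = 0\<close> by simp
  then have "\<phi> h > \<phi> 0" using z h by (smt (verit) mult_pos_pos)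
  then show False using d(2)[of h] h by simp
qed

lemma has_derivative_along_line:
  fixes u :: "'a::real_normed_vector \<Rightarrow> real"
  assumes "(u has_derivative L) (at (x + t *\<^sub>R b))"
  shows "((\<lambda>t. u (x + t *\<^sub>R b)) has_real_derivative L b) (at t)"
proof -
  have lin: "((\<lambda>t. x + t *\<^sub>R b) has_derivative (\<lambda>h. h *\<^sub>R b)) (at t)"
    by (auto intro!: derivative_eq_intros)
  have "((\<lambda>t. u (x + t *\<^sub>R b)) has_derivative (\<lambda>h. L (h *\<^sub>R b))) (at t)"
    by (rule has_derivative_compose[OF lin assms])
  moreover have "L (h *\<^sub>R b) = L b * h" for h
    using linear_cmul[OF has_derivative_linear[OF assms]] by simp
  ultimately show ?thesis unfolding has_field_derivative_def by simp
qed

lemma line_in_open: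
  fixes x b :: "'a::real_normed_vector"
  assumes "open S" "x \<in> S"
  shows "\<forall>\<^sub>F t in nhds 0. x + t *\<^sub>R b \<in> S"
proof -
  have "open ((\<lambda>t::real. x + t *\<^sub>R b) -` S)"
    by (rule open_vimage[OF assms(1)]) (auto intro!: continuous_intros)
  then have "\<forall>\<^sub>F t in nhds 0. t \<in> (\<lambda>t. x + t *\<^sub>R b) -` S"
    by (rule eventually_nhds_in_open) (use assms in auto)
  then show ?thesis by simp
qed

text \<open>\<open>laplacian\<close> is built from the total operator \<open>deriv\<close>; this
  certifies that on smooth functions its summands are genuine second derivatives.\<close>

lemma smooth_on_line_derivatives:
  fixes u :: "'a::real_normed_vector \<Rightarrow> real"
  assumes "smooth_on S u" "open S" "x \<in> S"
  obtains \<phi>' where "\<forall>\<^sub>F t in nhds 0. ((\<lambda>t. u (x + t *\<^sub>R b)) has_real_derivative \<phi>' t) (at t)"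
    "(\<phi>' has_real_derivative (deriv ^^ 2) (\<lambda>t. u (x + t *\<^sub>R b)) 0) (at 0)"
proof -
  have "Ck_on (Suc (Suc 0)) S u" using assms(1) smooth_on_def by blast
  then obtain u' where u': "\<And>y. y \<in> S \<Longrightarrow> (u has_derivative u' y) (at y within S)"
     "\<And>h. Ck_on (Suc 0) S (\<lambda>y. u' y h)" using Ck_on_SucE by blast
  then obtain u'' where u'': "\<And>y. y \<in> S \<Longrightarrow> ((\<lambda>y. u' y b) has_derivative u'' y) (at y within S)"
    using Ck_on_SucE by metis
  let ?p = "\<lambda>t. u' (x + t *\<^sub>R b) b"
  have 1: "\<forall>\<^sub>F t in nhds 0. ((\<lambda>t. u (x + t *\<^sub>R b)) has_real_derivative ?p t) (at t)"
    using line_in_open[OF assms(2,3), of b]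
  proof eventually_elim
    case (elim t)
    show ?case
      by (rule has_derivative_along_line) (use u'(1)[OF elim] at_within_open[OF elim assms(2)] in simp)
  qed
  have "((\<lambda>y. u' y b) has_derivative u'' x) (at (x + 0 *\<^sub>R b))"
    using u''[OF assms(3)] at_within_open[OF assms(3,2)] by simp
  then have 2: "(?p has_real_derivative u'' x b) (at 0)"
    by (rule has_derivative_along_line)
  show ?thesis using that[OF 1] 2 deriv_deriv_eqI[OF 1 2] by simp
qed

text \<open>The perturbation by \<open>\<epsilon> * (x \<bullet> x)\<close> makes the difference strictly subharmonic.\<close>

lemma laplacian_comparison:
  fixes u w :: "'a::euclidean_space \<Rightarrow> real"
  assumes su: "smooth_on (ball 0 1) u" and sw: "smooth_on (ball 0 1) w"
    and cu: "continuous_on (cball 0 1) u" and cw: "continuous_on (cball 0 1) w"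
    and lap: "\<And>x. x \<in> ball 0 1 \<Longrightarrow> laplacian u x \<le> laplacian w x"
    and bd: "\<And>x. norm x = 1 \<Longrightarrow> w x \<le> u x"
    and x0: "x0 \<in> cball 0 1"
  shows "w x0 \<le> u x0"
proof (rule ccontr)
  assume "\<not> w x0 \<le> u x0"
  \<comment> \<open>Half of the assumed violation: on the sphere \<open>z\<close> is at most
    \<open>e\<close>, at \<open>x0\<close> it is at least \<open>2 * e\<close>, so the maximum of
    \<open>z\<close> is interior. There all pure second derivatives of \<open>z\<close> are
    nonpositive, whereas their sum is positive.\<close>
  define e where "e = (w x0 - u x0) / 2"
  have e: "e > 0" using \<open>\<not> w x0 \<le> u x0\<close> by (simp add: e_def)
  define z where "z = (\<lambda>x. w x - u x + e * (x \<bullet> x))"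
  have "continuous_on (cball 0 1) z" unfolding z_def
    by (intro continuous_intros cu cw)
  then obtain y where y: "y \<in> cball 0 1" "\<And>x. x \<in> cball 0 1 \<Longrightarrow> z x \<le> z y"
    using continuous_attains_sup[of "cball 0 1" z] compact_cball x0 by blast
  have "norm y \<noteq> 1"
  proof
    assume n: "norm y = 1"
    have "z x0 \<ge> 2 * e" using e by (simp add: z_def e_def)
    moreover have "z y \<le> e" using bd[OF n] n by (simp add: z_def dot_square_norm)
    ultimately show False using y(2)[OF x0] e by simp
  qed
  then have yb: "y \<in> ball 0 1" using y(1) by simp
  have "(deriv ^^ 2) (\<lambda>t. w (y + t *\<^sub>R b)) 0 - (deriv ^^ 2) (\<lambda>t. u (y + t *\<^sub>R b)) 0 + 2 * e \<le> 0"
    if b: "b \<in> Basis" for b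
  proof -
    obtain pw where pw: "\<forall>\<^sub>F t in nhds 0. ((\<lambda>t. w (y + t *\<^sub>R b)) has_real_derivative pw t) (at t)"
      "(pw has_real_derivative (deriv ^^ 2) (\<lambda>t. w (y + t *\<^sub>R b)) 0) (at 0)"
      using smooth_on_line_derivatives[OF sw open_ball yb] .
    obtain pu where pu: "\<forall>\<^sub>F t in nhds 0. ((\<lambda>t. u (y + t *\<^sub>R b)) has_real_derivative pu t) (at t)"
      "(pu has_real_derivative (deriv ^^ 2) (\<lambda>t. u (y + t *\<^sub>R b)) 0) (at 0)"
      using smooth_on_line_derivatives[OF su open_ball yb] .
    have sq: "(y + t *\<^sub>R b) \<bullet> (y + t *\<^sub>R b) = y \<bullet> y + 2 * t * (y \<bullet> b) + t\<^sup>2" for t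
      using b by (simp add: algebra_simps inner_commute power2_eq_square)
    show ?thesis
    proof (rule second_derivative_nonpos_at_max)
      show "\<forall>\<^sub>F t in nhds 0. ((\<lambda>t. z (y + t *\<^sub>R b)) has_real_derivative
             (pw t - pu t + e * (2 * (y \<bullet> b) + 2 * t))) (at t)"
        using pw(1) pu(1)
        by eventually_elim (unfold z_def sq, auto intro!: derivative_eq_intros)
      show "((\<lambda>t. pw t - pu t + e * (2 * (y \<bullet> b) + 2 * t)) has_real_derivative
         (deriv ^^ 2) (\<lambda>t. w (y + t *\<^sub>R b)) 0 - (deriv ^^ 2) (\<lambda>t. u (y + t *\<^sub>R b)) 0 + 2 * e) (at 0)"
        by (rule derivative_eq_intros pw(2) pu(2) refl)+ simp
      show "\<forall>\<^sub>F t in nhds 0. z (y + t *\<^sub>R b) \<le> z (y + 0 *\<^sub>R b)"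
        using line_in_open[OF open_ball yb, of b] by eventually_elim (use y(2) in auto)
    qed
  qed
  then have "(\<Sum>b\<in>Basis. (deriv ^^ 2) (\<lambda>t. w (y + t *\<^sub>R b)) 0 - (deriv ^^ 2) (\<lambda>t. u (y + t *\<^sub>R b)) 0 + 2 * e) \<le> 0"
    by (rule sum_nonpos)
  then have "laplacian w y - laplacian u y + 2 * e * DIM('a) \<le> 0"
    by (simp add: laplacian_def sum.distrib sum_subtractf mult.commute)
  moreover have "2 * e * DIM('a) > 0" using e by simp
  ultimately show False using lap[OF yb] by linarith
qed

lemma inner_self_less_1_iff: "x \<bullet> x < 1 \<longleftrightarrow> norm (x::'a::real_inner) < 1"
  by (simp add: dot_square_norm abs_square_less_1)

text \<open>Along a coordinate line x . x is a quadratic polynomial, so the chain rule is applied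
  twice. Unlike u_rr + (N-1) u_r / r, the result has no singular coefficient, and the centre is not
  exceptional.\<close>

lemma laplacian_radial:
  fixes x :: "'a::euclidean_space" and \<phi> :: "real \<Rightarrow> real"
  assumes d1: "\<And>t. t \<in> {0..1} \<Longrightarrow> (\<phi> has_real_derivative \<phi>' t) (at t within {0..1})"
    and d2: "\<And>t. t \<in> {0..1} \<Longrightarrow> (\<phi>' has_real_derivative \<phi>'' t) (at t within {0..1})"
    and x: "x \<in> ball 0 1"
  shows "laplacian (\<lambda>x. \<phi> (x \<bullet> x)) x = 4 * (x \<bullet> x) * \<phi>'' (x \<bullet> x) + 2 * real DIM('a) * \<phi>' (x \<bullet> x)"
proof -
  have "(deriv ^^ 2) (\<lambda>t. \<phi> ((x + t *\<^sub>R b) \<bullet> (x + t *\<^sub>R b))) 0 = 4 * (x \<bullet> b)\<^sup>2 * \<phi>'' (x \<bullet> x) + 2 * \<phi>' (x \<bullet> x)"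
    if b: "b \<in> Basis" for b
  proof -
    define s where "s t = (x + t *\<^sub>R b) \<bullet> (x + t *\<^sub>R b)" for t
    have s_eq: "s = (\<lambda>t. x \<bullet> x + 2 * t * (x \<bullet> b) + t\<^sup>2)"
      using b by (auto simp: s_def algebra_simps inner_commute power2_eq_square)
    define J where "J = {t. x + t *\<^sub>R b \<in> ball 0 1}"
    have "open J" unfolding J_def 
      using open_vimage[OF open_ball, of "\<lambda>t::real. x + t *\<^sub>R b" 0 1]
      by (simp add: vimage_def continuous_intros)
    have "0 \<in> J" using x by (simp add: J_def)
    have sJ: "s ` J \<subseteq> {0..1}" by (auto simp: J_def s_def less_imp_le inner_self_less_1_iff)
    have ds: "(s has_real_derivative 2 * (x \<bullet> b) + 2 * t) (at t)" for t
      unfolding s_eq by (auto intro!: derivative_eq_intros)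
    \<comment> \<open>At the centre \<open>s\<close> attains the endpoint 0 of the domain of the
      profile. The chain rule is therefore applied within the image of \<open>J\<close>, which lies
      in \<open>{0..1}\<close>; openness of \<open>J\<close> then gives a two-sided
      derivative.\<close>
    have comp: "((\<lambda>t. \<psi> (s t)) has_real_derivative \<psi>' * (2 * (x \<bullet> b) + 2 * t)) (at t)"
      if "t \<in> J" "(\<psi> has_real_derivative \<psi>') (at (s t) within {0..1})" for t \<psi> \<psi>'
    proof -
      have "(\<psi> has_real_derivative \<psi>') (at (s t) within s ` J)"
        using DERIV_subset that(2) sJ by blast
      then have "((\<psi> \<circ> s) has_real_derivative \<psi>' * (2 * (x \<bullet> b) + 2 * t)) (at t within J)"
        by (rule DERIV_image_chain) (rule has_field_derivative_at_within[OF ds])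
      then show ?thesis using at_within_open[OF that(1) \<open>open J\<close>] by (simp add: o_def)
    qed
    have "\<forall>\<^sub>F t in nhds 0. t \<in> J" using \<open>open J\<close> \<open>0 \<in> J\<close> by (rule eventually_nhds_in_open)
    then have 1: "\<forall>\<^sub>F t in nhds 0. ((\<lambda>t. \<phi> (s t)) has_real_derivative \<phi>' (s t) * (2 * (x \<bullet> b) + 2 * t)) (at t)"
      by eventually_elim (use comp d1 sJ in blast)
    have "((\<lambda>t. \<phi>' (s t)) has_real_derivative \<phi>'' (s 0) * (2 * (x \<bullet> b) + 2 * 0)) (at 0)"
      using comp[OF \<open>0 \<in> J\<close>] d2 sJ \<open>0 \<in> J\<close> by blast
    then have 2: "((\<lambda>t. \<phi>' (s t) * (2 * (x \<bullet> b) + 2 * t)) has_real_derivative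
        4 * (x \<bullet> b)\<^sup>2 * \<phi>'' (x \<bullet> x) + 2 * \<phi>' (x \<bullet> x)) (at 0)"
      by (auto intro!: derivative_eq_intros simp: s_def power2_eq_square algebra_simps)
    show ?thesis using deriv_deriv_eqI[OF 1 2] by (simp add: s_def)
  qed
  then have "laplacian (\<lambda>x. \<phi> (x \<bullet> x)) x = (\<Sum>b\<in>Basis. 4 * (x \<bullet> b)\<^sup>2 * \<phi>'' (x \<bullet> x) + 2 * \<phi>' (x \<bullet> x))"
    unfolding laplacian_def by (rule sum.cong[OF refl])
  also have "\<dots> = 4 * (\<Sum>b\<in>Basis. (x \<bullet> b) * (x \<bullet> b)) * \<phi>'' (x \<bullet> x) + 2 * real DIM('a) * \<phi>' (x \<bullet> x)"
    by (simp add: sum.distrib sum_distrib_left sum_distrib_right power2_eq_square mult.assoc)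
  also have "(\<Sum>b\<in>Basis. (x \<bullet> b) * (x \<bullet> b)) = x \<bullet> x"
    by (rule euclidean_inner[symmetric])
  finally show ?thesis .
qed

section \<open>Radial solutions of the Poisson equation\<close>

text \<open>With \<open>m = N - 1\<close> and t = r^2 this is r^(-N) times the integral of
  \<rho>^(N-1) H(\<rho>^2) over [0,r], that is, -u_r / r for the radial solution of -\<Delta>u =
  H(|x|^2). Scaling to a fixed interval removes the division by zero at the centre and permits
  differentiation under the integral.\<close>

definition ball_mean :: "nat \<Rightarrow> (real \<Rightarrow> real) \<Rightarrow> real \<Rightarrow> real" where
  "ball_mean m H t = integral {0..1} (\<lambda>s. s ^ m * H (t * s\<^sup>2))"

text \<open>In the variable \<open>t = |x|\<^sup>2\<close> a smooth radial function is smooth up to the centre, and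
  \<open>w(x) = radial_solve N H (x \<bullet> x)\<close> solves \<open>-\<Delta>w = H(x \<bullet> x)\<close> in the unit ball of an
  \<open>N\<close>-dimensional space, with zero boundary values.\<close>

definition radial_solve :: "nat \<Rightarrow> (real \<Rightarrow> real) \<Rightarrow> real \<Rightarrow> real" where
  "radial_solve N H t = integral {t..1} (ball_mean (N - 1) H) / 2"

lemma mult_square_in_unit: 
  fixes t s :: real
  assumes "t \<in> {0..1}" "s \<in> {0..1}" 
  shows "t * s\<^sup>2 \<in> {0..1}"
  using assms by (auto intro!: mult_le_one power_le_one)

lemma continuous_on_ball_mean_integrand:
  assumes "continuous_on {0..1} H"
  shows "continuous_on ({0..1} \<times> cbox 0 1) (\<lambda>(t, s::real). s ^ m * H (t * s\<^sup>2))"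
proof -
  have "continuous_on ({0..1} \<times> cbox 0 1) (\<lambda>p. snd p ^ m * H (fst p * (snd p)\<^sup>2))"
    by (intro continuous_intros continuous_on_compose2[OF assms])
       (auto intro!: mult_le_one power_le_one)
  then show ?thesis by (simp add: case_prod_beta)
qed

lemma ball_mean_integrable:
  fixes H :: "real \<Rightarrow> real"
  assumes "continuous_on {0..1} H" "t \<in> {0..1}"
  shows "(\<lambda>s. s ^ m * H (t * s\<^sup>2)) integrable_on {0..1}"
proof (rule integrable_continuous_real)
  show "continuous_on {0..1} (\<lambda>s. s ^ m * H (t * s\<^sup>2))"
    by (intro continuous_intros continuous_on_compose2[OF assms(1)])
       (use mult_square_in_unit[OF assms(2)] in blast)+
qed

lemma continuous_on_ball_mean:
  assumes "continuous_on {0..1} H"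
  shows "continuous_on {0..1} (ball_mean m H)"
  using integral_continuous_on_param[OF continuous_on_ball_mean_integrand[OF assms]]
  by (simp add: ball_mean_def[abs_def])

text \<open>The inner derivative of t s^2 contributes the factor s^2, which raises the index by 2.
  The derivative is again a ball mean, whence smoothness of all orders up to the centre.\<close>

lemma ball_mean_derivative:
  assumes d: "\<And>t. t \<in> {0..1} \<Longrightarrow> (H has_real_derivative H' t) (at t within {0..1})"
    and c: "continuous_on {0..1} H'" and t: "t \<in> {0..1}"
  shows "(ball_mean m H has_real_derivative ball_mean (m + 2) H' t) (at t within {0..1})"
proof -
  have cH: "continuous_on {0..1} H" using d DERIV_continuous_on by blast
  have "((\<lambda>t. integral (cbox 0 1) (\<lambda>s. s ^ m * H (t * s\<^sup>2))) has_real_derivative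
          integral (cbox 0 1) (\<lambda>s. s ^ (m + 2) * H' (t * s\<^sup>2))) (at t within {0..1})"
  proof (rule leibniz_rule_field_derivative[OF _ _ continuous_on_ball_mean_integrand[OF c] t])
    fix t s :: real
    assume ts: "t \<in> {0..1}" "s \<in> cbox 0 1"
    have "(H has_real_derivative H' (t * s\<^sup>2)) (at (t * s\<^sup>2) within (\<lambda>t. t * s\<^sup>2) ` {0..1})"
      by (rule DERIV_subset[OF d]) (use ts mult_square_in_unit in auto)
    moreover have "((\<lambda>t. t * s\<^sup>2) has_real_derivative s\<^sup>2) (at t within {0..1})"
      by (auto intro!: derivative_eq_intros)
    ultimately have "((H \<circ> (\<lambda>t. t * s\<^sup>2)) has_real_derivative H' (t * s\<^sup>2) * s\<^sup>2) (at t within {0..1})"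
      by (rule DERIV_image_chain)
    then have "((\<lambda>t. s ^ m * H (t * s\<^sup>2)) has_real_derivative s ^ m * (H' (t * s\<^sup>2) * s\<^sup>2)) (at t within {0..1})"
      unfolding o_def by (rule DERIV_cmult)
    then show "((\<lambda>t. s ^ m * H (t * s\<^sup>2)) has_real_derivative s ^ (m + 2) * H' (t * s\<^sup>2)) (at t within {0..1})"
      by (simp only: power_add mult_ac)
  qed (use ball_mean_integrable[OF cH] in auto)
  then show ?thesis by (simp add: ball_mean_def[abs_def])
qed

text \<open>The integrand on the left is the s-derivative of s^N H(t s^2), whose boundary value at s
  = 0 vanishes as N >= 1. This is the Poisson equation in divergence form.\<close>

lemma ball_mean_divergence_identity:
  assumes d: "\<And>t. t \<in> {0..1} \<Longrightarrow> (H has_real_derivative H' t) (at t within {0..1})"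
    and c: "continuous_on {0..1} H'" and t: "t \<in> {0..1}" and N: "N \<ge> 1"
  shows "N * ball_mean (N - 1) H t + 2 * t * ball_mean (N + 1) H' t = H t"
proof -
  have cH: "continuous_on {0..1} H" using d DERIV_continuous_on by blast
  have der: "((\<lambda>s. s ^ N * H (t * s\<^sup>2)) has_vector_derivative
        (N * (s ^ (N - 1) * H (t * s\<^sup>2)) + 2 * t * (s ^ (N + 1) * H' (t * s\<^sup>2)))) (at s within {0..1})"
    if s: "s \<in> {0..1}" for s
  proof -
    have "(H has_real_derivative H' (t * s\<^sup>2)) (at (t * s\<^sup>2) within (\<lambda>s. t * s\<^sup>2) ` {0..1})"
      by (rule DERIV_subset[OF d]) (use t s mult_square_in_unit in auto)
    moreover have "((\<lambda>s. t * s\<^sup>2) has_real_derivative 2 * t * s) (at s within {0..1})"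
      by (auto intro!: derivative_eq_intros)
    ultimately have "((H \<circ> (\<lambda>s. t * s\<^sup>2)) has_real_derivative H' (t * s\<^sup>2) * (2 * t * s)) (at s within {0..1})"
      by (rule DERIV_image_chain)
    then have D: "((\<lambda>s. H (t * s\<^sup>2)) has_real_derivative H' (t * s\<^sup>2) * (2 * t * s)) (at s within {0..1})"
      by (simp add: o_def)
    have "((\<lambda>s. s ^ N * H (t * s\<^sup>2)) has_real_derivative
        (N * (s ^ (N - 1) * H (t * s\<^sup>2)) + 2 * t * (s ^ (N + 1) * H' (t * s\<^sup>2)))) (at s within {0..1})"
      by (rule DERIV_cong[OF DERIV_mult[OF DERIV_pow D]]) (simp add: algebra_simps)
    then show ?thesis by (simp add: has_real_derivative_iff_has_vector_derivative)
  qed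
  have 1: "((\<lambda>s. N * (s ^ (N - 1) * H (t * s\<^sup>2)) + 2 * t * (s ^ (N + 1) * H' (t * s\<^sup>2))) has_integral
      (1 ^ N * H (t * 1\<^sup>2) - 0 ^ N * H (t * 0\<^sup>2))) {0..1}"
    by (rule fundamental_theorem_of_calculus[OF _ der]) auto
  have 2: "((\<lambda>s. N * (s ^ (N - 1) * H (t * s\<^sup>2)) + 2 * t * (s ^ (N + 1) * H' (t * s\<^sup>2))) has_integral
      (N * ball_mean (N - 1) H t + 2 * t * ball_mean (N + 1) H' t)) {0..1}"
    unfolding ball_mean_def
    by (intro has_integral_add has_integral_mult_right integrable_integral ball_mean_integrable cH c t)
  show ?thesis using has_integral_unique[OF 1 2] N by (simp add: zero_power)
qed

lemma Ck_on_SucE_real: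
  fixes f :: "real \<Rightarrow> real"
  assumes "Ck_on (Suc k) S f"
  obtains f' where "\<And>x. x \<in> S \<Longrightarrow> (f has_real_derivative f' x) (at x within S)" "Ck_on k S f'"
proof -
  obtain L where L: "\<And>x. x \<in> S \<Longrightarrow> (f has_derivative L x) (at x within S)"
      "\<And>h. Ck_on k S (\<lambda>x. L x h)" using assms Ck_on_SucE by blast
  have "(f has_real_derivative L x 1) (at x within S)" if x: "x \<in> S" for x
  proof -
    have "L x = (\<lambda>h. L x 1 * h)"
    proof
      show "L x h = L x 1 * h" for h
        using linear_cmul[OF has_derivative_linear[OF L(1)[OF x]], of h 1] by simp
    qed
    then show ?thesis using L(1)[OF x] unfolding has_field_derivative_def by argo
  qed
  then show ?thesis by (rule that[OF _ L(2)])
qed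

lemma ball_mean_Ck_on:
  assumes "Ck_on k {0..1} H"
  shows "Ck_on k {0..1} (ball_mean m H)"
  using assms
proof (induction k arbitrary: H m)
  case 0
  then show ?case using continuous_on_ball_mean by simp
next
  case (Suc k)
  then obtain H' where H': "\<And>x. x \<in> {0..1} \<Longrightarrow> (H has_real_derivative H' x) (at x within {0..1})"
      "Ck_on k {0..1} H'" using Ck_on_SucE_real by blast
  show ?case
    by (rule Ck_on_SucI_real[OF ball_mean_derivative[OF H'(1) Ck_on_imp_continuous_on[OF H'(2)]]
          Suc.IH[OF H'(2)]])
qed

text \<open>Since t = r^2, d/dt is d/dr divided by 2 r; the factor 1/2 makes
  \<open>ball_mean (N - 1) H\<close> equal to -u_r / r.\<close>

lemma radial_solve_derivative:
  assumes "continuous_on {0..1} H" "t \<in> {0..1}"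
  shows "(radial_solve N H has_real_derivative - ball_mean (N - 1) H t / 2) (at t within {0..1})"
  unfolding radial_solve_def[abs_def]
  by (rule DERIV_cdivide[OF integral_has_real_derivative'[OF continuous_on_ball_mean[OF assms(1)] assms(2)]])

text \<open>A gain of one derivative is all that the bootstrap in \<open>radial_solutionI\<close>
  requires.\<close>

lemma radial_solve_Ck_on:
  assumes "Ck_on k {0..1} H"
  shows "Ck_on (Suc k) {0..1} (radial_solve N H)"
proof (rule Ck_on_SucI_real)
  show "(radial_solve N H has_real_derivative (- 1 / 2) * ball_mean (N - 1) H t) (at t within {0..1})"
    if "t \<in> {0..1}" for t
    using radial_solve_derivative[OF Ck_on_imp_continuous_on[OF assms] that] by simp
  show "Ck_on k {0..1} (\<lambda>t. (- 1 / 2) * ball_mean (N - 1) H t)"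
    by (rule Ck_on_mult[OF Ck_on_const ball_mean_Ck_on[OF assms]])
qed

lemma radial_solve_at_1 [simp]: "radial_solve N H 1 = 0"
  by (simp add: radial_solve_def)

lemma ball_mean_mono:
  assumes "continuous_on {0..1} H" "continuous_on {0..1} H'"
    and "\<And>s. s \<in> {0..t} \<Longrightarrow> H s \<le> H' s" and t: "t \<in> {0..1}"
  shows "ball_mean m H t \<le> ball_mean m H' t"
  unfolding ball_mean_def
proof (rule integral_le)
  show "s ^ m * H (t * s\<^sup>2) \<le> s ^ m * H' (t * s\<^sup>2)" if "s \<in> {0..1}" for s
    by (rule mult_left_mono[OF assms(3)])
       (use that t in \<open>auto intro!: mult_left_le power_le_one\<close>)
qed (use ball_mean_integrable assms in auto)

lemma ball_mean_const: "ball_mean m (\<lambda>_. c) t = c / (real m + 1)"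
proof -
  have "((\<lambda>s. s ^ m * c) has_integral (1 ^ Suc m / (real m + 1) * c - 0 ^ Suc m / (real m + 1) * c)) {0..1::real}"
  proof (rule fundamental_theorem_of_calculus)
    fix s :: real
    have "((\<lambda>s. s ^ Suc m / (real m + 1) * c) has_real_derivative
        (real (Suc m) * s ^ m) / (real m + 1) * c) (at s within {0..1})"
      by (rule DERIV_cmult_right[OF DERIV_cdivide]) (rule DERIV_cong[OF DERIV_pow], simp)
    also have "(real (Suc m) * s ^ m) / (real m + 1) * c = s ^ m * c"
      by (simp add: add.commute)
    finally show "((\<lambda>s. s ^ Suc m / (real m + 1) * c) has_vector_derivative s ^ m * c) (at s within {0..1})"
      by (simp add: has_real_derivative_iff_has_vector_derivative)
  qed simp
  then show ?thesis unfolding ball_mean_def by (auto dest: integral_unique)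
qed

lemma ball_mean_nonneg:
  assumes "continuous_on {0..1} H" "\<And>s. s \<in> {0..1} \<Longrightarrow> 0 \<le> H s" "t \<in> {0..1}"
  shows "0 \<le> ball_mean m H t"
  using ball_mean_mono[of "\<lambda>_. 0" H t m] assms by (auto simp: ball_mean_const)

lemma radial_solve_mono:
  assumes "continuous_on {0..1} H" "continuous_on {0..1} H'"
    and "\<And>s. s \<in> {0..1} \<Longrightarrow> H s \<le> H' s" and t: "t \<in> {0..1}"
  shows "radial_solve N H t \<le> radial_solve N H' t"
proof -
  have "integral {t..1} (ball_mean (N - 1) H) \<le> integral {t..1} (ball_mean (N - 1) H')"
  proof (rule integral_le)
    show "ball_mean (N - 1) H integrable_on {t..1}" "ball_mean (N - 1) H' integrable_on {t..1}"
      using assms t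
      by (auto intro!: integrable_continuous_real continuous_on_subset[OF continuous_on_ball_mean])
    show "ball_mean (N - 1) H s \<le> ball_mean (N - 1) H' s" if "s \<in> {t..1}" for s
      by (rule ball_mean_mono) (use that t assms in auto)
  qed
  then show ?thesis by (simp add: radial_solve_def)
qed

lemma radial_solve_nonneg:
  assumes "continuous_on {0..1} H" "\<And>s. s \<in> {0..1} \<Longrightarrow> 0 \<le> H s" "t \<in> {0..1}"
  shows "0 \<le> radial_solve N H t"
proof -
  have "radial_solve N (\<lambda>_. 0) t = 0" by (simp add: radial_solve_def ball_mean_const[abs_def])
  then show ?thesis using radial_solve_mono[of "\<lambda>_. 0" H t N] assms by simp
qed

text \<open>Dominated convergence is applied first in the ball mean and then in the outer integral.
  The pointwise limit \<open>H'\<close> is not assumed continuous; the integrability obtained on the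
  way still makes \<open>radial_solve N H'\<close> continuous, which starts the bootstrap.\<close>

lemma radial_solve_limit:
  fixes H :: "nat \<Rightarrow> real \<Rightarrow> real"
  assumes c: "\<And>n. continuous_on {0..1} (H n)"
    and b: "\<And>n s. s \<in> {0..1} \<Longrightarrow> \<bar>H n s\<bar> \<le> B"
    and lim: "\<And>s. s \<in> {0..1} \<Longrightarrow> (\<lambda>n. H n s) \<longlonglongrightarrow> H' s"
  shows "t \<in> {0..1} \<Longrightarrow> (\<lambda>n. radial_solve N (H n) t) \<longlonglongrightarrow> radial_solve N H' t"
    and "continuous_on {0..1} (radial_solve N H')"
proof -
  have mean: "(\<lambda>n. ball_mean (N - 1) (H n) t) \<longlonglongrightarrow> ball_mean (N - 1) H' t" if t: "t \<in> {0..1}" for t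
    unfolding ball_mean_def
  proof (rule dominated_convergence(2)[where h = "\<lambda>_. B"])
    show "norm (s ^ (N - 1) * H n (t * s\<^sup>2)) \<le> B" if s: "s \<in> {0..1}" for n s
    proof -
      have "\<bar>s ^ (N - 1)\<bar> * \<bar>H n (t * s\<^sup>2)\<bar> \<le> 1 * B"
        by (intro mult_mono b mult_square_in_unit t s) (use s in \<open>auto simp: power_abs intro!: power_le_one\<close>)
      then show ?thesis by (simp add: abs_mult)
    qed
    show "(\<lambda>n. s ^ (N - 1) * H n (t * s\<^sup>2)) \<longlonglongrightarrow> s ^ (N - 1) * H' (t * s\<^sup>2)" if s: "s \<in> {0..1}" for s
      by (intro tendsto_intros lim mult_square_in_unit t s)
  qed (use ball_mean_integrable c t in auto)
  have bm: "\<bar>ball_mean (N - 1) (H n) t\<bar> \<le> \<bar>B\<bar>" if t: "t \<in> {0..1}" for n t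
  proof -
    have "ball_mean (N - 1) (H n) t \<le> ball_mean (N - 1) (\<lambda>_. \<bar>B\<bar>) t"
      by (rule ball_mean_mono[OF c _ _ t]) (use t b[of _ n] in \<open>force simp: abs_le_iff\<close>)+
    moreover have "ball_mean (N - 1) (\<lambda>_. - \<bar>B\<bar>) t \<le> ball_mean (N - 1) (H n) t"
      by (rule ball_mean_mono[OF _ c _ t]) (use t b[of _ n] in \<open>force simp: abs_le_iff\<close>)+
    moreover have "\<bar>B\<bar> / (real (N - 1) + 1) \<le> \<bar>B\<bar>"
      by (simp add: divide_le_eq distrib_left)
    ultimately show ?thesis by (simp only: ball_mean_const abs_le_iff) (simp add: minus_divide_left[symmetric])
  qed
  have ci: "ball_mean (N - 1) (H n) integrable_on {t..1}" if "t \<in> {0..1}" for n t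
    using that
    by (auto intro!: integrable_continuous_real continuous_on_subset[OF continuous_on_ball_mean[OF c]])
  have dc: "ball_mean (N - 1) H' integrable_on {t..1}"
      "(\<lambda>n. integral {t..1} (ball_mean (N - 1) (H n))) \<longlonglongrightarrow> integral {t..1} (ball_mean (N - 1) H')"
    if t: "t \<in> {0..1}" for t
    using dominated_convergence[of "\<lambda>n. ball_mean (N - 1) (H n)" "{t..1}" "\<lambda>_. \<bar>B\<bar>" "ball_mean (N - 1) H'"]
      ci[OF t] bm mean t by auto
  show "(\<lambda>n. radial_solve N (H n) t) \<longlonglongrightarrow> radial_solve N H' t" if "t \<in> {0..1}"
    unfolding radial_solve_def by (intro tendsto_intros dc that) simp
  show "continuous_on {0..1} (radial_solve N H')"
    unfolding radial_solve_def[abs_def]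
    by (intro continuous_intros indefinite_integral_continuous_1' dc) auto
qed

lemma smooth_on_radial:
  fixes \<phi> :: "real \<Rightarrow> real"
  assumes "smooth_on {0..1} \<phi>"
  shows "smooth_on (ball 0 1) (\<lambda>x::'a::euclidean_space. \<phi> (x \<bullet> x))"
  unfolding smooth_on_def
proof
  fix k
  show "Ck_on k (ball 0 1) (\<lambda>x::'a. \<phi> (x \<bullet> x))"
    by (rule Ck_on_compose[OF _ Ck_on_inner_self])
       (use assms in \<open>auto simp: smooth_on_def less_imp_le inner_self_less_1_iff\<close>)
qed

lemma inner_self_in_unit: "norm (x::'a::real_inner) \<le> 1 \<Longrightarrow> x \<bullet> x \<in> {0..1}"
  by (simp add: dot_square_norm power_le_one)

lemma continuous_on_radial:
  assumes "continuous_on {0..1} (\<phi> :: real \<Rightarrow> real)"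
  shows "continuous_on (cball 0 1) (\<lambda>x::'a::euclidean_space. \<phi> (x \<bullet> x))"
  by (rule continuous_on_compose2[OF assms]) (use inner_self_in_unit in \<open>auto intro!: continuous_intros\<close>)

text \<open>The two terms of \<open>laplacian_radial\<close> become, up to sign, those of
  \<open>ball_mean_divergence_identity\<close>. The equation for \<open>U\<close> is assumed on
  \<open>{0..1}\<close> only, because fixed points are known only there.\<close>

lemma laplacian_radial_solve:
  fixes x :: "'a::euclidean_space"
  assumes H: "Ck_on (Suc 0) {0..1} H"
    and U: "\<And>t. t \<in> {0..1} \<Longrightarrow> U t = radial_solve DIM('a) H t" and x: "x \<in> ball 0 1"
  shows "laplacian (\<lambda>x. U (x \<bullet> x)) x = - H (x \<bullet> x)"
proof -
  obtain H' where d: "\<And>t. t \<in> {0..1} \<Longrightarrow> (H has_real_derivative H' t) (at t within {0..1})"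
    and "Ck_on 0 {0..1} H'" using Ck_on_SucE_real[OF H] by blast
  then have c: "continuous_on {0..1} H'" by simp
  let ?N = "DIM('a)"
  have N: "?N \<ge> 1" using DIM_positive by (simp add: Suc_le_eq)
  have cH: "continuous_on {0..1} H" using d DERIV_continuous_on by blast
  have dU: "(U has_real_derivative - ball_mean (?N - 1) H t / 2) (at t within {0..1})"
    if t: "t \<in> {0..1}" for t
    by (rule has_field_derivative_transform_within[OF radial_solve_derivative[OF cH t] zero_less_one t])
       (simp add: U)
  have "laplacian (\<lambda>x. U (x \<bullet> x)) x =
     4 * (x \<bullet> x) * (- ball_mean (?N - 1 + 2) H' (x \<bullet> x) / 2) + 2 * real ?N * (- ball_mean (?N - 1) H (x \<bullet> x) / 2)"
    by (rule laplacian_radial[OF dU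
          DERIV_cdivide[OF DERIV_minus[OF ball_mean_derivative[OF d c]]] x])
  also have "\<dots> = - (?N * ball_mean (?N - 1) H (x \<bullet> x) + 2 * (x \<bullet> x) * ball_mean (?N + 1) H' (x \<bullet> x))"
    using N by (simp add: Suc_diff_le add_divide_distrib)
  also have "\<dots> = - H (x \<bullet> x)"
    by (subst ball_mean_divergence_identity[OF d c inner_self_in_unit N]) (use x in auto)
  finally show ?thesis .
qed

section \<open>Minimal solutions are radial\<close>

definition nonlin :: "(real \<Rightarrow> real) \<Rightarrow> bool" where
  "nonlin f \<longleftrightarrow> admissible_nonlinearity f \<and> D_half f 0 > 0"

lemma nonlin_smooth: "nonlin f \<Longrightarrow> smooth_on {0..} f"
  by (simp add: nonlin_def admissible_nonlinearity_def)

lemma nonlin_derivative: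
  assumes "nonlin f" "t \<ge> 0"
  shows "(f has_real_derivative D_half f t) (at t within {0..})"
    and "(D_half f has_real_derivative D_half (D_half f) t) (at t within {0..})"
  using has_real_derivative_D_half nonlin_smooth smooth_on_D_half assms by blast+

lemma nonlin_continuous:
  assumes "nonlin f"
  shows "continuous_on {0..} f" "continuous_on {0..} (D_half f)" "continuous_on {0..} (D_half (D_half f))"
  using smooth_on_imp_continuous_on nonlin_smooth smooth_on_D_half assms by blast+

lemma nonlin_mono: "nonlin f \<Longrightarrow> 0 \<le> s \<Longrightarrow> s \<le> t \<Longrightarrow> f s \<le> f t"
  by (auto simp: nonlin_def admissible_nonlinearity_def mono_on_def)

lemma nonlin_ge_1: "nonlin f \<Longrightarrow> 0 \<le> t \<Longrightarrow> 1 \<le> f t"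
  using nonlin_mono[of f 0 t] by (auto simp: nonlin_def admissible_nonlinearity_def)

text \<open>At an interior point \<open>c\<close> this is convexity; the endpoint
  \<open>c = 0\<close>, where the derivative is one-sided, is reached by letting \<open>c\<close>
  decrease to 0 and using continuity of f and f'.\<close>

lemma nonlin_above_tangent:
  assumes f: "nonlin f" and "0 \<le> c" "0 \<le> x"
  shows "D_half f c * (x - c) \<le> f x - f c"
proof -
  have pos: "D_half f c * (x - c) \<le> f x - f c" if "0 < c" for c
    using f convex_on_imp_above_tangent[of "{0..}" f c x "D_half f c"] nonlin_derivative(1)[OF f, of c] that assms(3)
    by (auto simp: nonlin_def admissible_nonlinearity_def)
  show ?thesis
  proof (cases "c = 0")
    case True
    have sub: "at_right 0 \<le> at (0::real) within {0..}" by (rule at_le) auto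
    have t: "(D_half f \<longlongrightarrow> D_half f 0) (at 0 within {0..})" "(f \<longlongrightarrow> f 0) (at 0 within {0..})"
      using nonlin_continuous[OF f] unfolding continuous_on_def by auto
    have "((\<lambda>c. D_half f c * (x - c)) \<longlongrightarrow> D_half f 0 * (x - 0)) (at_right 0)"
        "((\<lambda>c. f x - f c) \<longlongrightarrow> f x - f 0) (at_right 0)"
      by (intro tendsto_intros tendsto_mono[OF sub t(1)] tendsto_mono[OF sub t(2)])+
    moreover have "\<forall>\<^sub>F c in at_right 0. D_half f c * (x - c) \<le> f x - f c"
      using pos by (auto simp: eventually_at_filter)
    ultimately show ?thesis unfolding True using tendsto_le trivial_limit_at_right_real by blast
  qed (use pos assms in auto)
qed

lemma nonlin_deriv_mono:
  assumes "nonlin f" "0 \<le> s" "s \<le> t"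
  shows "D_half f s \<le> D_half f t"
proof (cases "s = t")
  case False
  have "D_half f s * (t - s) \<le> D_half f t * (t - s)"
    using nonlin_above_tangent[of f s t] nonlin_above_tangent[of f t s] assms by (simp add: algebra_simps)
  then show ?thesis using False assms by simp
qed simp

lemma nonlin_deriv_pos: "nonlin f \<Longrightarrow> 0 \<le> t \<Longrightarrow> 0 < D_half f t"
  using nonlin_deriv_mono[of f 0 t] by (auto simp: nonlin_def)

lemma LIMSEQ_lim_mono:
  fixes X :: "nat \<Rightarrow> real"
  assumes "\<And>k. X k \<le> X (Suc k)" "\<And>k. X k \<le> M"
  shows "X \<longlonglongrightarrow> lim X"
proof -
  have "incseq X" by (rule incseq_SucI) (rule assms(1))
  then obtain L where "X \<longlonglongrightarrow> L" using incseq_convergent[of X M] assms(2) by blast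
  then show ?thesis by (simp add: limI)
qed

text \<open>With this source term the two equations of the system are exchanged by swapping
  \<open>(f, l, U)\<close> and \<open>(g, m, V)\<close>.\<close>

definition src :: "(real \<Rightarrow> real) \<Rightarrow> (real \<Rightarrow> real) \<Rightarrow> real \<Rightarrow> (real \<Rightarrow> real) \<Rightarrow> (real \<Rightarrow> real) \<Rightarrow> real \<Rightarrow> real" where
  "src f g l U V t = l * D_half f (U t) * g (V t)"

lemma src_nonneg:
  assumes "nonlin f" "nonlin g" "0 \<le> l" "0 \<le> U t" "0 \<le> V t"
  shows "0 \<le> src f g l U V t"
  using nonlin_deriv_pos[OF assms(1,4)] nonlin_ge_1[OF assms(2,5)] assms(3) by (simp add: src_def)

text \<open>The system is cooperative: as f and g are increasing and convex, each source grows with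
  both unknowns and with the parameter. All monotonicity arguments rest on this.\<close>

lemma source_mono:
  assumes "nonlin f" "nonlin g" "0 \<le> l" "l \<le> l'" "0 \<le> a" "a \<le> a'" "0 \<le> b" "b \<le> b'"
  shows "l * D_half f a * g b \<le> l' * D_half f a' * g b'"
proof -
  have "0 \<le> D_half f a" "0 \<le> g b" "D_half f a \<le> D_half f a'" "g b \<le> g b'"
    using nonlin_deriv_pos[of f a] nonlin_ge_1[of g b] nonlin_deriv_mono nonlin_mono assms by auto
  then show ?thesis using assms(3,4) by (intro mult_mono) auto
qed

lemma src_Ck_on:
  assumes "nonlin f" "nonlin g" "Ck_on k {0..1} U" "Ck_on k {0..1} V"
    and "\<And>t. t \<in> {0..1} \<Longrightarrow> 0 \<le> U t" "\<And>t. t \<in> {0..1} \<Longrightarrow> 0 \<le> V t"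
  shows "Ck_on k {0..1} (src f g l U V)"
proof -
  have fg: "Ck_on k {0..} (D_half f)" "Ck_on k {0..} g"
    using smooth_on_D_half[OF nonlin_smooth[OF assms(1)]] nonlin_smooth[OF assms(2)]
    by (simp_all add: smooth_on_def)
  have im: "U ` {0..1} \<subseteq> {0..}" "V ` {0..1} \<subseteq> {0..}" using assms(5,6) by auto
  have "Ck_on k {0..1} (\<lambda>t. l * D_half f (U t) * g (V t))"
    by (intro Ck_on_mult Ck_on_const Ck_on_compose[OF fg(1) assms(3) im(1)]
        Ck_on_compose[OF fg(2) assms(4) im(2)])
  then show ?thesis by (simp add: src_def[abs_def])
qed

lemma src_smooth:
  assumes "nonlin f" "nonlin g" "smooth_on {0..1} U" "smooth_on {0..1} V"
    and "\<And>t. t \<in> {0..1} \<Longrightarrow> 0 \<le> U t" "\<And>t. t \<in> {0..1} \<Longrightarrow> 0 \<le> V t"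
  shows "smooth_on {0..1} (src f g l U V)"
  using assms src_Ck_on[OF assms(1,2)] by (simp add: smooth_on_def)

lemma src_continuous:
  assumes "nonlin f" "nonlin g" "continuous_on {0..1} U" "continuous_on {0..1} V"
    and "\<And>t. t \<in> {0..1} \<Longrightarrow> 0 \<le> U t" "\<And>t. t \<in> {0..1} \<Longrightarrow> 0 \<le> V t"
  shows "continuous_on {0..1} (src f g l U V)"
  using src_Ck_on[OF assms(1,2), of 0] assms(3-) by simp

text \<open>An integral formulation, because it passes to bounded pointwise limits; the equations
  are required on \<open>{0..1}\<close> only, values elsewhere being arbitrary.\<close>

definition radial_solution ::
  "nat \<Rightarrow> (real \<Rightarrow> real) \<Rightarrow> (real \<Rightarrow> real) \<Rightarrow> real \<Rightarrow> real \<Rightarrow> (real \<Rightarrow> real) \<Rightarrow> (real \<Rightarrow> real) \<Rightarrow> bool" where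
  "radial_solution N f g l m U V \<longleftrightarrow>
     smooth_on {0..1} U \<and> smooth_on {0..1} V \<and>
     (\<forall>t\<in>{0..1}. 0 \<le> U t \<and> 0 \<le> V t \<and>
        U t = radial_solve N (src f g l U V) t \<and> V t = radial_solve N (src g f m V U) t)"

lemma radial_solutionD:
  assumes "radial_solution N f g l m U V"
  shows "smooth_on {0..1} U" "smooth_on {0..1} V"
    "t \<in> {0..1} \<Longrightarrow> 0 \<le> U t" "t \<in> {0..1} \<Longrightarrow> 0 \<le> V t"
    "t \<in> {0..1} \<Longrightarrow> U t = radial_solve N (src f g l U V) t"
    "t \<in> {0..1} \<Longrightarrow> V t = radial_solve N (src g f m V U) t"
  using assms unfolding radial_solution_def by blast+

lemma radial_solution_swap:
  "radial_solution N f g l m U V \<Longrightarrow> radial_solution N g f m l V U"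
  by (auto simp: radial_solution_def)

text \<open>Bootstrap: the sources are as smooth as \<open>U\<close> and \<open>V\<close>, and the
  solution operator gains a derivative. Both components are treated together since each source
  contains both.\<close>

lemma radial_solutionI:
  assumes fg: "nonlin f" "nonlin g"
    and c: "continuous_on {0..1} U" "continuous_on {0..1} V"
    and nn: "\<And>t. t \<in> {0..1} \<Longrightarrow> 0 \<le> U t" "\<And>t. t \<in> {0..1} \<Longrightarrow> 0 \<le> V t"
    and U: "\<And>t. t \<in> {0..1} \<Longrightarrow> U t = radial_solve N (src f g l U V) t"
    and V: "\<And>t. t \<in> {0..1} \<Longrightarrow> V t = radial_solve N (src g f m V U) t"
  shows "radial_solution N f g l m U V"
proof -
  have "Ck_on k {0..1} U \<and> Ck_on k {0..1} V" for k
  proof (induction k)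
    case 0
    then show ?case using c by simp
  next
    case (Suc k)
    then have "Ck_on k {0..1} (src f g l U V)" "Ck_on k {0..1} (src g f m V U)"
      using src_Ck_on fg nn by blast+
    then show ?case
      using Ck_on_cong[OF radial_solve_Ck_on] U[symmetric] V[symmetric] by blast
  qed
  then show ?thesis using nn U V by (auto simp: radial_solution_def smooth_on_def)
qed

lemma radial_solution_imp_smooth_solution:
  assumes fg: "nonlin f" "nonlin g" and s: "radial_solution DIM('a) f g l m U V"
  shows "smooth_solution (ball 0 1) f g l m (\<lambda>x::'a::euclidean_space. U (x \<bullet> x)) (\<lambda>x. V (x \<bullet> x))"
proof -
  note sm = radial_solutionD(1,2)[OF s] and nn = radial_solutionD(3,4)[OF s] and eq = radial_solutionD(5,6)[OF s]
  have "Ck_on (Suc 0) {0..1} (src f g l U V)" "Ck_on (Suc 0) {0..1} (src g f m V U)"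
    using sm unfolding smooth_on_def by (blast intro: src_Ck_on fg nn)+
  then have "laplacian (\<lambda>x. U (x \<bullet> x)) x = - src f g l U V (x \<bullet> x)"
      "laplacian (\<lambda>x. V (x \<bullet> x)) x = - src g f m V U (x \<bullet> x)" if "x \<in> ball 0 1" for x :: 'a
    using laplacian_radial_solve eq that by blast+
  moreover have "U 1 = 0" "V 1 = 0" using eq by auto
  moreover have "x \<bullet> x = 1" if "x \<in> frontier (ball 0 1)" for x :: 'a
    using that by (simp add: dot_square_norm)
  moreover have "U (x \<bullet> x) \<ge> 0" "V (x \<bullet> x) \<ge> 0" if "x \<in> closure (ball 0 1)" for x :: 'a
    using nn inner_self_in_unit[of x] that by auto
  ultimately show ?thesis
    unfolding smooth_solution_def
    using smooth_on_radial[OF sm(1)] smooth_on_radial[OF sm(2)]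
      continuous_on_radial[OF smooth_on_imp_continuous_on[OF sm(1)]]
      continuous_on_radial[OF smooth_on_imp_continuous_on[OF sm(2)]]
    by (auto simp: src_def mult_ac)
qed

text \<open>The hypotheses \<open>fp\<close> concern images under the solution operator, not fixed
  points. So the lemma serves both the iterates, whose images are their successors, and sequences of
  solutions with converging parameters.\<close>

lemma radial_solution_limit:
  assumes fg: "nonlin f" "nonlin g"
    and l: "l \<longlonglongrightarrow> l'" "m \<longlonglongrightarrow> m'"
    and c: "\<And>n. continuous_on {0..1} (U n)" "\<And>n. continuous_on {0..1} (V n)"
    and nn: "\<And>n t. t \<in> {0..1} \<Longrightarrow> 0 \<le> U n t" "\<And>n t. t \<in> {0..1} \<Longrightarrow> 0 \<le> V n t"
    and bd: "\<And>n t. t \<in> {0..1} \<Longrightarrow> U n t \<le> M" "\<And>n t. t \<in> {0..1} \<Longrightarrow> V n t \<le> M"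
    and lim: "\<And>t. t \<in> {0..1} \<Longrightarrow> (\<lambda>n. U n t) \<longlonglongrightarrow> U' t" "\<And>t. t \<in> {0..1} \<Longrightarrow> (\<lambda>n. V n t) \<longlonglongrightarrow> V' t"
    and fp: "\<And>t. t \<in> {0..1} \<Longrightarrow> (\<lambda>n. radial_solve N (src f g (l n) (U n) (V n)) t) \<longlonglongrightarrow> U' t"
       "\<And>t. t \<in> {0..1} \<Longrightarrow> (\<lambda>n. radial_solve N (src g f (m n) (V n) (U n)) t) \<longlonglongrightarrow> V' t"
  shows "radial_solution N f g l' m' U' V'"
proof -
  have half: "(\<forall>t\<in>{0..1}. U' t = radial_solve N (src f g l' U' V') t) \<and> continuous_on {0..1} U' \<and>
        (\<forall>t\<in>{0..1}. 0 \<le> U' t)"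
    if fg: "nonlin f" "nonlin g"
    and l: "l \<longlonglongrightarrow> l'"
    and c: "\<And>n. continuous_on {0..1} (U n)" "\<And>n. continuous_on {0..1} (V n)"
    and nn: "\<And>n t. t \<in> {0..1} \<Longrightarrow> 0 \<le> U n t" "\<And>n t. t \<in> {0..1} \<Longrightarrow> 0 \<le> V n t"
    and bd: "\<And>n t. t \<in> {0..1} \<Longrightarrow> U n t \<le> M" "\<And>n t. t \<in> {0..1} \<Longrightarrow> V n t \<le> M"
    and lim: "\<And>t. t \<in> {0..1} \<Longrightarrow> (\<lambda>n. U n t) \<longlonglongrightarrow> U' t" "\<And>t. t \<in> {0..1} \<Longrightarrow> (\<lambda>n. V n t) \<longlonglongrightarrow> V' t"
    and fp: "\<And>t. t \<in> {0..1} \<Longrightarrow> (\<lambda>n. radial_solve N (src f g (l n) (U n) (V n)) t) \<longlonglongrightarrow> U' t"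
    for f g l l' U V U' V'
  proof -
    have U'nn: "0 \<le> U' t" "0 \<le> V' t" if "t \<in> {0..1}" for t
      using LIMSEQ_le_const[OF lim(1)[OF that], of 0] LIMSEQ_le_const[OF lim(2)[OF that], of 0] nn[OF that]
      by blast+
    obtain L where L: "\<And>n. \<bar>l n\<bar> \<le> L"
      using convergent_imp_Bseq[OF convergentI[OF l]] unfolding Bseq_def by auto
    have 1: "continuous_on {0..1} (src f g (l n) (U n) (V n))" for n
      by (rule src_continuous[OF fg c nn])
    have 2: "\<bar>src f g (l n) (U n) (V n) t\<bar> \<le> L * D_half f M * g M" if t: "t \<in> {0..1}" for n t
    proof -
      have "\<bar>src f g (l n) (U n) (V n) t\<bar> = \<bar>l n\<bar> * D_half f (U n t) * g (V n t)"
        using nonlin_deriv_pos[OF fg(1) nn(1)[OF t], of n] nonlin_ge_1[OF fg(2) nn(2)[OF t], of n]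
        by (auto simp: src_def abs_mult)
      also have "\<dots> \<le> L * D_half f M * g M"
        by (rule source_mono) (use fg L nn bd t in auto)
      finally show ?thesis .
    qed
    have 3: "(\<lambda>n. src f g (l n) (U n) (V n) t) \<longlonglongrightarrow> src f g l' U' V' t" if t: "t \<in> {0..1}" for t
      unfolding src_def
      by (intro tendsto_mult l continuous_on_tendsto_compose[OF nonlin_continuous(2)[OF fg(1)] lim(1)[OF t]]
           continuous_on_tendsto_compose[OF nonlin_continuous(1)[OF fg(2)] lim(2)[OF t]])
         (use U'nn nn t in auto)
    have "U' t = radial_solve N (src f g l' U' V') t" if t: "t \<in> {0..1}" for t
      using LIMSEQ_unique[OF fp[OF t] radial_solve_limit(1)[OF 1 2 3 t]] .
    moreover have "continuous_on {0..1} (radial_solve N (src f g l' U' V'))"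
      by (rule radial_solve_limit(2)[OF 1 2 3])
    ultimately show ?thesis using U'nn continuous_on_cong[of "{0..1}" "{0..1}" U'] by auto
  qed
  note hU = half[OF fg l(1) c nn bd lim fp(1)]
  note hV = half[OF fg(2,1) l(2) c(2,1) nn(2,1) bd(2,1) lim(2,1) fp(2)]
  show ?thesis by (rule radial_solutionI[OF fg]) (use hU hV in auto)
qed

section \<open>Monotone iteration from zero\<close>

primrec radial_iterate :: "nat \<Rightarrow> (real \<Rightarrow> real) \<Rightarrow> (real \<Rightarrow> real) \<Rightarrow> real \<Rightarrow> real \<Rightarrow> nat \<Rightarrow> (real \<Rightarrow> real) \<times> (real \<Rightarrow> real)" where
  "radial_iterate N f g l m 0 = (\<lambda>_. 0, \<lambda>_. 0)"
| "radial_iterate N f g l m (Suc n) = (case radial_iterate N f g l m n of (U, V) \<Rightarrow>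
     (radial_solve N (src f g l U V), radial_solve N (src g f m V U)))"

text \<open>The given solution bounds the iterates, so they converge; its minimality gives the
  inequality between it and the limit that the iteration does not. The last conclusion allows larger
  parameters and so contains monotonicity of the branch.\<close>

lemma minimal_solution_radial:
  fixes u v :: "'a::euclidean_space \<Rightarrow> real"
  assumes fg: "nonlin f" "nonlin g" and lm: "0 < l" "0 < m"
    and minimal: "minimal_solution (ball 0 1) f g l m u v"
  obtains U V where "radial_solution DIM('a) f g l m U V"
    "\<And>x. norm x \<le> 1 \<Longrightarrow> u x = U (x \<bullet> x) \<and> v x = V (x \<bullet> x)"
    "\<And>l' m' W Z t. l \<le> l' \<Longrightarrow> m \<le> m' \<Longrightarrow> radial_solution DIM('a) f g l' m' W Z \<Longrightarrow> t \<in> {0..1} \<Longrightarrow> U t \<le> W t \<and> V t \<le> Z t"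
proof -
  let ?N = "DIM('a)"
  define U where "U n = fst (radial_iterate ?N f g l m n)" for n
  define V where "V n = snd (radial_iterate ?N f g l m n)" for n
  have U0: "U 0 = (\<lambda>_. 0)" "V 0 = (\<lambda>_. 0)" by (simp_all add: U_def V_def)
  have US: "U (Suc n) = radial_solve ?N (src f g l (U n) (V n))"
      "V (Suc n) = radial_solve ?N (src g f m (V n) (U n))" for n
    by (simp_all add: U_def V_def case_prod_beta)
  have sm_nn: "smooth_on {0..1} (U n) \<and> smooth_on {0..1} (V n) \<and> (\<forall>t\<in>{0..1}. 0 \<le> U n t \<and> 0 \<le> V n t)" for n
  proof (induction n)
    case 0
    then show ?case by (simp add: U0 smooth_on_def)
  next
    case (Suc n)
    have s: "smooth_on {0..1} (src f g l (U n) (V n))" "smooth_on {0..1} (src g f m (V n) (U n))"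
      using Suc fg src_smooth by blast+
    then have "smooth_on {0..1} (U (Suc n))" "smooth_on {0..1} (V (Suc n))"
      unfolding US smooth_on_def using radial_solve_Ck_on Ck_on_SucD by blast+
    moreover have "0 \<le> U (Suc n) t \<and> 0 \<le> V (Suc n) t" if "t \<in> {0..1}" for t
      unfolding US using Suc s fg lm that
      by (auto intro!: radial_solve_nonneg src_nonneg smooth_on_imp_continuous_on)
    ultimately show ?case by blast
  qed
  then have nn: "\<And>n t. t \<in> {0..1} \<Longrightarrow> 0 \<le> U n t" "\<And>n t. t \<in> {0..1} \<Longrightarrow> 0 \<le> V n t"
    and cont: "\<And>n. continuous_on {0..1} (U n)" "\<And>n. continuous_on {0..1} (V n)"
    using smooth_on_imp_continuous_on by blast+
  have smsrc: "smooth_on {0..1} (src f g l (U n) (V n))" "smooth_on {0..1} (src g f m (V n) (U n))" for n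
    using sm_nn[of n] fg src_smooth by blast+
  have csrc: "continuous_on {0..1} (src f g l (U n) (V n))" "continuous_on {0..1} (src g f m (V n) (U n))" for n
    using smsrc smooth_on_imp_continuous_on by blast+
  have inc: "\<forall>t\<in>{0..1}. U n t \<le> U (Suc n) t \<and> V n t \<le> V (Suc n) t" for n
  proof (induction n)
    case 0
    then show ?case using nn[where n = 1] by (simp add: U0)
  next
    case (Suc n)
    show ?case
    proof
      fix t :: real assume t: "t \<in> {0..1}"
      have "U (Suc n) t \<le> U (Suc (Suc n)) t" 
        by (subst US(1)[of n], subst US(1)[of "Suc n"], rule radial_solve_mono[OF csrc(1) csrc(1) _ t],
            unfold src_def, rule source_mono) (use fg lm nn Suc in auto)
      moreover have "V (Suc n) t \<le> V (Suc (Suc n)) t" 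
        by (subst US(2)[of n], subst US(2)[of "Suc n"], rule radial_solve_mono[OF csrc(2) csrc(2) _ t],
            unfold src_def, rule source_mono) (use fg lm nn Suc in auto)
      ultimately show "U (Suc n) t \<le> U (Suc (Suc n)) t \<and> V (Suc n) t \<le> V (Suc (Suc n)) t" ..
    qed
  qed
  have below_radial: "\<forall>t\<in>{0..1}. U n t \<le> W t \<and> V n t \<le> Z t"
    if "l \<le> l'" "m \<le> m'" and WZ: "radial_solution ?N f g l' m' W Z" for l' m' W Z n
  proof (induction n)
    case 0
    then show ?case using radial_solutionD(3,4)[OF WZ] by (simp add: U0)
  next
    case (Suc n)
    have c: "continuous_on {0..1} (src f g l' W Z)" "continuous_on {0..1} (src g f m' Z W)"
      using src_smooth[OF fg radial_solutionD(1-4)[OF WZ]]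
        src_smooth[OF fg(2,1) radial_solutionD(2,1,4,3)[OF WZ]] smooth_on_imp_continuous_on by blast+
    show ?case
    proof
      fix t :: real assume t: "t \<in> {0..1}"
      have "U (Suc n) t \<le> radial_solve ?N (src f g l' W Z) t" unfolding US
        by (rule radial_solve_mono[OF csrc(1) c(1) _ t], unfold src_def, rule source_mono)
           (use fg lm nn that Suc in auto)
      moreover have "V (Suc n) t \<le> radial_solve ?N (src g f m' Z W) t" unfolding US
        by (rule radial_solve_mono[OF csrc(2) c(2) _ t], unfold src_def, rule source_mono)
           (use fg lm nn that Suc in auto)
      ultimately show "U (Suc n) t \<le> W t \<and> V (Suc n) t \<le> Z t"
        using radial_solutionD(5,6)[OF WZ t] by simp
    qed
  qed
  have sol: "smooth_solution (ball 0 1) f g l m u v" using minimal by (simp add: minimal_solution_def)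
  then have smu: "smooth_on (ball 0 1) u" "smooth_on (ball 0 1) v"
    and cu: "continuous_on (cball 0 1) u" "continuous_on (cball 0 1) v"
    and nnu: "\<And>x. norm x \<le> 1 \<Longrightarrow> 0 \<le> u x \<and> 0 \<le> v x"
    and lapu: "\<And>x. x \<in> ball 0 1 \<Longrightarrow> laplacian u x = - (l * D_half f (u x) * g (v x))"
       "\<And>x. x \<in> ball 0 1 \<Longrightarrow> laplacian v x = - (m * D_half g (v x) * f (u x))"
    and bdu: "\<And>x. norm x = 1 \<Longrightarrow> u x = 0 \<and> v x = 0"
    by (simp_all add: smooth_solution_def minus_equation_iff[of "laplacian _ _"] mult_ac)
  have lap: "laplacian (\<lambda>x::'a. radial_solve ?N H (x \<bullet> x)) x = - H (x \<bullet> x)"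
    if "smooth_on {0..1} H" "x \<in> ball 0 1" for H and x :: 'a
    by (rule laplacian_radial_solve[OF _ refl that(2)]) (use that(1) smooth_on_def in blast)
  \<comment> \<open>Here \<open>u\<close> and \<open>v\<close> are not known to be radial, so the
    comparison takes place in the ball: the next iterate has the smaller source and the same
    boundary values.\<close>
  have below: "\<forall>x\<in>cball 0 1. U n (x \<bullet> x) \<le> u x \<and> V n (x \<bullet> x) \<le> v x" for n
  proof (induction n)
    case 0
    then show ?case using nnu by (simp add: U0)
  next
    case (Suc n)
    have smS: "smooth_on {0..1} (U (Suc n))" "smooth_on {0..1} (V (Suc n))" using sm_nn by blast+
    have unn: "0 \<le> U n (x \<bullet> x)" "0 \<le> V n (x \<bullet> x)" "U n (x \<bullet> x) \<le> u x" "V n (x \<bullet> x) \<le> v x"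
      if "x \<in> ball 0 1" for x :: 'a
      using Suc nn inner_self_in_unit[of x] that by auto
    have bnd: "U (Suc n) (x \<bullet> x) \<le> u x" "V (Suc n) (x \<bullet> x) \<le> v x" if "norm x = 1" for x :: 'a
      using bdu[OF that] that by (simp_all add: US dot_square_norm)
    show ?case
    proof
      fix x :: 'a assume x: "x \<in> cball 0 1"
      have "U (Suc n) (x \<bullet> x) \<le> u x"
      proof (rule laplacian_comparison[OF smu(1) smooth_on_radial[OF smS(1)] cu(1) continuous_on_radial _ bnd(1) x])
        show "laplacian u y \<le> laplacian (\<lambda>x. U (Suc n) (x \<bullet> x)) y" if y: "y \<in> ball 0 1" for y
          using lap[OF smsrc(1) y] lapu(1)[OF y] source_mono[OF fg, of l l] unn[OF y] lm
          by (simp add: US src_def)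
      qed (use smS smooth_on_imp_continuous_on in auto)
      moreover have "V (Suc n) (x \<bullet> x) \<le> v x"
      proof (rule laplacian_comparison[OF smu(2) smooth_on_radial[OF smS(2)] cu(2) continuous_on_radial _ bnd(2) x])
        show "laplacian v y \<le> laplacian (\<lambda>x. V (Suc n) (x \<bullet> x)) y" if y: "y \<in> ball 0 1" for y
          using lap[OF smsrc(2) y] lapu(2)[OF y] source_mono[OF fg(2,1), of m m] unn[OF y] lm
          by (simp add: US src_def)
      qed (use smS smooth_on_imp_continuous_on in auto)
      ultimately show "U (Suc n) (x \<bullet> x) \<le> u x \<and> V (Suc n) (x \<bullet> x) \<le> v x" ..
    qed
  qed
  obtain Mu where Mu: "\<And>x. x \<in> cball 0 1 \<Longrightarrow> u x \<le> Mu"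
    using continuous_attains_sup[OF compact_cball _ cu(1)] by fastforce
  obtain Mv where Mv: "\<And>x. x \<in> cball 0 1 \<Longrightarrow> v x \<le> Mv"
    using continuous_attains_sup[OF compact_cball _ cu(2)] by fastforce
  define M where "M = max Mu Mv"
  \<comment> \<open>Every \<open>t\<close> is x . x for a point on a coordinate axis, so bounds for
    \<open>u\<close> and \<open>v\<close> on the ball carry over to the profiles.\<close>
  have bd: "U n t \<le> M" "V n t \<le> M" if t: "t \<in> {0..1}" for n t
  proof -
    obtain b :: 'a where "b \<in> Basis" using nonempty_Basis by blast
    define x where "x = sqrt t *\<^sub>R b"
    have "norm x = sqrt t" using t \<open>b \<in> Basis\<close> by (simp add: x_def)
    then have "x \<in> cball 0 1" "x \<bullet> x = t" using t by (simp_all add: dot_square_norm)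
    then show "U n t \<le> M" "V n t \<le> M" using below[of n] Mu Mv unfolding M_def by fastforce+
  qed
  define U' where "U' t = lim (\<lambda>n. U n t)" for t
  define V' where "V' t = lim (\<lambda>n. V n t)" for t
  have limU: "(\<lambda>n. U n t) \<longlonglongrightarrow> U' t" if t: "t \<in> {0..1}" for t
    unfolding U'_def by (rule LIMSEQ_lim_mono) (use inc bd t in blast)+
  have limV: "(\<lambda>n. V n t) \<longlonglongrightarrow> V' t" if t: "t \<in> {0..1}" for t
    unfolding V'_def by (rule LIMSEQ_lim_mono) (use inc bd t in blast)+
  have rs: "radial_solution ?N f g l m U' V'"
  proof (rule radial_solution_limit[OF fg tendsto_const tendsto_const cont nn bd limU limV])
    show "(\<lambda>n. radial_solve ?N (src f g l (U n) (V n)) t) \<longlonglongrightarrow> U' t" if "t \<in> {0..1}" for t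
      using LIMSEQ_Suc[OF limU[OF that]] by (simp add: US)
    show "(\<lambda>n. radial_solve ?N (src g f m (V n) (U n)) t) \<longlonglongrightarrow> V' t" if "t \<in> {0..1}" for t
      using LIMSEQ_Suc[OF limV[OF that]] by (simp add: US)
  qed
  show thesis
  proof (rule that[OF rs])
    fix x :: 'a assume x: "norm x \<le> 1"
    have t: "x \<bullet> x \<in> {0..1}" using inner_self_in_unit[OF x] .
    have "U' (x \<bullet> x) \<le> u x" "V' (x \<bullet> x) \<le> v x"
      using LIMSEQ_le_const2[OF limU[OF t]] LIMSEQ_le_const2[OF limV[OF t]] below x by auto
    moreover have "u x \<le> U' (x \<bullet> x) \<and> v x \<le> V' (x \<bullet> x)"
      using minimal radial_solution_imp_smooth_solution[OF fg rs] x unfolding minimal_solution_def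
      by (metis (no_types, lifting) closure_ball mem_cball_0 zero_less_one)
    ultimately show "u x = U' (x \<bullet> x) \<and> v x = V' (x \<bullet> x)" by auto
  next
    fix l' m' W Z t
    assume a: "l \<le> l'" "m \<le> m'" "radial_solution ?N f g l' m' W Z" and t: "t \<in> {0..1::real}"
    show "U' t \<le> W t \<and> V' t \<le> Z t"
      using LIMSEQ_le_const2[OF limU[OF t]] LIMSEQ_le_const2[OF limV[OF t]] below_radial[OF a] t by auto
  qed
qed

section \<open>The radial system\<close>

text \<open>Differentiability in the open interval only admits the endpoints 0 and 1, where the
  radial equations are not posed. Differential inequalities are integrated by this mean value
  inequality throughout, without integrals.\<close>

lemma increment_ge:
  fixes \<phi> :: "real \<Rightarrow> real"
  assumes "a \<le> b" "continuous_on {a..b} \<phi>"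
    and d: "\<And>x. a < x \<Longrightarrow> x < b \<Longrightarrow> (\<phi> has_real_derivative \<phi>' x) (at x)"
    and c: "\<And>x. a < x \<Longrightarrow> x < b \<Longrightarrow> c \<le> \<phi>' x"
  shows "c * (b - a) \<le> \<phi> b - \<phi> a"
proof (cases "a = b")
  case False
  then have "a < b" using assms(1) by simp
  then obtain z where "a < z" "z < b" "\<phi> b - \<phi> a = \<phi>' z * (b - a)"
    by (rule mvt[OF _ assms(2), of "\<lambda>x h. \<phi>' x * h"])
       (use d in \<open>simp_all add: has_field_derivative_def\<close>)
  then show ?thesis using c[of z] assms(1) by (simp add: mult_right_mono)
qed simp

text \<open>In the radial variable \<open>r = |x|\<close>, with \<open>n = N - 1\<close>, the functions \<open>k\<close> and \<open>j\<close> stand for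
  \<open>-u\<^sub>r / r\<close> and \<open>-v\<^sub>r / r\<close>, which are continuous up to the centre.\<close>

definition radial_ode :: "nat \<Rightarrow> (real \<Rightarrow> real) \<Rightarrow> (real \<Rightarrow> real) \<Rightarrow> real \<Rightarrow> real \<Rightarrow>
    (real \<Rightarrow> real) \<Rightarrow> (real \<Rightarrow> real) \<Rightarrow> (real \<Rightarrow> real) \<Rightarrow> (real \<Rightarrow> real) \<Rightarrow> bool" where
  "radial_ode n f g l m u v k j \<longleftrightarrow>
     continuous_on {0..1} u \<and> continuous_on {0..1} v \<and> continuous_on {0..1} k \<and> continuous_on {0..1} j \<and>
     (\<forall>r\<in>{0..1}. 0 \<le> u r \<and> 0 \<le> v r \<and> 0 \<le> k r \<and> 0 \<le> j r) \<and> u 1 = 0 \<and> v 1 = 0 \<and>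
     (\<forall>r\<in>{0<..<1}. (u has_real_derivative - (r * k r)) (at r) \<and> (v has_real_derivative - (r * j r)) (at r) \<and>
        (k has_real_derivative (src f g l u v r - (real n + 1) * k r) / r) (at r) \<and>
        (j has_real_derivative (src g f m v u r - (real n + 1) * j r) / r) (at r))"

lemma radial_ode_swap: "radial_ode n f g l m u v k j \<Longrightarrow> radial_ode n g f m l v u j k"
  by (auto simp: radial_ode_def)

text \<open>The derivative of the ball mean at r^2 is 2 r times a ball mean of \<open>H'\<close>,
  which the divergence identity with N = n + 1 expresses through the source and \<open>k\<close>
  itself.\<close>

lemma radial_solution_imp_radial_ode:
  assumes fg: "nonlin f" "nonlin g" and lm: "0 < l" "0 < m"
    and s: "radial_solution (Suc n) f g l m U V"
  shows "radial_ode n f g l m (\<lambda>r. U (r\<^sup>2)) (\<lambda>r. V (r\<^sup>2))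
     (\<lambda>r. ball_mean n (src f g l U V) (r\<^sup>2)) (\<lambda>r. ball_mean n (src g f m V U) (r\<^sup>2))"
proof -
  have half: "continuous_on {0..1} (\<lambda>r. U (r\<^sup>2)) \<and> continuous_on {0..1} (\<lambda>r. ball_mean n (src f g l U V) (r\<^sup>2)) \<and>
     (\<forall>r\<in>{0..1}. 0 \<le> U (r\<^sup>2) \<and> 0 \<le> ball_mean n (src f g l U V) (r\<^sup>2)) \<and> U 1 = 0 \<and>
     (\<forall>r\<in>{0<..<1}. ((\<lambda>r. U (r\<^sup>2)) has_real_derivative - (r * ball_mean n (src f g l U V) (r\<^sup>2))) (at r) \<and>
        ((\<lambda>r. ball_mean n (src f g l U V) (r\<^sup>2)) has_real_derivative
           (src f g l (\<lambda>r. U (r\<^sup>2)) (\<lambda>r. V (r\<^sup>2)) r - (real n + 1) * ball_mean n (src f g l U V) (r\<^sup>2)) / r) (at r))"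
    if fg: "nonlin f" "nonlin g" and lm: "0 < l" and s: "radial_solution (Suc n) f g l m U V"
    for f g l m U V
  proof -
    let ?H = "src f g l U V"
    have sm: "smooth_on {0..1} ?H" by (rule src_smooth[OF fg radial_solutionD(1-4)[OF s]])
    have cH: "continuous_on {0..1} ?H" using smooth_on_imp_continuous_on[OF sm] .
    have "Ck_on (Suc 0) {0..1} ?H" using sm smooth_on_def by blast
    then obtain H' where H': "\<And>x. x \<in> {0..1} \<Longrightarrow> (?H has_real_derivative H' x) (at x within {0..1})"
      "Ck_on 0 {0..1} H'" using Ck_on_SucE_real by blast
    have cH': "continuous_on {0..1} H'" using H'(2) by simp
    have sq: "r\<^sup>2 \<in> {0..1}" if "r \<in> {0..1}" for r :: real
      using that by (auto intro: power_le_one)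
    have c: "continuous_on {0..1} (\<lambda>r. W (r\<^sup>2))" if "continuous_on {0..1} W" for W :: "real \<Rightarrow> real"
      by (rule continuous_on_compose2[OF that]) (use sq in \<open>auto intro!: continuous_intros\<close>)
    have chain: "((\<lambda>r. W (r\<^sup>2)) has_real_derivative W' * (2 * r)) (at r)"
      if W: "(W has_real_derivative W') (at (r\<^sup>2) within {0..1})" and r: "r \<in> {0<..<1}" for W W' r
    proof -
      have "(W has_real_derivative W') (at (r\<^sup>2) within (\<lambda>r. r\<^sup>2) ` {0<..<1})"
        by (rule DERIV_subset[OF W]) (use sq in auto)
      moreover have "((\<lambda>r. r\<^sup>2) has_real_derivative 2 * r) (at r within {0<..<1})"
        by (auto intro!: derivative_eq_intros)
      ultimately have "((W \<circ> (\<lambda>r. r\<^sup>2)) has_real_derivative W' * (2 * r)) (at r within {0<..<1})"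
        by (rule DERIV_image_chain)
      then show ?thesis using at_within_open[OF r open_greaterThanLessThan] by (simp add: o_def)
    qed
    have eqU: "U t = radial_solve (Suc n) ?H t" if "t \<in> {0..1}" for t
      using radial_solutionD(5)[OF s that] .
    have dU: "(U has_real_derivative - ball_mean n ?H t / 2) (at t within {0..1})" if t: "t \<in> {0..1}" for t
      using has_field_derivative_transform_within[OF radial_solve_derivative[OF cH t, of "Suc n"] zero_less_one t, of U]
        eqU by simp
    have "((\<lambda>r. U (r\<^sup>2)) has_real_derivative - (r * ball_mean n ?H (r\<^sup>2))) (at r)" if r: "r \<in> {0<..<1}" for r
    proof -
      have "r\<^sup>2 \<in> {0..1}" using sq r by simp
      then show ?thesis using DERIV_cong[OF chain[OF dU r]] by (simp add: mult.commute)
    qed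
    moreover have "((\<lambda>r. ball_mean n ?H (r\<^sup>2)) has_real_derivative
           (src f g l (\<lambda>r. U (r\<^sup>2)) (\<lambda>r. V (r\<^sup>2)) r - (real n + 1) * ball_mean n ?H (r\<^sup>2)) / r) (at r)"
      if r: "r \<in> {0<..<1}" for r
    proof (rule DERIV_cong[OF chain[OF ball_mean_derivative[OF H'(1) cH'] r]])
      show t: "r\<^sup>2 \<in> {0..1}" using sq r by simp
      have "src f g l (\<lambda>r. U (r\<^sup>2)) (\<lambda>r. V (r\<^sup>2)) r = ?H (r\<^sup>2)" by (simp add: src_def)
      moreover have "(real n + 1) * ball_mean n ?H (r\<^sup>2) + 2 * r\<^sup>2 * ball_mean (n + 2) H' (r\<^sup>2) = ?H (r\<^sup>2)"
        using ball_mean_divergence_identity[OF H'(1) cH' t, of "Suc n"] by (simp add: add.commute)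
      ultimately show "ball_mean (n + 2) H' (r\<^sup>2) * (2 * r) =
         (src f g l (\<lambda>r. U (r\<^sup>2)) (\<lambda>r. V (r\<^sup>2)) r - (real n + 1) * ball_mean n ?H (r\<^sup>2)) / r"
        using r by (simp add: field_simps power2_eq_square)
    qed auto
    moreover have "0 \<le> ball_mean n ?H (r\<^sup>2)" "0 \<le> U (r\<^sup>2)" if "r \<in> {0..1}" for r
      using ball_mean_nonneg[OF cH _ sq[OF that]] src_nonneg[OF fg] lm radial_solutionD(3,4)[OF s] sq[OF that]
      by auto
    moreover have "U 1 = 0" using eqU by simp
    ultimately show ?thesis
      using c[OF smooth_on_imp_continuous_on[OF radial_solutionD(1)[OF s]]] c[OF continuous_on_ball_mean[OF cH]] by blast
  qed
  show ?thesis
    using half[OF fg lm(1) s] half[OF fg(2,1) lm(2) radial_solution_swap[OF s]]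
    unfolding radial_ode_def by (simp only: ball_simps(9) conj_assoc power_one) blast
qed

lemma radial_odeD:
  assumes "radial_ode n f g l m u v k j"
  shows "continuous_on {0..1} u" "continuous_on {0..1} k"
    "0 \<le> r \<Longrightarrow> r \<le> 1 \<Longrightarrow> 0 \<le> u r" "0 \<le> r \<Longrightarrow> r \<le> 1 \<Longrightarrow> 0 \<le> k r" "u 1 = 0"
    "0 < r \<Longrightarrow> r < 1 \<Longrightarrow> (u has_real_derivative - (r * k r)) (at r)"
    "0 < r \<Longrightarrow> r < 1 \<Longrightarrow> (k has_real_derivative (src f g l u v r - (real n + 1) * k r) / r) (at r)"
  using assms unfolding radial_ode_def by auto

lemma radial_ode_antimono:
  assumes "radial_ode n f g l m u v k j" "0 \<le> a" "a \<le> b" "b \<le> 1"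
  shows "u b \<le> u a"
proof -
  have "0 * (b - a) \<le> (- u b) - (- u a)"
  proof (rule increment_ge[OF assms(3)])
    show "continuous_on {a..b} (\<lambda>r. - u r)"
      using radial_odeD(1)[OF assms(1)] assms by (auto intro!: continuous_intros elim!: continuous_on_subset)
    show "((\<lambda>r. - u r) has_real_derivative r * k r) (at r)" if "a < r" "r < b" for r
      using DERIV_minus[OF radial_odeD(6)[OF assms(1)], of r] that assms by simp
    show "0 \<le> r * k r" if "a < r" "r < b" for r
      using radial_odeD(4)[OF assms(1), of r] that assms by simp
  qed
  then show ?thesis by simp
qed

section \<open>Estimates for the flux r^(n+1) k = -r^n u_r\<close>

lemma flux_derivative:
  assumes "r > 0" "(k has_real_derivative (h - (real n + 1) * k r) / r) (at r)"
  shows "((\<lambda>r. r ^ (n + 1) * k r) has_real_derivative r ^ n * h) (at r)"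
  by (rule DERIV_cong[OF DERIV_mult[OF DERIV_pow assms(2)]])
     (use assms(1) in \<open>simp add: field_simps\<close>)

lemma flux_mono:
  assumes fg: "nonlin f" "nonlin g" "0 \<le> l"
    and o: "radial_ode n f g l m u v k j" and "0 \<le> a" "a \<le> b" "b \<le> 1"
  shows "a ^ (n + 1) * k a \<le> b ^ (n + 1) * k b"
proof -
  have "0 * (b - a) \<le> b ^ (n + 1) * k b - a ^ (n + 1) * k a"
  proof (rule increment_ge)
    show "continuous_on {a..b} (\<lambda>r. r ^ (n + 1) * k r)"
      by (intro continuous_intros continuous_on_subset[OF radial_odeD(2)[OF o]]) (use assms in auto)
    show "((\<lambda>r. r ^ (n + 1) * k r) has_real_derivative r ^ n * src f g l u v r) (at r)" if "a < r" "r < b" for r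
      by (rule flux_derivative[OF _ radial_odeD(7)[OF o]]) (use assms that in auto)
    show "0 \<le> r ^ n * src f g l u v r" if "a < r" "r < b" for r
      using src_nonneg[OF fg] radial_odeD(3)[OF o] radial_odeD(3)[OF radial_ode_swap[OF o]] that assms by simp
  qed (use assms in simp)
  then show ?thesis by simp
qed

text \<open>For r < b the source is at least its value with u replaced by 0 and v by
  \<open>v b\<close>, since v decreases; then r^n is integrated over [0,b].\<close>

lemma flux_ge:
  assumes fg: "nonlin f" "nonlin g" "0 \<le> l"
    and o: "radial_ode n f g l m u v k j" and b: "0 \<le> b" "b \<le> 1"
  shows "b ^ (n + 1) * (l * D_half f 0 * g (v b) / (real n + 1)) \<le> b ^ (n + 1) * k b"
proof -
  let ?c = "l * D_half f 0 * g (v b)"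
  have "0 * (b - 0) \<le> (b ^ (n + 1) * k b - ?c / (real n + 1) * b ^ (n + 1)) - (0 ^ (n + 1) * k 0 - ?c / (real n + 1) * 0 ^ (n + 1))"
  proof (rule increment_ge)
    show "continuous_on {0..b} (\<lambda>r. r ^ (n + 1) * k r - ?c / (real n + 1) * r ^ (n + 1))"
      by (intro continuous_intros continuous_on_subset[OF radial_odeD(2)[OF o]]) (use b in auto)
    show "((\<lambda>r. r ^ (n + 1) * k r - ?c / (real n + 1) * r ^ (n + 1)) has_real_derivative r ^ n * (src f g l u v r - ?c)) (at r)"
      if r: "0 < r" "r < b" for r
    proof (rule DERIV_cong[OF DERIV_diff[OF flux_derivative[OF _ radial_odeD(7)[OF o]] DERIV_cmult[OF DERIV_pow]]])
      have "?c / (real n + 1) * (real (n + 1) * r ^ (n + 1 - Suc 0)) = ?c * r ^ n"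
        by (simp add: add.commute)
      then show "r ^ n * src f g l u v r - ?c / (real n + 1) * (real (n + 1) * r ^ (n + 1 - Suc 0)) = r ^ n * (src f g l u v r - ?c)"
        by (simp only: right_diff_distrib) (simp add: mult.commute)
    qed (use r b in auto)
    show "0 \<le> r ^ n * (src f g l u v r - ?c)" if r: "0 < r" "r < b" for r
    proof -
      have "l * D_half f 0 * g (v b) \<le> l * D_half f (u r) * g (v r)"
        by (rule source_mono[OF fg(1,2)])
           (use fg(3) r b radial_odeD(3)[OF o] radial_odeD(3)[OF radial_ode_swap[OF o]]
              radial_ode_antimono[OF radial_ode_swap[OF o], of r b] in auto)
      then show ?thesis using r by (simp add: src_def)
    qed
  qed (use b in simp)
  then show ?thesis by (simp add: mult_ac)
qed

text \<open>Beyond \<open>b\<close> the flux is larger and r^n <= 1, so -u_r is at least the flux at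
  \<open>b\<close>; integration up to the boundary, where u = 0, gives the factor 1 - b.\<close>

lemma flux_le:
  assumes fg: "nonlin f" "nonlin g" "0 \<le> l"
    and o: "radial_ode n f g l m u v k j" and b: "0 < b" "b \<le> 1"
  shows "(1 - b) * (b ^ (n + 1) * k b) \<le> u b"
proof -
  have "(b ^ (n + 1) * k b) * (1 - b) \<le> (- u 1) - (- u b)"
  proof (rule increment_ge[OF b(2)])
    show "continuous_on {b..1} (\<lambda>r. - u r)"
      by (intro continuous_intros continuous_on_subset[OF radial_odeD(1)[OF o]]) (use b in auto)
    show "((\<lambda>r. - u r) has_real_derivative r * k r) (at r)" if "b < r" "r < 1" for r
      using DERIV_minus[OF radial_odeD(6)[OF o], of r] that b by simp
    show "b ^ (n + 1) * k b \<le> r * k r" if r: "b < r" "r < 1" for r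
    proof -
      have "b ^ (n + 1) * k b \<le> r ^ (n + 1) * k r" by (rule flux_mono[OF fg o]) (use b r in auto)
      also have "\<dots> = r ^ n * (r * k r)" by simp
      also have "\<dots> \<le> 1 * (r * k r)"
        by (rule mult_right_mono) (use r b radial_odeD(4)[OF o, of r] in \<open>auto intro: power_le_one\<close>)
      finally show ?thesis by simp
    qed
  qed
  then show ?thesis using radial_odeD(5)[OF o] by (simp add: mult.commute)
qed

text \<open>The shift \<open>T\<close> makes a linear lower bound of any slope valid on the whole
  half line, so small and large arguments need not be distinguished later.\<close>

lemma nonlin_superlinear:
  assumes "nonlin f"
  obtains T where "0 \<le> T" "\<And>t. 0 \<le> t \<Longrightarrow> K * (t - T) \<le> f t"
proof -
  have "filterlim (\<lambda>t. f t / t) at_top at_top" 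
    using assms by (simp add: nonlin_def admissible_nonlinearity_def)
  then have "\<forall>\<^sub>F t in at_top. \<bar>K\<bar> \<le> f t / t" by (simp add: filterlim_at_top)
  then obtain T where T: "\<And>t. T \<le> t \<Longrightarrow> \<bar>K\<bar> \<le> f t / t" by (auto simp: eventually_at_top_linorder)
  define T' where "T' = max T 1"
  have "\<bar>K\<bar> * (t - T') \<le> f t" if t: "0 \<le> t" for t
  proof (cases "T' \<le> t")
    case True
    then have "\<bar>K\<bar> * t \<le> f t" using T[of t] by (simp add: T'_def field_simps)
    moreover have "\<bar>K\<bar> * (t - T') \<le> \<bar>K\<bar> * t" by (rule mult_left_mono) (auto simp: T'_def)
    ultimately show ?thesis by simp
  next
    case False
    then have "\<bar>K\<bar> * (t - T') \<le> 0" by (simp add: mult_nonneg_nonpos)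
    then show ?thesis using nonlin_ge_1[OF assms t] by simp
  qed
  then have "K * (t - (if K \<ge> 0 then T' else 0)) \<le> f t" if "0 \<le> t" for t
    using that nonlin_ge_1[OF assms that] mult_nonpos_nonneg[of K t] by (force split: if_splits)
  moreover have "0 \<le> (if K \<ge> 0 then T' else 0)" by (auto simp: T'_def max_def)
  ultimately show ?thesis using that by blast
qed

text \<open>At \<open>r = 1/4\<close> each component controls the source term of the other one, and superlinearity
  closes the loop.\<close>

lemma radial_ode_uniform_bound:
  assumes fg: "nonlin f" "nonlin g" and l0: "0 < l0"
  obtains M where "0 \<le> M" "\<And>l m u v k j. l0 \<le> l \<Longrightarrow> l0 \<le> m \<Longrightarrow> radial_ode n f g l m u v k j \<Longrightarrow>
     u (1/4) \<le> M \<and> v (1/4) \<le> M"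
proof -
  define d where "d = min (D_half f 0) (D_half g 0)"
  have d: "0 < d" using fg by (simp add: d_def nonlin_def)
  \<comment> \<open>The product of the constants of \<open>flux_ge\<close> and
    \<open>flux_le\<close> at b = 1/4, with both parameters replaced by \<open>l0\<close>; it yields
    \<open>c * g (v (1/4)) \<le> u (1/4)\<close> and its mirror image.\<close>
  define c where "c = (3/4) * ((1/4) ^ (n + 1) * (l0 * d / (real n + 1)))"
  have c: "0 < c" using d l0 by (simp add: c_def)
  \<comment> \<open>Slope 2/c turns the two bounds into 2 (v - T) <= u and 2 (u - S) <= v at 1/4; as
    2 * 2 > 1, they bound both values.\<close>
  obtain S where S: "0 \<le> S" "\<And>t. 0 \<le> t \<Longrightarrow> (2 / c) * (t - S) \<le> f t" using nonlin_superlinear[OF fg(1)] by blast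
  obtain T where T: "0 \<le> T" "\<And>t. 0 \<le> t \<Longrightarrow> (2 / c) * (t - T) \<le> g t" using nonlin_superlinear[OF fg(2)] by blast
  have half: "c * g (v (1/4)) \<le> u (1/4)"
    if fg: "nonlin f" "nonlin g" "l0 \<le> l" "d \<le> D_half f 0" and o: "radial_ode n f g l m u v k j" for f g l m u v k j
  proof -
    have gv: "0 \<le> g (v (1/4))" using nonlin_ge_1[OF fg(2) radial_odeD(3)[OF radial_ode_swap[OF o], of "1/4"]] by simp
    have "c * g (v (1/4)) = (3/4) * ((1/4) ^ (n + 1) * (l0 * d * g (v (1/4)) / (real n + 1)))"
      by (simp add: c_def)
    also have "\<dots> \<le> (3/4) * ((1/4) ^ (n + 1) * (l * D_half f 0 * g (v (1/4)) / (real n + 1)))"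
      using gv fg l0 d by (intro mult_left_mono divide_right_mono mult_right_mono mult_mono) auto
    also have "\<dots> \<le> (3/4) * ((1/4) ^ (n + 1) * k (1/4))"
      by (rule mult_left_mono[OF flux_ge[OF fg(1,2) _ o, of "1/4"]]) (use l0 fg in auto)
    also have "\<dots> \<le> u (1/4)"
      using flux_le[OF fg(1,2) _ o, of "1/4"] l0 fg by simp
    finally show ?thesis .
  qed
  show thesis
  proof (rule that[of "2 * (S + T)"])
    fix l m u v k j assume l: "l0 \<le> l" "l0 \<le> m" and o: "radial_ode n f g l m u v k j"
    have nn: "0 \<le> u (1/4)" "0 \<le> v (1/4)"
      using radial_odeD(3)[OF o, of "1/4"] radial_odeD(3)[OF radial_ode_swap[OF o], of "1/4"] by auto
    have "c * ((2 / c) * (v (1/4) - T)) \<le> c * g (v (1/4))" using T(2)[OF nn(2)] c by (simp add: mult_left_mono del: times_divide_eq_left times_divide_eq_right)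
    also have "\<dots> \<le> u (1/4)" using half[OF fg l(1) _ o] by (simp add: d_def)
    finally have 1: "2 * (v (1/4) - T) \<le> u (1/4)" using c by simp
    have "c * ((2 / c) * (u (1/4) - S)) \<le> c * f (u (1/4))" using S(2)[OF nn(1)] c by (simp add: mult_left_mono del: times_divide_eq_left times_divide_eq_right)
    also have "\<dots> \<le> v (1/4)" using half[OF fg(2,1) l(2) _ radial_ode_swap[OF o]] by (simp add: d_def)
    finally have 2: "2 * (u (1/4) - S) \<le> v (1/4)" using c by simp
    have "u (1/4) \<le> 2 * (S + T)" "v (1/4) \<le> 2 * (S + T)" 
      using 1 2 S(1) T(1) by (auto simp: field_simps)
    then show "u (1/4) \<le> 2 * (S + T) \<and> v (1/4) \<le> 2 * (S + T)" ..
  qed (use S T in simp)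
qed

section \<open>Stability of minimal solutions\<close>

lemma increment_pos:
  fixes \<phi> :: "real \<Rightarrow> real"
  assumes "a < b" "continuous_on {a..b} \<phi>"
    and d: "\<And>x. a < x \<Longrightarrow> x < b \<Longrightarrow> (\<phi> has_real_derivative \<phi>' x) (at x)"
    and c: "\<And>x. a < x \<Longrightarrow> x < b \<Longrightarrow> 0 < \<phi>' x"
  shows "\<phi> a < \<phi> b"
  by (rule DERIV_pos_imp_increasing_open[OF assms(1) _ assms(2)]) (use c d in blast)

text \<open>The parameters differ and f', g are positive, so the source difference is positive;
  hence so is the flux difference, and u - u' decreases to 0 at the boundary. Positivity permits
  division by u - u' in Picone's identity, and because the maximum is at the centre, closeness there
  is uniform closeness.\<close>

lemma radial_ode_strict:
  assumes fg: "nonlin f" "nonlin g" and l: "0 \<le> l'" "l' < l"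
    and o: "radial_ode n f g l m u v k j" and o': "radial_ode n f g l' m' u' v' k' j'"
    and le: "\<And>r. 0 \<le> r \<Longrightarrow> r \<le> 1 \<Longrightarrow> u' r \<le> u r" "\<And>r. 0 \<le> r \<Longrightarrow> r \<le> 1 \<Longrightarrow> v' r \<le> v r"
  shows "0 < r \<Longrightarrow> r < 1 \<Longrightarrow> k' r < k r" and "0 \<le> r \<Longrightarrow> r < 1 \<Longrightarrow> u' r < u r"
    and "0 \<le> r \<Longrightarrow> r < 1 \<Longrightarrow> u r - u' r \<le> u 0 - u' 0"
proof -
  note nn = radial_odeD(3)[OF o] radial_odeD(3)[OF radial_ode_swap[OF o]]
    radial_odeD(3)[OF o'] radial_odeD(3)[OF radial_ode_swap[OF o']]
  have h: "src f g l' u' v' r < src f g l u v r" if r: "0 < r" "r < 1" for r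
  proof -
    have "l' * (D_half f (u' r) * g (v' r)) < l * (D_half f (u' r) * g (v' r))"
      using l r nonlin_deriv_pos[OF fg(1), of "u' r"] nonlin_ge_1[OF fg(2), of "v' r"] nn
      by (intro mult_strict_right_mono mult_pos_pos) (auto intro: less_le_trans[of 0 1])
    also have "\<dots> \<le> l * D_half f (u r) * g (v r)"
      using source_mono[OF fg, of l l "u' r" "u r" "v' r" "v r"] l r nn le by (simp add: mult.assoc)
    finally show ?thesis by (simp add: src_def mult.assoc)
  qed
  have k: "k' r < k r" if r: "0 < r" "r < 1" for r
  proof -
    have "0 ^ (n + 1) * k 0 - 0 ^ (n + 1) * k' 0 < r ^ (n + 1) * k r - r ^ (n + 1) * k' r"
    proof (rule increment_pos[OF r(1)])
      show "continuous_on {0..r} (\<lambda>r. r ^ (n + 1) * k r - r ^ (n + 1) * k' r)"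
        by (intro continuous_intros continuous_on_subset[OF radial_odeD(2)[OF o]]
            continuous_on_subset[OF radial_odeD(2)[OF o']]) (use r in auto)
      show "((\<lambda>r. r ^ (n + 1) * k r - r ^ (n + 1) * k' r) has_real_derivative
          x ^ n * src f g l u v x - x ^ n * src f g l' u' v' x) (at x)" if "0 < x" "x < r" for x
        by (intro DERIV_diff flux_derivative radial_odeD(7)[OF o] radial_odeD(7)[OF o']) (use that r in auto)
      show "0 < x ^ n * src f g l u v x - x ^ n * src f g l' u' v' x" if "0 < x" "x < r" for x
        using h[of x] that r by simp
    qed
    then have "0 < r ^ (n + 1) * (k r - k' r)" by (simp add: right_diff_distrib)
    then have "0 < k r - k' r" by (rule zero_less_mult_pos) (use r in simp)
    then show ?thesis by simp
  qed
  have cont: "continuous_on {a..b} (\<lambda>r. u' r - u r)" if "0 \<le> a" "b \<le> 1" for a b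
    by (intro continuous_intros continuous_on_subset[OF radial_odeD(1)[OF o]]
        continuous_on_subset[OF radial_odeD(1)[OF o']]) (use that in auto)
  have der: "((\<lambda>r. u' r - u r) has_real_derivative - (x * k' x) - - (x * k x)) (at x)" if "0 < x" "x < 1" for x
    by (intro DERIV_diff radial_odeD(6)[OF o] radial_odeD(6)[OF o']) (use that in auto)
  show "0 < r \<Longrightarrow> r < 1 \<Longrightarrow> k' r < k r" by (rule k)
  show "u' r < u r" if r: "0 \<le> r" "r < 1"
  proof -
    have "u' r - u r < u' 1 - u 1"
      by (rule increment_pos[OF r(2) cont der]) (use r k in auto)
    then show ?thesis using radial_odeD(5)[OF o] radial_odeD(5)[OF o'] by simp
  qed
  show "u r - u' r \<le> u 0 - u' 0" if r: "0 \<le> r" "r < 1"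
  proof -
    have "0 * (r - 0) \<le> (u' r - u r) - (u' 0 - u 0)"
      by (rule increment_ge[OF r(1) cont der]) (use r k in \<open>auto simp: less_imp_le\<close>)
    then show ?thesis by simp
  qed
qed

text \<open>By the mean value theorem the difference quotient of f' is f'' at an intermediate point,
  so uniform continuity of f' and f'' on \<open>{0..M}\<close> suffices.\<close>

lemma nonlin_modulus:
  assumes f: "nonlin f" and e: "0 < e"
  obtains d where "0 < d" "\<And>x y. 0 \<le> y \<Longrightarrow> y < x \<Longrightarrow> x \<le> M \<Longrightarrow> x - y \<le> d \<Longrightarrow>
      D_half f x - D_half f y \<le> e \<and> D_half (D_half f) x - (D_half f x - D_half f y) / (x - y) \<le> e"
proof -
  have "uniformly_continuous_on {0..M} (D_half f)" "uniformly_continuous_on {0..M} (D_half (D_half f))"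
    using nonlin_continuous[OF f] by (auto intro!: compact_uniformly_continuous elim: continuous_on_subset)
  then obtain d1 d2 where d: "0 < d1" "0 < d2"
    "\<And>x y. x \<in> {0..M} \<Longrightarrow> y \<in> {0..M} \<Longrightarrow> dist y x < d1 \<Longrightarrow> dist (D_half f y) (D_half f x) < e"
    "\<And>x y. x \<in> {0..M} \<Longrightarrow> y \<in> {0..M} \<Longrightarrow> dist y x < d2 \<Longrightarrow> dist (D_half (D_half f) y) (D_half (D_half f) x) < e"
    using e unfolding uniformly_continuous_on_def by metis
  show thesis
  proof (rule that[of "min d1 d2 / 2"])
    fix x y assume xy: "0 \<le> y" "y < x" "x \<le> M" "x - y \<le> min d1 d2 / 2"
    have "dist (D_half f x) (D_half f y) < e" by (rule d(3)) (use xy d in \<open>auto simp: dist_real_def\<close>)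
    moreover obtain z where z: "y < z" "z < x" "D_half f x - D_half f y = (x - y) * D_half (D_half f) z"
    proof -
      have "continuous_on {y..x} (D_half f)" 
        using nonlin_continuous(2)[OF f] by (rule continuous_on_subset) (use xy in auto)
      moreover have "(D_half f has_derivative (\<lambda>h. D_half (D_half f) t * h)) (at t)" if "y < t" "t < x" for t
      proof -
        have "(D_half f has_real_derivative D_half (D_half f) t) (at t within {0<..})"
          by (rule DERIV_subset[OF nonlin_derivative(2)[OF f]]) (use that xy in auto)
        then have "(D_half f has_real_derivative D_half (D_half f) t) (at t)"
          using at_within_open[of t "{0<..}"] that xy by simp
        then show ?thesis by (simp add: has_field_derivative_def)
      qed
      ultimately show thesis using mvt[OF xy(2), of "D_half f" "\<lambda>t h. D_half (D_half f) t * h"] that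
        by (metis mult.commute)
    qed
    moreover have "dist (D_half (D_half f) x) (D_half (D_half f) z) < e" 
      by (rule d(4)) (use xy d z in \<open>auto simp: dist_real_def\<close>)
    ultimately show "D_half f x - D_half f y \<le> e \<and> D_half (D_half f) x - (D_half f x - D_half f y) / (x - y) \<le> e"
      using xy by (auto simp: dist_real_def)
  qed (use d in simp)
qed

section \<open>Linearisation and Picone's identity\<close>

lemma src_derivative:
  assumes fg: "nonlin f" "nonlin g" and o: "radial_ode n f g l m u v k j" and r: "0 < r" "r < 1"
  shows "(src f g l u v has_real_derivative
     - (l * (D_half (D_half f) (u r) * g (v r) * (r * k r) + D_half f (u r) * D_half g (v r) * (r * j r)))) (at r)"
proof -
  have chain: "((\<lambda>r. F (w r)) has_real_derivative F' * w') (at r)"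
    if F: "(F has_real_derivative F') (at (w r) within {0..})" and w: "(w has_real_derivative w') (at r)"
      and nn: "\<And>r. 0 < r \<Longrightarrow> r < 1 \<Longrightarrow> 0 \<le> w r" for F w F' w'
  proof -
    have "(F has_real_derivative F') (at (w r) within w ` {0<..<1})"
      by (rule DERIV_subset[OF F]) (use nn in auto)
    then have "((F \<circ> w) has_real_derivative F' * w') (at r within {0<..<1})"
      by (rule DERIV_image_chain) (rule has_field_derivative_at_within[OF w])
    then show ?thesis using at_within_open[of r "{0<..<1}"] r by (simp add: o_def)
  qed
  have nn: "0 \<le> u r" "0 \<le> v r" if "0 < r" "r < 1" for r
    using radial_odeD(3)[OF o, of r] radial_odeD(3)[OF radial_ode_swap[OF o], of r] that by auto
  have "((\<lambda>r. D_half f (u r)) has_real_derivative D_half (D_half f) (u r) * - (r * k r)) (at r)"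
    by (rule chain[OF nonlin_derivative(2)[OF fg(1) nn(1)] radial_odeD(6)[OF o]]) (use r nn in auto)
  moreover have "((\<lambda>r. g (v r)) has_real_derivative D_half g (v r) * - (r * j r)) (at r)"
    by (rule chain[OF nonlin_derivative(1)[OF fg(2) nn(2)] radial_odeD(6)[OF radial_ode_swap[OF o]]]) (use r nn in auto)
  ultimately show ?thesis unfolding src_def[abs_def]
    by (auto intro!: derivative_eq_intros simp: algebra_simps)
qed

text \<open>Derivative of \<open>r\<^sup>n (\<phi>\<^sub>r \<phi> - p\<^sub>r \<phi>\<^sup>2 / p)\<close> for \<open>\<phi> = u\<^sub>r = -r k\<close>, where \<open>p\<^sub>r = -r \<kappa>\<close>: the first term comes
  from the linearised equation satisfied by \<open>u\<^sub>r\<close>, the second one from Picone's identity.\<close>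

lemma picone_derivative:
  fixes n :: nat and r \<delta> h' :: real and h k \<kappa> p :: "real \<Rightarrow> real"
  assumes r: "0 < r" and p: "0 < p r"
    and k: "(k has_real_derivative (h r - (real n + 1) * k r) / r) (at r)"
    and h: "(h has_real_derivative h') (at r)"
    and \<kappa>: "(\<kappa> has_real_derivative (\<delta> - (real n + 1) * \<kappa> r) / r) (at r)"
    and dp: "(p has_real_derivative - (r * \<kappa> r)) (at r)"
  shows "((\<lambda>r. r ^ n * (r * k r * (h r - real n * k r + (r * \<kappa> r) * (r * k r) / p r))) has_real_derivative
     r ^ n * ((h r - real n * k r + (r * \<kappa> r) * (r * k r) / p r)\<^sup>2 + real n * (k r)\<^sup>2 + r * k r * h' + \<delta> * (r * k r)\<^sup>2 / p r)) (at r)"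
proof -
  \<comment> \<open>X = p (r k / p)_r, whose square is the nonnegative term in Picone's identity.
    The term \<open>real n * (k r)\<^sup>2\<close> arises from differentiating the coefficient n/r
    of the radial Laplacian and becomes the left side of the stability inequality.\<close>
  define X where "X = (\<lambda>r. h r - real n * k r + (r * \<kappa> r) * (r * k r) / p r)"
  have a: "((\<lambda>r. r * k r) has_real_derivative h r - real n * k r) (at r)"
    by (rule DERIV_cong[OF DERIV_mult[OF DERIV_ident k]]) (use r in \<open>simp add: field_simps\<close>)
  have \<alpha>: "((\<lambda>r. r * \<kappa> r) has_real_derivative \<delta> - real n * \<kappa> r) (at r)"
    by (rule DERIV_cong[OF DERIV_mult[OF DERIV_ident \<kappa>]]) (use r in \<open>simp add: field_simps\<close>)
  have X: "(X has_real_derivative h' - real n * ((h r - (real n + 1) * k r) / r)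
     + (((\<delta> - real n * \<kappa> r) * (r * k r) + (h r - real n * k r) * (r * \<kappa> r)) * p r
         - (r * \<kappa> r) * (r * k r) * - (r * \<kappa> r)) / (p r * p r)) (at r)"
    unfolding X_def
    by (intro DERIV_add DERIV_diff h DERIV_cmult k DERIV_divide DERIV_mult a \<alpha> dp) (use p in simp)
  have pw: "((\<lambda>r. r ^ n) has_real_derivative real n * r ^ n / r) (at r)"
    by (rule DERIV_cong[OF DERIV_pow]) (use r in \<open>cases n; simp\<close>)
  have eq: "real n * r ^ n / r * (r * k r * X r)
     + ((h r - real n * k r) * X r + (h' - real n * ((h r - (real n + 1) * k r) / r)
     + (((\<delta> - real n * \<kappa> r) * (r * k r) + (h r - real n * k r) * (r * \<kappa> r)) * p r
         - (r * \<kappa> r) * (r * k r) * - (r * \<kappa> r)) / (p r * p r)) * (r * k r)) * r ^ n =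
     r ^ n * ((X r)\<^sup>2 + real n * (k r)\<^sup>2 + r * k r * h' + \<delta> * (r * k r)\<^sup>2 / p r)"
    using r p by (simp add: X_def divide_simps) (simp add: power2_eq_square algebra_simps)
  have "((\<lambda>r. r ^ n * (r * k r * X r)) has_real_derivative
     r ^ n * ((X r)\<^sup>2 + real n * (k r)\<^sup>2 + r * k r * h' + \<delta> * (r * k r)\<^sup>2 / p r)) (at r)"
    by (rule DERIV_cong[OF DERIV_mult[OF pw DERIV_mult[OF a X]] eq])
  then show ?thesis by (simp add: X_def)
qed

text \<open>Three inequalities are added. Completing the square gives X^2 + 2 s a X >= -s^2 a^2.
  Expanding (q a - p b)^2 >= 0 bounds the coupling 2 c a b by the Picone terms; division by
  \<open>l\<close> and \<open>m\<close> has given both equations the same \<open>c\<close>.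
  Replacing P, S and twice Q by A, B and c costs at most 4 e W^2.\<close>

lemma stability_pointwise:
  fixes n :: nat and r s l m p q a b c e k j W A B P Q S d1 d2 X Y :: real
  assumes pos: "0 < l" "0 < m" "0 < p" "0 < q" "0 \<le> a" "0 \<le> b" "0 \<le> c" "0 \<le> e"
    and k: "a = r * k" "b = r * j" and W: "a \<le> W" "b \<le> W" and r: "0 \<le> r" "r \<le> 1"
    and d: "l * (A * p + c * q) \<le> d1" "m * (B * q + c * p) \<le> d2"
    and err: "P - A \<le> e" "S - B \<le> e" "Q - c \<le> e"
  shows "r ^ n * ((real n - s\<^sup>2 * r\<^sup>2) * (k\<^sup>2 / l + j\<^sup>2 / m)) - 4 * e * W\<^sup>2
    \<le> (r ^ n * (X\<^sup>2 + real n * k\<^sup>2 + a * - (l * (P * a + Q * b)) + d1 * a\<^sup>2 / p) / l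
       + r ^ n * (Y\<^sup>2 + real n * j\<^sup>2 + b * - (m * (S * b + Q * a)) + d2 * b\<^sup>2 / q) / m)
      + 2 * s * (r ^ n * (a * X) / l + r ^ n * (b * Y) / m)"
proof -
  have quad: "- (s\<^sup>2 * r\<^sup>2 * k\<^sup>2) \<le> X\<^sup>2 + 2 * s * (a * X)" "- (s\<^sup>2 * r\<^sup>2 * j\<^sup>2) \<le> Y\<^sup>2 + 2 * s * (b * Y)"
    using zero_le_power2[of "X + s * a"] zero_le_power2[of "Y + s * b"]
    by (simp_all add: k power2_eq_square algebra_simps)
  have "A * a\<^sup>2 + c * q * a\<^sup>2 / p = (A * p + c * q) * (a\<^sup>2 / p)" using pos by (simp add: field_simps)
  also have "\<dots> \<le> (d1 / l) * (a\<^sup>2 / p)"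
    by (rule mult_right_mono) (use d(1) pos in \<open>simp_all add: pos_le_divide_eq mult.commute\<close>)
  finally have d1: "A * a\<^sup>2 + c * q * a\<^sup>2 / p \<le> d1 * a\<^sup>2 / p / l" by (simp add: mult.commute)
  have "B * b\<^sup>2 + c * p * b\<^sup>2 / q = (B * q + c * p) * (b\<^sup>2 / q)" using pos by (simp add: field_simps)
  also have "\<dots> \<le> (d2 / m) * (b\<^sup>2 / q)"
    by (rule mult_right_mono) (use d(2) pos in \<open>simp_all add: pos_le_divide_eq mult.commute\<close>)
  finally have d2: "B * b\<^sup>2 + c * p * b\<^sup>2 / q \<le> d2 * b\<^sup>2 / q / m" by (simp add: mult.commute)
  have "0 \<le> c * (q * a - p * b)\<^sup>2 / (p * q)" using pos by simp
  also have "\<dots> = c * q * a\<^sup>2 / p + c * p * b\<^sup>2 / q - 2 * c * a * b"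
    using pos by (simp add: field_simps power2_eq_square)
  finally have amgm: "2 * c * a * b \<le> c * q * a\<^sup>2 / p + c * p * b\<^sup>2 / q" by simp
  have sq: "a\<^sup>2 \<le> W\<^sup>2" "b\<^sup>2 \<le> W\<^sup>2" "a * b \<le> W\<^sup>2"
    using pos W by (auto simp: power2_eq_square intro!: mult_mono)
  have "(P - A) * a\<^sup>2 \<le> e * W\<^sup>2" "(S - B) * b\<^sup>2 \<le> e * W\<^sup>2" "(Q - c) * (a * b) \<le> e * W\<^sup>2"
    using err sq pos by (auto intro: order_trans[OF mult_right_mono mult_left_mono])
  then have errs: "P * a\<^sup>2 + S * b\<^sup>2 + 2 * Q * a * b - 4 * e * W\<^sup>2 \<le> A * a\<^sup>2 + B * b\<^sup>2 + 2 * c * a * b"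
    by (simp add: algebra_simps)
  define T where "T = (X\<^sup>2 + real n * k\<^sup>2 + a * - (l * (P * a + Q * b)) + d1 * a\<^sup>2 / p) / l
       + (Y\<^sup>2 + real n * j\<^sup>2 + b * - (m * (S * b + Q * a)) + d2 * b\<^sup>2 / q) / m + 2 * s * (a * X / l + b * Y / m)"
  have "T = (X\<^sup>2 + 2 * s * (a * X)) / l + (Y\<^sup>2 + 2 * s * (b * Y)) / m + real n * (k\<^sup>2 / l + j\<^sup>2 / m)
      - (P * a\<^sup>2 + S * b\<^sup>2 + 2 * Q * a * b) + d1 * a\<^sup>2 / p / l + d2 * b\<^sup>2 / q / m"
    using pos by (simp add: T_def add_divide_distrib diff_divide_distrib power2_eq_square) (simp add: algebra_simps)
  moreover have "- (s\<^sup>2 * r\<^sup>2 * k\<^sup>2) / l \<le> (X\<^sup>2 + 2 * s * (a * X)) / l"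
      "- (s\<^sup>2 * r\<^sup>2 * j\<^sup>2) / m \<le> (Y\<^sup>2 + 2 * s * (b * Y)) / m"
    using quad pos by (simp_all only: divide_right_mono less_imp_le)
  ultimately have "- (s\<^sup>2 * r\<^sup>2 * k\<^sup>2) / l - (s\<^sup>2 * r\<^sup>2 * j\<^sup>2) / m + real n * (k\<^sup>2 / l + j\<^sup>2 / m) - 4 * e * W\<^sup>2 \<le> T"
    using errs d1 d2 amgm by simp
  also have "- (s\<^sup>2 * r\<^sup>2 * k\<^sup>2) / l - (s\<^sup>2 * r\<^sup>2 * j\<^sup>2) / m + real n * (k\<^sup>2 / l + j\<^sup>2 / m) =
      (real n - s\<^sup>2 * r\<^sup>2) * (k\<^sup>2 / l + j\<^sup>2 / m)" by (simp add: algebra_simps)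
  finally have "r ^ n * ((real n - s\<^sup>2 * r\<^sup>2) * (k\<^sup>2 / l + j\<^sup>2 / m) - 4 * e * W\<^sup>2) \<le> r ^ n * T"
    using r by (intro mult_left_mono) auto
  moreover have "r ^ n * (4 * e * W\<^sup>2) \<le> 1 * (4 * e * W\<^sup>2)"
    by (rule mult_right_mono) (use r pos in \<open>auto intro: power_le_one\<close>)
  moreover have "r ^ n * T = (r ^ n * (X\<^sup>2 + real n * k\<^sup>2 + a * - (l * (P * a + Q * b)) + d1 * a\<^sup>2 / p) / l
       + r ^ n * (Y\<^sup>2 + real n * j\<^sup>2 + b * - (m * (S * b + Q * a)) + d2 * b\<^sup>2 / q) / m)
      + 2 * s * (r ^ n * (a * X) / l + r ^ n * (b * Y) / m)"
    unfolding T_def by (simp only: distrib_left times_divide_eq_right mult.left_commute)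
  ultimately show ?thesis by (simp add: right_diff_distrib)
qed

text \<open>With s = \<eta>'/\<eta>, multiplication by \<eta>^2 turns D + 2 s G into (\<eta>^2 G)',
  and integration gives the weighted stability inequality; leaving s free postpones the choice of
  \<eta>. The hypotheses \<open>err\<close> measure how far the system satisfied by the differences
  is from the linearisation at (u, v).\<close>

lemma stability_riccati:
  assumes fg: "nonlin f" "nonlin g" and l: "0 < l'" "l' < l" and m: "0 < m'" "m' < m"
    and o: "radial_ode n f g l m u v k j" and o': "radial_ode n f g l' m' u' v' k' j'"
    and le: "\<And>r. 0 \<le> r \<Longrightarrow> r \<le> 1 \<Longrightarrow> u' r \<le> u r" "\<And>r. 0 \<le> r \<Longrightarrow> r \<le> 1 \<Longrightarrow> v' r \<le> v r"
    and W: "\<And>r. 0 \<le> r \<Longrightarrow> r \<le> 1 \<Longrightarrow> r * k r \<le> W" "\<And>r. 0 \<le> r \<Longrightarrow> r \<le> 1 \<Longrightarrow> r * j r \<le> W"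
    and e: "0 \<le> e"
    and err: "\<And>r. 0 < r \<Longrightarrow> r < 1 \<Longrightarrow>
        (D_half (D_half f) (u r) - (D_half f (u r) - D_half f (u' r)) / (u r - u' r)) * g (v r) \<le> e"
      "\<And>r. 0 < r \<Longrightarrow> r < 1 \<Longrightarrow>
        (D_half (D_half g) (v r) - (D_half g (v r) - D_half g (v' r)) / (v r - v' r)) * f (u r) \<le> e"
      "\<And>r. 0 < r \<Longrightarrow> r < 1 \<Longrightarrow> D_half f (u r) * D_half g (v r) - D_half f (u' r) * D_half g (v' r) \<le> e"
  obtains G D where "continuous_on {0..<1} G"
    "\<And>r. 0 < r \<Longrightarrow> r < 1 \<Longrightarrow> (G has_real_derivative D r) (at r)"
    "\<And>r s. 0 < r \<Longrightarrow> r < 1 \<Longrightarrow>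
       r ^ n * ((real n - s\<^sup>2 * r\<^sup>2) * ((k r)\<^sup>2 / l + (j r)\<^sup>2 / m)) - 4 * e * W\<^sup>2 \<le> D r + 2 * s * G r"
proof -
  note swap = radial_ode_swap[OF o] and swap' = radial_ode_swap[OF o']
  have lp: "0 < l" "0 < m" using l m by auto
  have p: "u' r < u r" "v' r < v r" if "0 \<le> r" "r < 1" for r
    using radial_ode_strict(2)[OF fg _ l(2) o o' le] radial_ode_strict(2)[OF fg(2,1) _ m(2) swap swap' le(2,1)]
      that l m by auto
  have nn: "0 \<le> u r" "0 \<le> v r" "0 \<le> u' r" "0 \<le> v' r" "0 \<le> k r" "0 \<le> j r" if "0 \<le> r" "r \<le> 1" for r
    using radial_odeD(3,4)[OF o that] radial_odeD(3,4)[OF swap that] radial_odeD(3)[OF o' that] radial_odeD(3)[OF swap' that]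
    by auto
  define h where "h = src f g l u v"
  define i where "i = src g f m v u"
  define X where "X r = h r - real n * k r + (r * (k r - k' r)) * (r * k r) / (u r - u' r)" for r
  define Y where "Y r = i r - real n * j r + (r * (j r - j' r)) * (r * j r) / (v r - v' r)" for r
  define dh where "dh r = - (l * (D_half (D_half f) (u r) * g (v r) * (r * k r) + D_half f (u r) * D_half g (v r) * (r * j r)))" for r
  define di where "di r = - (m * (D_half (D_half g) (v r) * f (u r) * (r * j r) + D_half g (v r) * D_half f (u r) * (r * k r)))" for r
  define G where "G r = r ^ n * (r * k r * X r) / l + r ^ n * (r * j r * Y r) / m" for r
  define D where "D r = r ^ n * ((X r)\<^sup>2 + real n * (k r)\<^sup>2 + r * k r * dh r + (h r - src f g l' u' v' r) * (r * k r)\<^sup>2 / (u r - u' r)) / l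
     + r ^ n * ((Y r)\<^sup>2 + real n * (j r)\<^sup>2 + r * j r * di r + (i r - src g f m' v' u' r) * (r * j r)\<^sup>2 / (v r - v' r)) / m" for r
  show thesis
  proof (rule that)
    \<comment> \<open>The point 1 is left out because u - u' and v - v', by which \<open>X\<close>
      and \<open>Y\<close> divide, vanish there.\<close>
    have sub: "{0..<1} \<subseteq> {0..1::real}" by auto
    note c = continuous_on_subset[OF radial_odeD(1)[OF o] sub] continuous_on_subset[OF radial_odeD(1)[OF swap] sub]
      continuous_on_subset[OF radial_odeD(2)[OF o] sub] continuous_on_subset[OF radial_odeD(2)[OF swap] sub]
      continuous_on_subset[OF radial_odeD(1)[OF o'] sub] continuous_on_subset[OF radial_odeD(1)[OF swap'] sub]
      continuous_on_subset[OF radial_odeD(2)[OF o'] sub] continuous_on_subset[OF radial_odeD(2)[OF swap'] sub]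
    have "continuous_on {0..1} h" "continuous_on {0..1} i"
      unfolding h_def i_def using src_continuous[OF fg radial_odeD(1)[OF o] radial_odeD(1)[OF swap]]
        src_continuous[OF fg(2,1) radial_odeD(1)[OF swap] radial_odeD(1)[OF o]] nn by auto
    then have ch: "continuous_on {0..<1} h" "continuous_on {0..<1} i"
      using continuous_on_subset[OF _ sub] by blast+
    have ne: "\<forall>r\<in>{0..<1}. u r - u' r \<noteq> 0" "\<forall>r\<in>{0..<1}. v r - v' r \<noteq> 0" using p by force+
    show "continuous_on {0..<1} G" unfolding G_def[abs_def] X_def Y_def
      by (intro continuous_on_add continuous_on_diff continuous_on_mult continuous_on_divide
          continuous_on_power continuous_on_const continuous_on_id c ch ne) (use lp in auto)
  next
    fix r :: real assume r: "0 < r" "r < 1"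
    have dk: "((\<lambda>r. k r - k' r) has_real_derivative (h r - src f g l' u' v' r - (real n + 1) * (k r - k' r)) / r) (at r)"
      by (rule DERIV_cong[OF DERIV_diff[OF radial_odeD(7)[OF o r] radial_odeD(7)[OF o' r]]])
         (simp add: h_def diff_divide_distrib[symmetric] algebra_simps)
    have dj: "((\<lambda>r. j r - j' r) has_real_derivative (i r - src g f m' v' u' r - (real n + 1) * (j r - j' r)) / r) (at r)"
      by (rule DERIV_cong[OF DERIV_diff[OF radial_odeD(7)[OF swap r] radial_odeD(7)[OF swap' r]]])
         (simp add: i_def diff_divide_distrib[symmetric] algebra_simps)
    have du: "((\<lambda>r. u r - u' r) has_real_derivative - (r * (k r - k' r))) (at r)"
      by (rule DERIV_cong[OF DERIV_diff[OF radial_odeD(6)[OF o r] radial_odeD(6)[OF o' r]]]) (simp add: algebra_simps)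
    have dv: "((\<lambda>r. v r - v' r) has_real_derivative - (r * (j r - j' r))) (at r)"
      by (rule DERIV_cong[OF DERIV_diff[OF radial_odeD(6)[OF swap r] radial_odeD(6)[OF swap' r]]]) (simp add: algebra_simps)
    have pr: "0 < u r - u' r" "0 < v r - v' r" using p[of r] r by auto
    have 1: "((\<lambda>r. r ^ n * (r * k r * X r)) has_real_derivative
       r ^ n * ((X r)\<^sup>2 + real n * (k r)\<^sup>2 + r * k r * dh r + (h r - src f g l' u' v' r) * (r * k r)\<^sup>2 / (u r - u' r))) (at r)"
      unfolding X_def
      by (rule picone_derivative[OF r(1) pr(1) radial_odeD(7)[OF o r, folded h_def]
          src_derivative[OF fg o r, folded h_def dh_def] dk du])
    have 2: "((\<lambda>r. r ^ n * (r * j r * Y r)) has_real_derivative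
       r ^ n * ((Y r)\<^sup>2 + real n * (j r)\<^sup>2 + r * j r * di r + (i r - src g f m' v' u' r) * (r * j r)\<^sup>2 / (v r - v' r))) (at r)"
      unfolding Y_def
      by (rule picone_derivative[OF r(1) pr(2) radial_odeD(7)[OF swap r, folded i_def]
          src_derivative[OF fg(2,1) swap r, folded i_def di_def] dj dv])
    show "(G has_real_derivative D r) (at r)"
      unfolding G_def[abs_def] D_def by (intro DERIV_add DERIV_cdivide 1 2)
  next
    fix r s :: real assume r: "0 < r" "r < 1"
    define A where "A = (D_half f (u r) - D_half f (u' r)) / (u r - u' r) * g (v r)"
    define B where "B = (D_half g (v r) - D_half g (v' r)) / (v r - v' r) * f (u r)"
    define c where "c = D_half f (u' r) * D_half g (v' r)"
    have pr: "0 < u r - u' r" "0 < v r - v' r" using p[of r] r by auto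
    have nr: "0 \<le> u r" "0 \<le> v r" "0 \<le> u' r" "0 \<le> v' r" "0 \<le> k r" "0 \<le> j r" using nn[of r] r by auto
    have c0: "0 \<le> c" using nonlin_deriv_pos[OF fg(1) nr(3)] nonlin_deriv_pos[OF fg(2) nr(4)] by (simp add: c_def)
    have Ap: "A * (u r - u' r) = (D_half f (u r) - D_half f (u' r)) * g (v r)" using pr by (simp add: A_def)
    have Bp: "B * (v r - v' r) = (D_half g (v r) - D_half g (v' r)) * f (u r)" using pr by (simp add: B_def)
    \<comment> \<open>The supersolution property: l' is replaced by l in the smaller source, the
      change of f' is kept exactly as A (u - u'), and the change of g is bounded below by the
      tangent at v'.\<close>
    have 1: "l * (A * (u r - u' r) + c * (v r - v' r)) \<le> h r - src f g l' u' v' r"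
    proof -
      have "l' * (D_half f (u' r) * g (v' r)) \<le> l * (D_half f (u' r) * g (v' r))"
        using l nonlin_deriv_pos[OF fg(1) nr(3)] nonlin_ge_1[OF fg(2) nr(4)] by (intro mult_right_mono) auto
      moreover have "D_half f (u' r) * (D_half g (v' r) * (v r - v' r)) \<le> D_half f (u' r) * (g (v r) - g (v' r))"
        using nonlin_above_tangent[OF fg(2) nr(4,2)] nonlin_deriv_pos[OF fg(1) nr(3)] by (intro mult_left_mono) auto
      then have "A * (u r - u' r) + c * (v r - v' r) \<le> D_half f (u r) * g (v r) - D_half f (u' r) * g (v' r)"
        unfolding Ap by (simp add: c_def algebra_simps)
      then have "l * (A * (u r - u' r) + c * (v r - v' r)) \<le> l * (D_half f (u r) * g (v r) - D_half f (u' r) * g (v' r))"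
        using lp by (intro mult_left_mono) auto
      ultimately show ?thesis by (simp add: h_def src_def algebra_simps)
    qed
    have 2: "m * (B * (v r - v' r) + c * (u r - u' r)) \<le> i r - src g f m' v' u' r"
    proof -
      have "m' * (D_half g (v' r) * f (u' r)) \<le> m * (D_half g (v' r) * f (u' r))"
        using m nonlin_deriv_pos[OF fg(2) nr(4)] nonlin_ge_1[OF fg(1) nr(3)] by (intro mult_right_mono) auto
      moreover have "D_half g (v' r) * (D_half f (u' r) * (u r - u' r)) \<le> D_half g (v' r) * (f (u r) - f (u' r))"
        using nonlin_above_tangent[OF fg(1) nr(3,1)] nonlin_deriv_pos[OF fg(2) nr(4)] by (intro mult_left_mono) auto
      then have "B * (v r - v' r) + c * (u r - u' r) \<le> D_half g (v r) * f (u r) - D_half g (v' r) * f (u' r)"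
        unfolding Bp by (simp add: c_def algebra_simps)
      then have "m * (B * (v r - v' r) + c * (u r - u' r)) \<le> m * (D_half g (v r) * f (u r) - D_half g (v' r) * f (u' r))"
        using lp by (intro mult_left_mono) auto
      ultimately show ?thesis by (simp add: i_def src_def algebra_simps)
    qed
    have e1: "D_half (D_half f) (u r) * g (v r) - A \<le> e" using err(1)[OF r] by (simp add: A_def left_diff_distrib)
    have e2: "D_half (D_half g) (v r) * f (u r) - B \<le> e" using err(2)[OF r] by (simp add: B_def left_diff_distrib)
    have e3: "D_half f (u r) * D_half g (v r) - c \<le> e" using err(3)[OF r] by (simp add: c_def)
    have "r ^ n * ((real n - s\<^sup>2 * r\<^sup>2) * ((k r)\<^sup>2 / l + (j r)\<^sup>2 / m)) - 4 * e * W\<^sup>2 \<le>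
      (r ^ n * ((X r)\<^sup>2 + real n * (k r)\<^sup>2 + r * k r * - (l * (D_half (D_half f) (u r) * g (v r) * (r * k r) + D_half f (u r) * D_half g (v r) * (r * j r)))
          + (h r - src f g l' u' v' r) * (r * k r)\<^sup>2 / (u r - u' r)) / l
       + r ^ n * ((Y r)\<^sup>2 + real n * (j r)\<^sup>2 + r * j r * - (m * (D_half (D_half g) (v r) * f (u r) * (r * j r) + D_half f (u r) * D_half g (v r) * (r * k r)))
          + (i r - src g f m' v' u' r) * (r * j r)\<^sup>2 / (v r - v' r)) / m)
      + 2 * s * (r ^ n * (r * k r * X r) / l + r ^ n * (r * j r * Y r) / m)"
      by (rule stability_pointwise[OF lp pr _ _ c0 e refl refl _ _ _ _ 1 2 e1 e2 e3])
         (use r nr W in auto)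
    then show "r ^ n * ((real n - s\<^sup>2 * r\<^sup>2) * ((k r)\<^sup>2 / l + (j r)\<^sup>2 / m)) - 4 * e * W\<^sup>2 \<le> D r + 2 * s * G r"
      by (simp only: D_def G_def dh_def di_def mult.commute[of "D_half g (v r)" "D_half f (u r)"])
  qed
qed

text \<open>The weights \<open>r\<^sup>2\<close>, \<open>r powr (-2s)\<close> and \<open>(3/4 - r)\<^sup>2\<close> are the squares of the pieces of the test function
  of Villegas: linear near the centre, then the solution \<open>r powr (-s)\<close> of \<open>\<eta>' \<^sup>2 = n \<eta>\<^sup>2 / r\<^sup>2\<close>, then cut off.\<close>

lemma riccati_decay:
  fixes n :: nat and G D E :: "real \<Rightarrow> real"
  assumes n: "2 \<le> n" and s: "0 \<le> s" "s\<^sup>2 = real n" and \<eta>: "0 \<le> \<eta>"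
    and c: "continuous_on {0..<1} G"
    and d: "\<And>r. 0 < r \<Longrightarrow> r < 1 \<Longrightarrow> (G has_real_derivative D r) (at r)"
    and ric: "\<And>r \<sigma>. 0 < r \<Longrightarrow> r < 1 \<Longrightarrow> r ^ n * ((real n - \<sigma>\<^sup>2 * r\<^sup>2) * E r) - \<eta> \<le> D r + 2 * \<sigma> * G r"
    and E: "\<And>r. 0 < r \<Longrightarrow> r < 1 \<Longrightarrow> 0 \<le> E r"
    and B: "\<And>r. 1/2 < r \<Longrightarrow> r < 3/4 \<Longrightarrow> r ^ (n + 2) * E r \<le> B"
    and \<rho>: "0 < \<rho>" "\<rho> \<le> 1/4" and e0: "\<And>r. \<rho> < r \<Longrightarrow> r < 2 * \<rho> \<Longrightarrow> e0 \<le> r ^ (n + 2) * E r"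
  shows "\<rho> * e0 \<le> (2 * \<rho>)\<^sup>2 * ((2 * \<rho>) powr (2 * s) * (2 powr (2 * s) * (4 * (B + \<eta>))) + \<eta>) + 2 * \<eta>"
proof -
  define x where "x = 2 * \<rho>"
  have x: "0 < x" "x \<le> 1/2" using \<rho> by (auto simp: x_def)
  have cG: "continuous_on {a..b} G" if "0 \<le> a" "b < 1" for a b
    using c by (rule continuous_on_subset) (use that in auto)
  \<comment> \<open>Here \<eta> = 3/4 - r. The weighted function vanishes at 3/4 and \<eta>'^2 = 1,
    so the loss per unit length is at most \<open>B + \<eta>\<close>; the interval has length 1/4
    and the weight at 1/2 is 1/16, whence the factor 4.\<close>
  have outer: "G (1/2) \<le> 4 * (B + \<eta>)"
  proof -
    have "- (B + \<eta>) * (3/4 - 1/2) \<le> (3/4 - 3/4)\<^sup>2 * G (3/4) - (3/4 - 1/2)\<^sup>2 * G (1/2)"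
    proof (rule increment_ge)
      show "continuous_on {1/2..3/4} (\<lambda>r. (3/4 - r)\<^sup>2 * G r)"
        by (intro continuous_intros cG) auto
      fix r :: real assume r: "1/2 < r" "r < 3/4"
      define \<sigma> where "\<sigma> = - 1 / (3/4 - r)"
      have \<sigma>: "(3/4 - r) * \<sigma> = - 1" using r by (simp add: \<sigma>_def)
      show "((\<lambda>r. (3/4 - r)\<^sup>2 * G r) has_real_derivative (3/4 - r)\<^sup>2 * D r - 2 * (3/4 - r) * G r) (at r)"
        using r by (auto intro!: derivative_eq_intros d simp: algebra_simps power2_eq_square)
      have "(3/4 - r)\<^sup>2 * (r ^ n * ((real n - \<sigma>\<^sup>2 * r\<^sup>2) * E r) - \<eta>) \<le> (3/4 - r)\<^sup>2 * (D r + 2 * \<sigma> * G r)"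
        using ric[of r \<sigma>] r by (intro mult_left_mono) auto
      also have "\<dots> = (3/4 - r)\<^sup>2 * D r + 2 * (3/4 - r) * ((3/4 - r) * \<sigma>) * G r"
        by (simp add: power2_eq_square algebra_simps)
      also have "\<dots> = (3/4 - r)\<^sup>2 * D r - 2 * (3/4 - r) * G r"
        unfolding \<sigma> by (simp add: algebra_simps)
      finally have 1: "(3/4 - r)\<^sup>2 * (r ^ n * ((real n - \<sigma>\<^sup>2 * r\<^sup>2) * E r) - \<eta>) \<le> (3/4 - r)\<^sup>2 * D r - 2 * (3/4 - r) * G r" .
      have "(3/4 - r)\<^sup>2 * (r ^ n * ((real n - \<sigma>\<^sup>2 * r\<^sup>2) * E r) - \<eta>)
         = (3/4 - r)\<^sup>2 * (r ^ n * (real n * E r)) - ((3/4 - r) * \<sigma>)\<^sup>2 * (r ^ (n + 2) * E r) - (3/4 - r)\<^sup>2 * \<eta>"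
        by (simp add: power_add power2_eq_square algebra_simps)
      moreover have "0 \<le> (3/4 - r)\<^sup>2 * (r ^ n * (real n * E r))" using E[of r] r by simp
      moreover have "(3/4 - r)\<^sup>2 * \<eta> \<le> 1 * \<eta>"
        using r \<eta> by (intro mult_right_mono power_le_one) auto
      ultimately have "- B - \<eta> \<le> (3/4 - r)\<^sup>2 * (r ^ n * ((real n - \<sigma>\<^sup>2 * r\<^sup>2) * E r) - \<eta>)"
        using B[OF r] by (simp add: \<sigma>)
      then show "- (B + \<eta>) \<le> (3/4 - r)\<^sup>2 * D r - 2 * (3/4 - r) * G r" using 1 by linarith
    qed simp
    then show ?thesis by (simp add: power2_eq_square)
  qed
  \<comment> \<open>With \<sigma> = -s/r the factor n - \<sigma>^2 r^2 vanishes, so nothing about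
    \<open>E\<close> is needed between \<open>x\<close> and 1/2: the weighted function can decrease
    only by the error. This transports the bound at 1/2 to \<open>x\<close> with the gain
    x^(2s).\<close>
  have middle: "x powr (- 2 * s) * G x \<le> (1/2) powr (- 2 * s) * G (1/2) + x powr (- 2 * s) * \<eta>"
  proof -
    have "- (x powr (- 2 * s) * \<eta>) * (1/2 - x) \<le> (1/2) powr (- 2 * s) * G (1/2) - x powr (- 2 * s) * G x"
    proof (rule increment_ge[OF x(2)])
      show "continuous_on {x..1/2} (\<lambda>r. r powr (- 2 * s) * G r)"
        by (intro continuous_intros cG) (use x in auto)
      fix r :: real assume r: "x < r" "r < 1/2"
      then have r0: "0 < r" using x by simp
      have "((\<lambda>r. r powr (- 2 * s)) has_real_derivative - 2 * s * r powr (- 2 * s - 1)) (at r)"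
        by (rule has_real_derivative_powr[OF r0])
      then show "((\<lambda>r. r powr (- 2 * s) * G r) has_real_derivative
          (- 2 * s * r powr (- 2 * s - 1)) * G r + D r * r powr (- 2 * s)) (at r)"
        by (rule DERIV_mult) (use d r r0 in auto)
      have "- (x powr (- 2 * s) * \<eta>) \<le> r powr (- 2 * s) * (- \<eta>)"
        using powr_mono2'[of "- 2 * s" x r] s x r \<eta> by (simp add: mult_right_mono)
      also have "\<dots> \<le> r powr (- 2 * s) * (D r + 2 * (- s / r) * G r)"
        using ric[of r "- s / r"] r r0 s by (intro mult_left_mono) (auto simp: power_divide)
      also have "\<dots> = (- 2 * s * r powr (- 2 * s - 1)) * G r + D r * r powr (- 2 * s)"
        using r0 by (simp add: powr_diff algebra_simps)
      finally show "- (x powr (- 2 * s) * \<eta>) \<le> (- 2 * s * r powr (- 2 * s - 1)) * G r + D r * r powr (- 2 * s)" .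
    qed
    moreover have "(x powr (- 2 * s) * \<eta>) * (1/2 - x) \<le> (x powr (- 2 * s) * \<eta>) * 1"
      using x \<eta> by (intro mult_left_mono) auto
    ultimately show ?thesis by simp
  qed
  have "G x \<le> x powr (2 * s) * (2 powr (2 * s) * (4 * (B + \<eta>))) + \<eta>"
  proof -
    have half: "(1/2) powr (- 2 * s) = 2 powr (2 * s)"
      by (simp add: powr_minus powr_divide)
    have "x powr (- 2 * s) * G x \<le> 2 powr (2 * s) * (4 * (B + \<eta>)) + x powr (- 2 * s) * \<eta>"
    proof -
      have "2 powr (2 * s) * G (1/2) \<le> 2 powr (2 * s) * (4 * (B + \<eta>))" by (intro mult_left_mono outer) simp
      then show ?thesis using middle unfolding half by linarith
    qed
    then have "x powr (2 * s) * (x powr (- 2 * s) * G x) \<le> x powr (2 * s) * (2 powr (2 * s) * (4 * (B + \<eta>)) + x powr (- 2 * s) * \<eta>)"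
      by (intro mult_left_mono) auto
    moreover have "x powr (2 * s) * (x powr (- 2 * s) * y) = y" for y
      using x by (simp add: powr_add[symmetric] mult.assoc[symmetric])
    ultimately show ?thesis by (simp only: distrib_left)
  qed
  then have Gx: "x\<^sup>2 * G x \<le> x\<^sup>2 * (x powr (2 * s) * (2 powr (2 * s) * (4 * (B + \<eta>))) + \<eta>)"
    by (intro mult_left_mono) auto
  \<comment> \<open>With \<sigma> = 1/r the factor is n - 1, at least 1 because
    \<open>2 \<le> n\<close>, so \<open>E\<close> is a gain. It is discarded on [0, \<rho>] and
    bounded below by \<open>e0\<close> on [\<rho>, 2 \<rho>].\<close>
  have inner: "r\<^sup>2 * D r + 2 * r * G r \<ge> r ^ (n + 2) * E r - \<eta>" if r: "0 < r" "r < 1" for r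
  proof -
    have "r\<^sup>2 * (r ^ n * ((real n - (1 / r)\<^sup>2 * r\<^sup>2) * E r) - \<eta>) \<le> r\<^sup>2 * (D r + 2 * (1 / r) * G r)"
      using ric[OF r, of "1 / r"] by (intro mult_left_mono) auto
    also have "\<dots> = r\<^sup>2 * D r + 2 * r * G r" using r by (simp add: power2_eq_square algebra_simps)
    also have "(1 / r)\<^sup>2 * r\<^sup>2 = 1" using r by (simp add: power_divide)
    finally have "r ^ (n + 2) * ((real n - 1) * E r) - r\<^sup>2 * \<eta> \<le> r\<^sup>2 * D r + 2 * r * G r"
      by (simp add: power_add power2_eq_square algebra_simps)
    moreover have "r ^ (n + 2) * (1 * E r) \<le> r ^ (n + 2) * ((real n - 1) * E r)"
      using n E[OF r] r by (intro mult_left_mono mult_right_mono) auto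
    moreover have "r\<^sup>2 * \<eta> \<le> 1 * \<eta>" using r \<eta> by (intro mult_right_mono power_le_one) auto
    ultimately show ?thesis by simp
  qed
  have dsq: "((\<lambda>r. r\<^sup>2 * G r) has_real_derivative r\<^sup>2 * D r + 2 * r * G r) (at r)" if "0 < r" "r < 1" for r
    using that by (auto intro!: derivative_eq_intros d simp: algebra_simps)
  have "- \<eta> * (\<rho> - 0) \<le> \<rho>\<^sup>2 * G \<rho> - 0\<^sup>2 * G 0"
  proof (rule increment_ge[OF _ _ dsq])
    show "continuous_on {0..\<rho>} (\<lambda>r. r\<^sup>2 * G r)" by (intro continuous_intros cG) (use \<rho> in auto)
    show "- \<eta> \<le> r\<^sup>2 * D r + 2 * r * G r" if "0 < r" "r < \<rho>" for r
    proof -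
      have "0 \<le> r ^ (n + 2) * E r" using E[of r] that \<rho> by simp
      then show ?thesis using inner[of r] that \<rho> by simp
    qed
  qed (use \<rho> in auto)
  moreover have "(e0 - \<eta>) * (x - \<rho>) \<le> x\<^sup>2 * G x - \<rho>\<^sup>2 * G \<rho>"
  proof (rule increment_ge[OF _ _ dsq])
    show "continuous_on {\<rho>..x} (\<lambda>r. r\<^sup>2 * G r)" by (intro continuous_intros cG) (use \<rho> x in auto)
    show "e0 - \<eta> \<le> r\<^sup>2 * D r + 2 * r * G r" if "\<rho> < r" "r < x" for r
      using inner[of r] e0[of r] that \<rho> x by (simp add: x_def)
  qed (use \<rho> x in \<open>auto simp: x_def\<close>)
  moreover have "2 * (\<rho> * \<eta>) \<le> 2 * (1 * \<eta>)" using \<rho> \<eta> by (intro mult_left_mono mult_right_mono) auto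
  ultimately have "\<rho> * e0 \<le> x\<^sup>2 * G x + 2 * \<eta>" by (simp add: x_def algebra_simps)
  then show ?thesis using Gx by (simp add: x_def)
qed

text \<open>\<open>approximable\<close> replaces semi-stability: strictly smaller parameters admit smaller solutions which
  are arbitrarily close at the centre.\<close>

definition approximable :: "nat \<Rightarrow> (real \<Rightarrow> real) \<Rightarrow> (real \<Rightarrow> real) \<Rightarrow> real \<Rightarrow> real \<Rightarrow> (real \<Rightarrow> real) \<Rightarrow> (real \<Rightarrow> real) \<Rightarrow> bool" where
  "approximable n f g l m u v \<longleftrightarrow> (\<forall>d>0. \<exists>l' m' u' v' k' j'. 0 < l' \<and> l' < l \<and> 0 < m' \<and> m' < m \<and>
     radial_ode n f g l' m' u' v' k' j' \<and> (\<forall>r\<in>{0..1}. u' r \<le> u r \<and> v' r \<le> v r) \<and>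
     u 0 - u' 0 \<le> d \<and> v 0 - v' 0 \<le> d)"

lemma approximableE:
  assumes "approximable n f g l m u v" "0 < d"
  obtains l' m' u' v' k' j' where "0 < l'" "l' < l" "0 < m'" "m' < m" "radial_ode n f g l' m' u' v' k' j'"
    "\<forall>r\<in>{0..1}. u' r \<le> u r \<and> v' r \<le> v r" "u 0 - u' 0 \<le> d" "v 0 - v' 0 \<le> d"
  using assms(1)[unfolded approximable_def, THEN spec, THEN mp, OF assms(2)]
  by (elim exE conjE) (rule that)

lemma approximable_swap:
  assumes "approximable n f g l m u v"
  shows "approximable n g f m l v u"
  unfolding approximable_def
proof (intro allI impI)
  fix d :: real assume "0 < d"
  show "\<exists>m' l' v' u' j' k'. 0 < m' \<and> m' < m \<and> 0 < l' \<and> l' < l \<and>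
     radial_ode n g f m' l' v' u' j' k' \<and> (\<forall>r\<in>{0..1}. v' r \<le> v r \<and> u' r \<le> u r) \<and>
     v 0 - v' 0 \<le> d \<and> u 0 - u' 0 \<le> d"
  proof (rule approximableE[OF assms \<open>0 < d\<close>])
    fix l' m' u' v' k' j'
    assume "0 < l'" "l' < l" "0 < m'" "m' < m" and o: "radial_ode n f g l' m' u' v' k' j'"
      and "\<forall>r\<in>{0..1}. u' r \<le> u r \<and> v' r \<le> v r" "u 0 - u' 0 \<le> d" "v 0 - v' 0 \<le> d"
    then show ?thesis using radial_ode_swap[OF o]
      by (intro exI[of _ m'] exI[of _ l'] exI[of _ v'] exI[of _ u'] exI[of _ j'] exI[of _ k']) simp
  qed
qed

text \<open>The error in the Riccati inequality involves the size of this particular solution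
  through \<open>W\<close> and \<open>M\<close>. As the solution is fixed, the smaller one can be
  chosen afterwards, arbitrarily close, so the error vanishes and the final bound is free of
  \<open>W\<close> and \<open>M\<close>.\<close>

lemma approximable_flux_decay:
  assumes fg: "nonlin f" "nonlin g" and lm: "0 < l" "0 < m" and n: "2 \<le> n"
    and s: "0 \<le> s" "s\<^sup>2 = real n"
    and o: "radial_ode n f g l m u v k j" and ap: "approximable n f g l m u v"
    and B: "\<And>r. 1/2 < r \<Longrightarrow> r < 3/4 \<Longrightarrow> r ^ (n + 2) * ((k r)\<^sup>2 / l + (j r)\<^sup>2 / m) \<le> B"
    and \<rho>: "0 < \<rho>" "\<rho> \<le> 1/4"
  shows "\<rho> * ((\<rho> ^ (n + 1) * k \<rho>)\<^sup>2 / (l * (2 * \<rho>) ^ n)) \<le> (2 * \<rho>)\<^sup>2 * ((2 * \<rho>) powr (2 * s) * (2 powr (2 * s) * (4 * B)))"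
proof (rule field_le_epsilon)
  fix \<epsilon> :: real assume \<epsilon>: "0 < \<epsilon>"
  note swap = radial_ode_swap[OF o]
  \<comment> \<open>The total coefficient of \<open>\<eta>\<close> in the conclusion of
    \<open>riccati_decay\<close>.\<close>
  define K where "K = (2 * \<rho>)\<^sup>2 * ((2 * \<rho>) powr (2 * s) * (2 powr (2 * s) * 4) + 1) + 2"
  have K: "0 < K" using \<rho> by (simp add: K_def add_nonneg_pos)
  define \<eta> where "\<eta> = \<epsilon> / K"
  have \<eta>: "0 < \<eta>" using \<epsilon> K by (simp add: \<eta>_def)
  obtain Wu where Wu: "\<And>r. 0 \<le> r \<Longrightarrow> r \<le> 1 \<Longrightarrow> r * k r \<le> Wu"
  proof -
    have "continuous_on {0..1} (\<lambda>r. r * k r)" by (intro continuous_intros radial_odeD(2)[OF o])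
    then show thesis using continuous_attains_sup[of "{0..1}" "\<lambda>r. r * k r"] that by fastforce
  qed
  obtain Wv where Wv: "\<And>r. 0 \<le> r \<Longrightarrow> r \<le> 1 \<Longrightarrow> r * j r \<le> Wv"
  proof -
    have "continuous_on {0..1} (\<lambda>r. r * j r)" by (intro continuous_intros radial_odeD(2)[OF swap])
    then show thesis using continuous_attains_sup[of "{0..1}" "\<lambda>r. r * j r"] that by fastforce
  qed
  define W where "W = max Wu Wv"
  define e where "e = \<eta> / (4 * W\<^sup>2 + 1)"
  have W1: "0 < 4 * W\<^sup>2 + 1" by (simp add: add_nonneg_pos)
  have e: "0 < e" using \<eta> W1 by (simp add: e_def)
  have "e * (4 * W\<^sup>2 + 1) = \<eta>" using W1 unfolding e_def by simp
  then have eW: "4 * e * W\<^sup>2 \<le> \<eta>" using e by (simp add: algebra_simps)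
  define M where "M = max (u 0) (v 0)"
  have M0: "0 \<le> M" using radial_odeD(3)[OF o, of 0] by (simp add: M_def)
  have nn: "0 \<le> u r" "u r \<le> M" "0 \<le> v r" "v r \<le> M" if "0 \<le> r" "r \<le> 1" for r
    using radial_odeD(3)[OF o that] radial_odeD(3)[OF swap that] radial_ode_antimono[OF o, of 0 r]
      radial_ode_antimono[OF swap, of 0 r] that by (auto simp: M_def)
  \<comment> \<open>One modulus \<open>w\<close> serves all three errors: each is at most
    \<open>w\<close> times a partial sum of \<open>Z\<close>, hence at most
    \<open>w * Z = e\<close>.\<close>
  define Z where "Z = f M + g M + D_half f M + D_half g M"
  have Zs: "0 < f M" "0 < g M" "0 < D_half f M" "0 < D_half g M"
    using nonlin_ge_1[OF fg(1) M0] nonlin_ge_1[OF fg(2) M0] nonlin_deriv_pos[OF fg(1) M0] nonlin_deriv_pos[OF fg(2) M0]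
    by auto
  then have Z: "0 < Z" by (simp add: Z_def)
  define w where "w = e / Z"
  have w: "0 < w" "w * Z = e" using e Z by (simp_all add: w_def)
  have "w * f M + w * g M + w * D_half f M + w * D_half g M = e" using w(2) by (simp add: Z_def distrib_left)
  moreover have "0 < w * f M" "0 < w * g M" "0 < w * D_half f M" "0 < w * D_half g M" using w Zs by simp_all
  ultimately have wz: "w * f M \<le> e" "w * g M \<le> e" "w * D_half g M + D_half f M * w \<le> e"
    by (simp_all add: mult.commute)
  obtain d1 where d1: "0 < d1" "\<And>x y. 0 \<le> y \<Longrightarrow> y < x \<Longrightarrow> x \<le> M \<Longrightarrow> x - y \<le> d1 \<Longrightarrow>
      D_half f x - D_half f y \<le> w \<and> D_half (D_half f) x - (D_half f x - D_half f y) / (x - y) \<le> w"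
    using nonlin_modulus[OF fg(1) w(1)] by blast
  obtain d2 where d2: "0 < d2" "\<And>x y. 0 \<le> y \<Longrightarrow> y < x \<Longrightarrow> x \<le> M \<Longrightarrow> x - y \<le> d2 \<Longrightarrow>
      D_half g x - D_half g y \<le> w \<and> D_half (D_half g) x - (D_half g x - D_half g y) / (x - y) \<le> w"
    using nonlin_modulus[OF fg(2) w(1)] by blast
  have d12: "0 < min d1 d2" using d1 d2 by simp
  obtain l' m' u' v' k' j' where a: "0 < l'" "l' < l" "0 < m'" "m' < m" "radial_ode n f g l' m' u' v' k' j'"
    and le': "\<forall>r\<in>{0..1}. u' r \<le> u r \<and> v' r \<le> v r"
    and close: "u 0 - u' 0 \<le> min d1 d2" "v 0 - v' 0 \<le> min d1 d2"
    using approximableE[OF ap d12] .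
  have le: "u' r \<le> u r" "v' r \<le> v r" if "0 \<le> r" "r \<le> 1" for r using le' that by auto
  note swap' = radial_ode_swap[OF a(5)]
  have mod: "D_half f (u r) - D_half f (u' r) \<le> w" "D_half g (v r) - D_half g (v' r) \<le> w"
      "D_half (D_half f) (u r) - (D_half f (u r) - D_half f (u' r)) / (u r - u' r) \<le> w"
      "D_half (D_half g) (v r) - (D_half g (v r) - D_half g (v' r)) / (v r - v' r) \<le> w"
      "0 \<le> u' r" "0 \<le> v' r" if r: "0 < r" "r < 1" for r
  proof -
    have su: "u' r < u r" "u r - u' r \<le> u 0 - u' 0"
      using radial_ode_strict(2,3)[OF fg _ a(2) o a(5) le, of r] a(1) r by auto
    have sv: "v' r < v r" "v r - v' r \<le> v 0 - v' 0"
      using radial_ode_strict(2,3)[OF fg(2,1) _ a(4) swap swap' le(2,1), of r] a(3) r by auto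
    have nn': "0 \<le> u' r" "0 \<le> v' r" using radial_odeD(3)[OF a(5), of r] radial_odeD(3)[OF swap', of r] r by auto
    then show "0 \<le> u' r" "0 \<le> v' r" .
    show "D_half f (u r) - D_half f (u' r) \<le> w" "D_half g (v r) - D_half g (v' r) \<le> w"
      "D_half (D_half f) (u r) - (D_half f (u r) - D_half f (u' r)) / (u r - u' r) \<le> w"
      "D_half (D_half g) (v r) - (D_half g (v r) - D_half g (v' r)) / (v r - v' r) \<le> w"
      using d1(2)[OF nn'(1) su(1)] d2(2)[OF nn'(2) sv(1)] nn[of r] su sv close r by auto
  qed
  have W': "r * k r \<le> W" "r * j r \<le> W" if "0 \<le> r" "r \<le> 1" for r
    using Wu[OF that] Wv[OF that] by (auto simp: W_def)
  have err1: "(D_half (D_half f) (u r) - (D_half f (u r) - D_half f (u' r)) / (u r - u' r)) * g (v r) \<le> e"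
    if r: "0 < r" "r < 1" for r
  proof -
    have "1 \<le> g (v r)" "g (v r) \<le> g M" using nonlin_ge_1[OF fg(2)] nonlin_mono[OF fg(2)] nn[of r] r by auto
    then have "(D_half (D_half f) (u r) - (D_half f (u r) - D_half f (u' r)) / (u r - u' r)) * g (v r) \<le> w * g (v r)"
      "w * g (v r) \<le> w * g M"
      using mod(3)[OF r] w by (auto intro!: mult_right_mono mult_left_mono)
    then show ?thesis using wz(2) by linarith
  qed
  have err2: "(D_half (D_half g) (v r) - (D_half g (v r) - D_half g (v' r)) / (v r - v' r)) * f (u r) \<le> e"
    if r: "0 < r" "r < 1" for r
  proof -
    have "1 \<le> f (u r)" "f (u r) \<le> f M" using nonlin_ge_1[OF fg(1)] nonlin_mono[OF fg(1)] nn[of r] r by auto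
    then have "(D_half (D_half g) (v r) - (D_half g (v r) - D_half g (v' r)) / (v r - v' r)) * f (u r) \<le> w * f (u r)"
      "w * f (u r) \<le> w * f M"
      using mod(4)[OF r] w by (auto intro!: mult_right_mono mult_left_mono)
    then show ?thesis using wz(1) by linarith
  qed
  have err3: "D_half f (u r) * D_half g (v r) - D_half f (u' r) * D_half g (v' r) \<le> e" if r: "0 < r" "r < 1" for r
  proof -
    have b: "0 < D_half g (v r)" "D_half g (v r) \<le> D_half g M" "0 < D_half f (u' r)" "D_half f (u' r) \<le> D_half f M"
      using nonlin_deriv_pos[OF fg(2)] nonlin_deriv_mono[OF fg(2)] nonlin_deriv_pos[OF fg(1)] nonlin_deriv_mono[OF fg(1), of "u' r" M]
        nn[of r] mod(5)[OF r] le[of r] r by auto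
    have "D_half f (u r) * D_half g (v r) - D_half f (u' r) * D_half g (v' r) =
       (D_half f (u r) - D_half f (u' r)) * D_half g (v r) + D_half f (u' r) * (D_half g (v r) - D_half g (v' r))"
      by (simp add: algebra_simps)
    also have "\<dots> \<le> w * D_half g (v r) + D_half f (u' r) * w"
      using b mod(1,2)[OF r] by (intro add_mono mult_right_mono mult_left_mono) auto
    also have "\<dots> \<le> w * D_half g M + D_half f M * w"
      using b w by (intro add_mono mult_right_mono mult_left_mono) auto
    finally show ?thesis using wz(3) by linarith
  qed
  obtain G D where GD: "continuous_on {0..<1} G"
    "\<And>r. 0 < r \<Longrightarrow> r < 1 \<Longrightarrow> (G has_real_derivative D r) (at r)"
    "\<And>r s. 0 < r \<Longrightarrow> r < 1 \<Longrightarrow>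
       r ^ n * ((real n - s\<^sup>2 * r\<^sup>2) * ((k r)\<^sup>2 / l + (j r)\<^sup>2 / m)) - 4 * e * W\<^sup>2 \<le> D r + 2 * s * G r"
    using stability_riccati[OF fg a(1-4) o a(5) le W' less_imp_le[OF e] err1 err2 err3] by blast
  have ric: "r ^ n * ((real n - \<sigma>\<^sup>2 * r\<^sup>2) * ((k r)\<^sup>2 / l + (j r)\<^sup>2 / m)) - \<eta> \<le> D r + 2 * \<sigma> * G r"
    if r: "0 < r" "r < 1" for r \<sigma>
    using GD(3)[OF r, of \<sigma>] eW by linarith
  \<comment> \<open>r^(n+2) k^2 / l is the squared flux divided by l r^n; on this interval the flux
    is smallest at \<rho> and r^n largest at 2 \<rho>. The term with \<open>j\<close> is dropped,
    since the other component follows by exchanging f and g.\<close>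
  have e0: "(\<rho> ^ (n + 1) * k \<rho>)\<^sup>2 / (l * (2 * \<rho>) ^ n) \<le> r ^ (n + 2) * ((k r)\<^sup>2 / l + (j r)\<^sup>2 / m)"
    if r: "\<rho> < r" "r < 2 * \<rho>" for r
  proof -
    have r01: "0 < r" "r < 1" using r \<rho> by auto
    have "\<rho> ^ (n + 1) * k \<rho> \<le> r ^ (n + 1) * k r"
      by (rule flux_mono[OF fg _ o]) (use lm r \<rho> in auto)
    moreover have "0 \<le> \<rho> ^ (n + 1) * k \<rho>" using radial_odeD(4)[OF o, of \<rho>] \<rho> by simp
    ultimately have "(\<rho> ^ (n + 1) * k \<rho>)\<^sup>2 \<le> (r ^ (n + 1) * k r)\<^sup>2" by (rule power_mono)
    moreover have "l * r ^ n \<le> l * (2 * \<rho>) ^ n" using r r01 lm by (intro mult_left_mono power_mono) auto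
    ultimately have "(\<rho> ^ (n + 1) * k \<rho>)\<^sup>2 / (l * (2 * \<rho>) ^ n) \<le> (r ^ (n + 1) * k r)\<^sup>2 / (l * r ^ n)"
      using lm r01 by (intro frac_le) auto
    also have "\<dots> = r ^ (n + 2) * ((k r)\<^sup>2 / l)"
      using r01 lm by (simp add: power_mult_distrib power2_eq_square power_add field_simps)
    also have "\<dots> \<le> r ^ (n + 2) * ((k r)\<^sup>2 / l + (j r)\<^sup>2 / m)"
      using r01 lm by (intro mult_left_mono) auto
    finally show ?thesis .
  qed
  have "\<rho> * ((\<rho> ^ (n + 1) * k \<rho>)\<^sup>2 / (l * (2 * \<rho>) ^ n)) \<le>
      (2 * \<rho>)\<^sup>2 * ((2 * \<rho>) powr (2 * s) * (2 powr (2 * s) * (4 * (B + \<eta>))) + \<eta>) + 2 * \<eta>"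
    by (rule riccati_decay[OF n s less_imp_le[OF \<eta>] GD(1,2) ric _ B \<rho> e0]) (use lm in auto)
  also have "\<dots> = (2 * \<rho>)\<^sup>2 * ((2 * \<rho>) powr (2 * s) * (2 powr (2 * s) * (4 * B))) + K * \<eta>"
    by (simp add: K_def algebra_simps)
  also have "K * \<eta> = \<epsilon>" using K by (simp add: \<eta>_def)
  finally show "\<rho> * ((\<rho> ^ (n + 1) * k \<rho>)\<^sup>2 / (l * (2 * \<rho>) ^ n)) \<le>
      (2 * \<rho>)\<^sup>2 * ((2 * \<rho>) powr (2 * s) * (2 powr (2 * s) * (4 * B))) + \<epsilon>" .
qed

section \<open>Regularity of the extremal solution\<close>

text \<open>Division of \<open>approximable_flux_decay\<close> by r^(n+1) leaves (r k)^2 <= const *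
  r^(1-n+2s). The constants depend on the parameters only through \<open>l0\<close> and
  \<open>L\<close>, so they survive the limit along the branch.\<close>

lemma approximable_derivative_bound:
  assumes fg: "nonlin f" "nonlin g" and n: "2 \<le> n" and l0: "0 < l0"
  obtains C M where "0 \<le> C" "0 \<le> M"
    "\<And>l m u v k j. l0 \<le> l \<Longrightarrow> l0 \<le> m \<Longrightarrow> l \<le> L \<Longrightarrow> m \<le> L \<Longrightarrow> radial_ode n f g l m u v k j \<Longrightarrow> approximable n f g l m u v \<Longrightarrow>
       u (1/4) \<le> M \<and> (\<forall>r. 0 < r \<longrightarrow> r \<le> 1/4 \<longrightarrow> r * k r \<le> C * r powr ((1 - real n) / 2 + sqrt (real n)))"
proof -
  define s where "s = sqrt (real n)"
  have s: "0 \<le> s" "s\<^sup>2 = real n" by (simp_all add: s_def)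
  obtain M where M: "0 \<le> M" "\<And>l m u v k j. l0 \<le> l \<Longrightarrow> l0 \<le> m \<Longrightarrow> radial_ode n f g l m u v k j \<Longrightarrow>
     u (1/4) \<le> M \<and> v (1/4) \<le> M" using radial_ode_uniform_bound[OF fg l0] by blast
  \<comment> \<open>On (1/2, 3/4) the flux is at most its value at 3/4, hence at most 4 u(3/4) <= 4
    M by \<open>flux_le\<close>. Dividing its square by l r^n with r > 1/2 gives the bracket; the
    factor 2 counts both components.\<close>
  define B where "B = 2 * ((4 * M)\<^sup>2 * 2 ^ n / l0)"
  define C where "C = sqrt (\<bar>L\<bar> * (2 ^ n * 4 * 2 powr (2 * s) * (2 powr (2 * s) * (4 * B))))"
  have B0: "0 \<le> B" using l0 by (simp add: B_def)
  have half: "r ^ (n + 2) * ((k r)\<^sup>2 / l) \<le> (4 * M)\<^sup>2 * 2 ^ n / l0"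
    if fg: "nonlin f" "nonlin g" and l: "l0 \<le> l" and o: "radial_ode n f g l m u v k j" and u: "u (1/4) \<le> M"
      and r: "1/2 < r" "r < 3/4" for f g l m u v k j r
  proof -
    have lp: "0 < l" using l l0 by simp
    have "r ^ (n + 1) * k r \<le> (3/4) ^ (n + 1) * k (3/4)"
      by (rule flux_mono[OF fg _ o]) (use lp r in auto)
    also have "\<dots> \<le> 4 * u (3/4)" using flux_le[OF fg _ o, of "3/4"] lp by simp
    also have "\<dots> \<le> 4 * M" using radial_ode_antimono[OF o, of "1/4" "3/4"] u by simp
    finally have "(r ^ (n + 1) * k r)\<^sup>2 \<le> (4 * M)\<^sup>2"
      using radial_odeD(4)[OF o, of r] r by (intro power_mono) auto
    moreover have "(1/2) ^ n \<le> r ^ n" using r by (intro power_mono) auto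
    ultimately have "(r ^ (n + 1) * k r)\<^sup>2 / (l * r ^ n) \<le> (4 * M)\<^sup>2 / (l0 * (1/2) ^ n)"
      using l l0 r by (intro frac_le mult_mono) auto
    also have "\<dots> = (4 * M)\<^sup>2 * 2 ^ n / l0" by (simp add: power_one_over divide_simps)
    also have "(r ^ (n + 1) * k r)\<^sup>2 / (l * r ^ n) = r ^ (n + 2) * ((k r)\<^sup>2 / l)"
      using r lp by (simp add: power_mult_distrib power2_eq_square power_add field_simps)
    finally show ?thesis .
  qed
  show thesis
  proof (rule that[OF _ M(1)])
    show "0 \<le> C" using B0 by (simp add: C_def)
    fix l m u v k j
    assume l: "l0 \<le> l" and m: "l0 \<le> m" and L: "l \<le> L" "m \<le> L"
      and o: "radial_ode n f g l m u v k j" and ap: "approximable n f g l m u v"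
    note swap = radial_ode_swap[OF o]
    have lm: "0 < l" "0 < m" using l m l0 by auto
    have uv: "u (1/4) \<le> M" "v (1/4) \<le> M" using M(2)[OF l m o] by auto
    have "r * k r \<le> C * r powr ((1 - real n) / 2 + s)" if r: "0 < r" "r \<le> 1/4" for r
    proof -
      have Bd: "x ^ (n + 2) * ((k x)\<^sup>2 / l + (j x)\<^sup>2 / m) \<le> B" if "1/2 < x" "x < 3/4" for x
        using half[OF fg l o uv(1) that] half[OF fg(2,1) m swap uv(2) that]
        by (simp add: B_def distrib_left)
      have "r * ((r ^ (n + 1) * k r)\<^sup>2 / (l * (2 * r) ^ n)) \<le> (2 * r)\<^sup>2 * ((2 * r) powr (2 * s) * (2 powr (2 * s) * (4 * B)))"
        by (rule approximable_flux_decay[OF fg lm n s o ap Bd r])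
      then have "(l * (2 * r) ^ n / r ^ (n + n + 1)) * (r * ((r ^ (n + 1) * k r)\<^sup>2 / (l * (2 * r) ^ n)))
          \<le> (l * (2 * r) ^ n / r ^ (n + n + 1)) * ((2 * r)\<^sup>2 * ((2 * r) powr (2 * s) * (2 powr (2 * s) * (4 * B))))"
        using r lm by (intro mult_left_mono) auto
      also have "(l * (2 * r) ^ n / r ^ (n + n + 1)) * (r * ((r ^ (n + 1) * k r)\<^sup>2 / (l * (2 * r) ^ n))) = (r * k r)\<^sup>2"
        using r lm by (simp add: power_mult_distrib power2_eq_square power_add field_simps)
      also have "(l * (2 * r) ^ n / r ^ (n + n + 1)) * ((2 * r)\<^sup>2 * ((2 * r) powr (2 * s) * (2 powr (2 * s) * (4 * B))))
         = (l * (2 ^ n * 4 * 2 powr (2 * s) * (2 powr (2 * s) * (4 * B)))) * (r ^ n * r\<^sup>2 * r powr (2 * s) / r ^ (n + n + 1))"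
        using r by (simp add: power_mult_distrib powr_mult field_simps)
      also have "r ^ n * r\<^sup>2 * r powr (2 * s) / r ^ (n + n + 1)
          = r powr real n * r powr real 2 * r powr (2 * s) / r powr real (n + n + 1)"
        using r(1) by (simp only: powr_realpow)
      also have "\<dots> = r powr (((1 - real n) / 2 + s) + ((1 - real n) / 2 + s))"
        by (simp only: powr_add[symmetric] powr_diff[symmetric]) (rule arg_cong2[of _ _ _ _ "(powr)"], simp_all add: field_simps)
      also have "\<dots> = (r powr ((1 - real n) / 2 + s))\<^sup>2"
        by (simp only: power2_eq_square powr_add)
      also have "(l * (2 ^ n * 4 * 2 powr (2 * s) * (2 powr (2 * s) * (4 * B)))) * (r powr ((1 - real n) / 2 + s))\<^sup>2
          \<le> (\<bar>L\<bar> * (2 ^ n * 4 * 2 powr (2 * s) * (2 powr (2 * s) * (4 * B)))) * (r powr ((1 - real n) / 2 + s))\<^sup>2"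
        using L(1) B0 by (intro mult_right_mono) auto
      also have "\<dots> = (C * r powr ((1 - real n) / 2 + s))\<^sup>2"
        using B0 by (simp add: C_def power_mult_distrib)
      finally show ?thesis
        by (rule power2_le_imp_le) (use B0 in \<open>simp add: C_def\<close>)
    qed
    then show "u (1/4) \<le> M \<and> (\<forall>r. 0 < r \<longrightarrow> r \<le> 1/4 \<longrightarrow> r * k r \<le> C * r powr ((1 - real n) / 2 + sqrt (real n)))"
      using uv by (simp add: s_def)
  qed
qed

text \<open>The bound -u_r <= C r^(\<beta>-1) makes u + (C/\<beta>) r^\<beta>, or u + C ln r if
  \<beta> = 0, increasing on (0, 1/4]; further out \<open>M\<close> bounds u, which
  decreases.\<close>

lemma profile_growth:
  assumes o: "radial_ode n f g l m u v k j" and M: "0 \<le> M" "u (1/4) \<le> M" and C: "0 \<le> C"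
    and d: "\<And>r. 0 < r \<Longrightarrow> r \<le> 1/4 \<Longrightarrow> r * k r \<le> C * r powr (\<beta> - 1)"
  shows "0 < \<beta> \<Longrightarrow> 0 \<le> r \<Longrightarrow> r \<le> 1 \<Longrightarrow> u r \<le> M + C / \<beta>"
    and "\<beta> = 0 \<Longrightarrow> 0 < r \<Longrightarrow> r \<le> 1 \<Longrightarrow> u r \<le> (M + C) * (1 + \<bar>ln r\<bar>)"
    and "\<beta> < 0 \<Longrightarrow> 0 < r \<Longrightarrow> r \<le> 1 \<Longrightarrow> u r \<le> (M + C / - \<beta>) * r powr \<beta>"
proof -
  have outer: "u r \<le> M" if "1/4 \<le> r" "r \<le> 1"
    using radial_ode_antimono[OF o, of "1/4" r] that M by simp
  \<comment> \<open>For positive \<open>\<beta>\<close> the function r^\<beta> is continuous at 0,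
    so the centre itself is covered; otherwise r must be positive.\<close>
  have power: "u r \<le> M + (C / \<beta>) * ((1/4) powr \<beta> - r powr \<beta>)" if r: "r \<le> 1/4" and b: "0 < \<beta> \<and> 0 \<le> r \<or> \<beta> \<noteq> 0 \<and> 0 < r"
  proof -
    have "0 * (1/4 - r) \<le> (u (1/4) + (C / \<beta>) * (1/4) powr \<beta>) - (u r + (C / \<beta>) * r powr \<beta>)"
    proof (rule increment_ge[OF r])
      show "continuous_on {r..1/4} (\<lambda>x. u x + (C / \<beta>) * x powr \<beta>)"
        by (intro continuous_intros continuous_on_powr' continuous_on_subset[OF radial_odeD(1)[OF o]]) (use b in auto)
      fix x assume x: "r < x" "x < 1/4"
      then have x0: "0 < x" using b by auto
      show "((\<lambda>x. u x + (C / \<beta>) * x powr \<beta>) has_real_derivative - (x * k x) + (C / \<beta>) * (\<beta> * x powr (\<beta> - 1))) (at x)"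
        by (intro DERIV_add radial_odeD(6)[OF o] DERIV_cmult has_real_derivative_powr) (use x x0 in auto)
      show "0 \<le> - (x * k x) + (C / \<beta>) * (\<beta> * x powr (\<beta> - 1))"
        using d[of x] x x0 b by auto
    qed
    then show ?thesis using M by (simp add: right_diff_distrib)
  qed
  show "u r \<le> M + C / \<beta>" if b: "0 < \<beta>" and r: "0 \<le> r" "r \<le> 1"
  proof (cases "r \<le> 1/4")
    case True
    have "(1/4) powr \<beta> \<le> (1::real)" using powr_mono2[of \<beta> "1/4" "1::real"] b by simp
    then have "(1/4) powr \<beta> - r powr \<beta> \<le> 1" using powr_ge_zero[of r \<beta>] by linarith
    then have "(C / \<beta>) * ((1/4) powr \<beta> - r powr \<beta>) \<le> (C / \<beta>) * 1"
      using C b by (intro mult_left_mono) auto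
    then show ?thesis using power[OF True] b r by auto
  next
    case False
    then show ?thesis using outer r C b by (simp add: add_increasing2)
  qed
  show "u r \<le> (M + C / - \<beta>) * r powr \<beta>" if b: "\<beta> < 0" and r: "0 < r" "r \<le> 1"
  proof -
    have r1: "1 \<le> r powr \<beta>" using powr_mono2'[of \<beta> r 1] b r by simp
    define K where "K = C / - \<beta>"
    have K: "0 \<le> K" "C / \<beta> = - K" using C b by (simp_all add: K_def divide_nonneg_neg)
    have "u r \<le> M + K * r powr \<beta>"
    proof (cases "r \<le> 1/4")
      case True
      have "0 \<le> K * (1/4) powr \<beta>" using K(1) by simp
      moreover have "u r \<le> M + - K * ((1/4) powr \<beta> - r powr \<beta>)" using power[OF True] b r unfolding K(2) by simp
      ultimately show ?thesis by (simp add: right_diff_distrib)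
    next
      case False
      then show ?thesis using outer r K by (simp add: add_increasing2)
    qed
    also have "\<dots> \<le> M * r powr \<beta> + K * r powr \<beta>"
      using mult_left_mono[OF r1 M(1)] by simp
    finally show ?thesis unfolding K_def[symmetric] by (simp only: distrib_right)
  qed
  show "u r \<le> (M + C) * (1 + \<bar>ln r\<bar>)" if b: "\<beta> = 0" and r: "0 < r" "r \<le> 1"
  proof -
    have "u r \<le> M + C * \<bar>ln r\<bar>"
    proof (cases "r \<le> 1/4")
      case True
      have "0 * (1/4 - r) \<le> (u (1/4) + C * ln (1/4)) - (u r + C * ln r)"
      proof (rule increment_ge[OF True])
        show "continuous_on {r..1/4} (\<lambda>x. u x + C * ln x)"
          by (intro continuous_intros continuous_on_subset[OF radial_odeD(1)[OF o]]) (use r in auto)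
        fix x assume x: "r < x" "x < 1/4"
        then have x0: "0 < x" using r by auto
        show "((\<lambda>x. u x + C * ln x) has_real_derivative - (x * k x) + C * (1 / x)) (at x)"
          by (intro DERIV_add radial_odeD(6)[OF o] DERIV_cmult DERIV_ln_divide) (use x x0 in auto)
        have "x powr (\<beta> - 1) = 1 / x" using b x0 by (simp add: powr_minus_divide)
        then show "0 \<le> - (x * k x) + C * (1 / x)"
          using d[OF x0] x by simp
      qed
      moreover have "C * ln (1/4) \<le> 0" using C by (simp add: mult_nonneg_nonpos)
      moreover have "C * \<bar>ln r\<bar> = - (C * ln r)" using r by simp
      ultimately show ?thesis using M by linarith
    next
      case False
      moreover have "0 \<le> C * \<bar>ln r\<bar>" using C by simp
      ultimately show ?thesis using outer r by linarith
    qed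
    also have "\<dots> \<le> (M + C) * (1 + \<bar>ln r\<bar>)" using M C by (simp add: algebra_simps)
    finally show ?thesis .
  qed
qed

text \<open>Left continuity of the branch: solutions at parameters increasing to \<open>l\<close>
  converge to a solution at \<open>l\<close>, and leastness of \<open>P l\<close>,
  \<open>Q l\<close> puts these below the limit. Convergence at the centre is all that is
  extracted.\<close>

lemma minimal_family_approximable:
  fixes P Q :: "real \<Rightarrow> real \<Rightarrow> real"
  assumes fg: "nonlin f" "nonlin g" and pos: "0 \<le> a" "0 < c"
    and sol: "\<And>l. a < l \<Longrightarrow> l < b \<Longrightarrow> radial_solution (Suc n) f g l (c * l) (P l) (Q l)"
    and least: "\<And>l l' W Z t. a < l \<Longrightarrow> l \<le> l' \<Longrightarrow> l' < b \<Longrightarrow> radial_solution (Suc n) f g l' (c * l') W Z \<Longrightarrow> t \<in> {0..1} \<Longrightarrow>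
        P l t \<le> W t \<and> Q l t \<le> Z t"
    and l: "a < l" "l < b"
  shows "approximable n f g l (c * l) (\<lambda>r. P l (r\<^sup>2)) (\<lambda>r. Q l (r\<^sup>2))"
  unfolding approximable_def
proof (intro allI impI)
  fix d :: real assume d: "0 < d"
  \<comment> \<open>The offset 2 makes the sequence start at the midpoint of \<open>a\<close> and
    \<open>l\<close>; with offset 1 it would start at \<open>a\<close>, which is excluded.\<close>
  define x where "x k = l - (l - a) / (real k + 2)" for k :: nat
  have x: "a < x k" "x k < l" "x k < b" for k
  proof -
    have "(l - a) / (real k + 2) < (l - a) / 1" by (rule divide_strict_left_mono) (use l in auto)
    then show "a < x k" by (simp add: x_def)
    show "x k < l" using l by (simp add: x_def)
    then show "x k < b" using l by simp
  qed
  have xinc: "x k \<le> x (Suc k)" for k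
    unfolding x_def by (intro diff_left_mono divide_left_mono) (use l in auto)
  have xlim: "x \<longlonglongrightarrow> l" unfolding x_def by real_asymp
  have smx: "continuous_on {0..1} (P (x k))" "continuous_on {0..1} (Q (x k))" for k
    using smooth_on_imp_continuous_on radial_solutionD(1,2)[OF sol[OF x(1,3)]] by blast+
  have nn: "0 \<le> P (x k) t" "0 \<le> Q (x k) t" if "t \<in> {0..1}" for k t
    using radial_solutionD(3,4)[OF sol[OF x(1,3)] that] by auto
  have inc: "P (x k) t \<le> P (x (Suc k)) t" "Q (x k) t \<le> Q (x (Suc k)) t" if "t \<in> {0..1}" for k t
    using least[OF x(1) xinc x(3) sol[OF x(1,3)] that] by auto
  have below: "P (x k) t \<le> P l t" "Q (x k) t \<le> Q l t" if "t \<in> {0..1}" for k t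
    using least[OF x(1) less_imp_le[OF x(2)] l(2) sol[OF l] that] by auto
  obtain Mp where Mp: "\<And>t. t \<in> {0..1} \<Longrightarrow> P l t \<le> Mp"
    using continuous_attains_sup[of "{0..1}" "P l"] smooth_on_imp_continuous_on[OF radial_solutionD(1)[OF sol[OF l]]]
    by fastforce
  obtain Mq where Mq: "\<And>t. t \<in> {0..1} \<Longrightarrow> Q l t \<le> Mq"
    using continuous_attains_sup[of "{0..1}" "Q l"] smooth_on_imp_continuous_on[OF radial_solutionD(2)[OF sol[OF l]]]
    by fastforce
  define M where "M = max Mp Mq"
  have bd: "P (x k) t \<le> M" "Q (x k) t \<le> M" if "t \<in> {0..1}" for k t
    using below[OF that, of k] Mp[OF that] Mq[OF that] unfolding M_def by linarith+
  define P' where "P' t = lim (\<lambda>k. P (x k) t)" for t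
  define Q' where "Q' t = lim (\<lambda>k. Q (x k) t)" for t
  have limP: "(\<lambda>k. P (x k) t) \<longlonglongrightarrow> P' t" if t: "t \<in> {0..1}" for t
    unfolding P'_def by (rule LIMSEQ_lim_mono) (use inc bd t in blast)+
  have limQ: "(\<lambda>k. Q (x k) t) \<longlonglongrightarrow> Q' t" if t: "t \<in> {0..1}" for t
    unfolding Q'_def by (rule LIMSEQ_lim_mono) (use inc bd t in blast)+
  have rs: "radial_solution (Suc n) f g l (c * l) P' Q'"
  proof (rule radial_solution_limit[OF fg xlim tendsto_mult_left[OF xlim] smx nn bd limP limQ])
    show "(\<lambda>k. radial_solve (Suc n) (src f g (x k) (P (x k)) (Q (x k))) t) \<longlonglongrightarrow> P' t" if "t \<in> {0..1}" for t
      using limP[OF that] radial_solutionD(5)[OF sol[OF x(1,3)] that] by simp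
    show "(\<lambda>k. radial_solve (Suc n) (src g f (c * x k) (Q (x k)) (P (x k))) t) \<longlonglongrightarrow> Q' t" if "t \<in> {0..1}" for t
      using limQ[OF that] radial_solutionD(6)[OF sol[OF x(1,3)] that] by simp
  qed
  have le: "P l 0 \<le> P' 0" "Q l 0 \<le> Q' 0" using least[OF l(1) order_refl l(2) rs, of 0] by auto
  have "\<forall>\<^sub>F k in sequentially. P l 0 - d < P (x k) 0"
    by (rule order_tendstoD(1)[OF limP]) (use le d in auto)
  moreover have "\<forall>\<^sub>F k in sequentially. Q l 0 - d < Q (x k) 0"
    by (rule order_tendstoD(1)[OF limQ]) (use le d in auto)
  ultimately have "\<forall>\<^sub>F k in sequentially. P l 0 - d < P (x k) 0 \<and> Q l 0 - d < Q (x k) 0"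
    by (rule eventually_conj)
  then obtain k where k: "P l 0 - d < P (x k) 0" "Q l 0 - d < Q (x k) 0"
    by (auto simp: eventually_sequentially)
  have xp: "0 < x k" using x(1)[of k] pos by simp
  have o: "radial_ode n f g (x k) (c * x k) (\<lambda>r. P (x k) (r\<^sup>2)) (\<lambda>r. Q (x k) (r\<^sup>2))
     (\<lambda>r. ball_mean n (src f g (x k) (P (x k)) (Q (x k))) (r\<^sup>2))
     (\<lambda>r. ball_mean n (src g f (c * x k) (Q (x k)) (P (x k))) (r\<^sup>2))"
    by (rule radial_solution_imp_radial_ode[OF fg xp _ sol[OF x(1,3)]]) (use xp pos in simp)
  have "\<forall>r\<in>{0..1}. P (x k) (r\<^sup>2) \<le> P l (r\<^sup>2) \<and> Q (x k) (r\<^sup>2) \<le> Q l (r\<^sup>2)"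
    using below by (simp add: power_le_one)
  then have *: "0 < x k \<and> x k < l \<and> 0 < c * x k \<and> c * x k < c * l \<and>
     radial_ode n f g (x k) (c * x k) (\<lambda>r. P (x k) (r\<^sup>2)) (\<lambda>r. Q (x k) (r\<^sup>2))
       (\<lambda>r. ball_mean n (src f g (x k) (P (x k)) (Q (x k))) (r\<^sup>2))
       (\<lambda>r. ball_mean n (src g f (c * x k) (Q (x k)) (P (x k))) (r\<^sup>2)) \<and>
     (\<forall>r\<in>{0..1}. P (x k) (r\<^sup>2) \<le> P l (r\<^sup>2) \<and> Q (x k) (r\<^sup>2) \<le> Q l (r\<^sup>2)) \<and>
     P l (0\<^sup>2) - P (x k) (0\<^sup>2) \<le> d \<and> Q l (0\<^sup>2) - Q (x k) (0\<^sup>2) \<le> d"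
    using xp x(2) pos k o by simp
  show "\<exists>l' m' u' v' k' j'. 0 < l' \<and> l' < l \<and> 0 < m' \<and> m' < c * l \<and> radial_ode n f g l' m' u' v' k' j' \<and>
     (\<forall>r\<in>{0..1}. u' r \<le> P l (r\<^sup>2) \<and> v' r \<le> Q l (r\<^sup>2)) \<and> P l (0\<^sup>2) - u' 0 \<le> d \<and> Q l (0\<^sup>2) - v' 0 \<le> d"
    by (rule exI[where x = "x k"], rule exI[where x = "c * x k"], rule exI[where x = "\<lambda>r. P (x k) (r\<^sup>2)"],
        rule exI[where x = "\<lambda>r. Q (x k) (r\<^sup>2)"], rule exI, rule exI, rule *)
qed

text \<open>Measurability passes to countable limits, hence a sequence: on the ball \<open>w\<close>
  equals a limsup of continuous functions. Nonnegativity turns the upper bound into one for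
  |w|.\<close>

lemma L_infinity_limit:
  fixes w :: "'a::euclidean_space \<Rightarrow> ereal" and W :: "nat \<Rightarrow> 'a \<Rightarrow> real"
  assumes c: "\<And>k. continuous_on (ball 0 1) (W k)"
    and lim: "\<And>x. x \<in> ball 0 1 \<Longrightarrow> (\<lambda>k. ereal (W k x)) \<longlonglongrightarrow> w x"
    and nn: "\<And>k x. x \<in> ball 0 1 \<Longrightarrow> 0 \<le> W k x" and bd: "\<And>k x. x \<in> ball 0 1 \<Longrightarrow> W k x \<le> C"
  shows "L_infinity (ball 0 1) w"
proof -
  have "(\<lambda>x. limsup (\<lambda>k. ereal (W k x))) \<in> borel_measurable (lebesgue_on (ball 0 1))"
    by (intro borel_measurable_limsup borel_measurable_ereal continuous_imp_measurable_on_sets_lebesgue c) simp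
  moreover have "w \<in> borel_measurable (lebesgue_on (ball 0 1)) \<longleftrightarrow>
      (\<lambda>x. limsup (\<lambda>k. ereal (W k x))) \<in> borel_measurable (lebesgue_on (ball 0 1))"
    by (rule measurable_cong) (use lim_imp_Limsup[OF _ lim] in simp)
  ultimately have m: "w \<in> borel_measurable (lebesgue_on (ball 0 1))" by blast
  have "\<bar>w x\<bar> \<le> ereal C" if "x \<in> space (lebesgue_on (ball 0 1))" for x
  proof -
    have x: "x \<in> ball 0 1" using that by simp
    have "0 \<le> w x" by (rule LIMSEQ_le_const[OF lim[OF x]]) (use nn[OF x] in auto)
    moreover have "w x \<le> ereal C" by (rule LIMSEQ_le_const2[OF lim[OF x]]) (use bd[OF x] in auto)
    ultimately show ?thesis by (simp add: abs_ereal_ge0)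
  qed
  then have "esssup (lebesgue_on (ball 0 1)) (\<lambda>x. \<bar>w x\<bar>) \<le> ereal C"
    using m by (intro esssup_I) auto
  then show ?thesis unfolding L_infinity_def using m by (auto simp: less_le_trans intro: le_less_trans)
qed

theorem theorem2p2:
  fixes f g :: "real \<Rightarrow> real"
    and lam gam :: real
    and us vs :: "real ^ 'n \<Rightarrow> ereal"
  assumes "CARD('n) \<ge> 3"
    and "admissible_nonlinearity f" and "admissible_nonlinearity g"
    and "D_half f 0 > 0" and "D_half g 0 > 0"
    and "Liminf at_top (\<lambda>t. ereal (D_half (D_half f) t)) = \<infinity>"
    and "Liminf at_top (\<lambda>t. ereal (D_half (D_half g) t)) = \<infinity>"
    and "(lam, gam) \<in> extremal_params (ball (0 :: real ^ 'n) 1) f g"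
    and "extremal_solution (ball (0 :: real ^ 'n) 1) f g lam gam us vs"
  shows "(CARD('n) < 10 \<longrightarrow>
            L_infinity (ball 0 1) us \<and> L_infinity (ball 0 1) vs) \<and>
         (CARD('n) = 10 \<longrightarrow>
            (\<exists>C::real. \<forall>r\<in>{0<..1}. \<forall>x. norm x = r \<longrightarrow>
               us x \<le> ereal (C * (1 + \<bar>ln r\<bar>)) \<and> vs x \<le> ereal (C * (1 + \<bar>ln r\<bar>)))) \<and>
         (CARD('n) > 10 \<longrightarrow>
            (\<exists>C::real. \<forall>r\<in>{0<..1}. \<forall>x. norm x = r \<longrightarrow>
               us x \<le> ereal (C * r powr (- real CARD('n) / 2 + sqrt (real CARD('n) - 1) + 2)) \<and>
               vs x \<le> ereal (C * r powr (- real CARD('n) / 2 + sqrt (real CARD('n) - 1) + 2))))"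
proof -
  have fg: "nonlin f" "nonlin g" using assms by (simp_all add: nonlin_def)
  have lg: "0 < lam" "0 < gam" using assms(8) by (auto simp: extremal_params_def param_quadrant_def)
  define c where "c = gam / lam"
  have c: "0 < c" "c * lam = gam" using lg by (simp_all add: c_def)
  define n where "n = CARD('n) - 1"
  have n: "DIM(real ^ 'n) = Suc n" "CARD('n) = Suc n" "2 \<le> n" using assms(1) by (simp_all add: n_def)
  obtain U V where UV': "\<forall>l\<in>{lam/2<..<lam}. minimal_solution (ball (0 :: real ^ 'n) 1) f g l (gam / lam * l) (U l) (V l)"
    and lim': "\<forall>x\<in>closure (ball (0 :: real ^ 'n) 1). ((\<lambda>l. ereal (U l x)) \<longlongrightarrow> us x) (at_left lam) \<and>
                        ((\<lambda>l. ereal (V l x)) \<longlongrightarrow> vs x) (at_left lam)"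
    using assms(9) unfolding extremal_solution_def by blast
  have UV: "\<And>l. lam / 2 < l \<Longrightarrow> l < lam \<Longrightarrow> minimal_solution (ball (0 :: real ^ 'n) 1) f g l (c * l) (U l) (V l)"
    and lim: "\<And>x. norm x \<le> 1 \<Longrightarrow> ((\<lambda>l. ereal (U l x)) \<longlongrightarrow> us x) (at_left lam)"
      "\<And>x. norm x \<le> 1 \<Longrightarrow> ((\<lambda>l. ereal (V l x)) \<longlongrightarrow> vs x) (at_left lam)"
    using UV' lim' by (simp_all add: c_def)
  \<comment> \<open>The range of \<open>l\<close> is a premise inside the existential, and the two
    profiles form one pair, so that a choice function of \<open>l\<close> can be extracted.\<close>
  have "\<exists>p. lam / 2 < l \<longrightarrow> l < lam \<longrightarrow> radial_solution (Suc n) f g l (c * l) (fst p) (snd p) \<and>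
     (\<forall>x. norm x \<le> 1 \<longrightarrow> U l x = fst p (x \<bullet> x) \<and> V l x = snd p (x \<bullet> x)) \<and>
     (\<forall>l' m' W Z t. l \<le> l' \<longrightarrow> c * l \<le> m' \<longrightarrow> radial_solution (Suc n) f g l' m' W Z \<longrightarrow> t \<in> {0..1} \<longrightarrow>
        fst p t \<le> W t \<and> snd p t \<le> Z t)" for l
  proof (cases "lam / 2 < l \<and> l < lam")
    case True
    then have l: "0 < l" "0 < c * l" using lg c by auto
    have "minimal_solution (ball (0 :: real ^ 'n) 1) f g l (c * l) (U l) (V l)" using UV True by blast
    then show ?thesis
    proof (rule minimal_solution_radial[OF fg l])
      fix P Q
      assume "radial_solution DIM(real ^ 'n) f g l (c * l) P Q"
        "\<And>x. norm x \<le> 1 \<Longrightarrow> U l x = P (x \<bullet> x) \<and> V l x = Q (x \<bullet> x)"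
        "\<And>l' m' W Z t. l \<le> l' \<Longrightarrow> c * l \<le> m' \<Longrightarrow> radial_solution DIM(real ^ 'n) f g l' m' W Z \<Longrightarrow> t \<in> {0..1} \<Longrightarrow>
           P t \<le> W t \<and> Q t \<le> Z t"
      then show ?thesis unfolding n(1) by (intro exI[of _ "(P, Q)"]) simp
    qed
  qed blast
  then obtain p where p: "\<And>l. lam / 2 < l \<Longrightarrow> l < lam \<Longrightarrow> radial_solution (Suc n) f g l (c * l) (fst (p l)) (snd (p l)) \<and>
     (\<forall>x. norm x \<le> 1 \<longrightarrow> U l x = fst (p l) (x \<bullet> x) \<and> V l x = snd (p l) (x \<bullet> x)) \<and>
     (\<forall>l' m' W Z t. l \<le> l' \<longrightarrow> c * l \<le> m' \<longrightarrow> radial_solution (Suc n) f g l' m' W Z \<longrightarrow> t \<in> {0..1} \<longrightarrow>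
        fst (p l) t \<le> W t \<and> snd (p l) t \<le> Z t)"
    by metis
  define P where "P l = fst (p l)" for l
  define Q where "Q l = snd (p l)" for l
  have sol: "radial_solution (Suc n) f g l (c * l) (P l) (Q l)" if "lam / 2 < l" "l < lam" for l
    using p[OF that] by (simp add: P_def Q_def)
  have least: "P l t \<le> W t \<and> Q l t \<le> Z t"
    if "lam / 2 < l" "l \<le> l'" "l' < lam" "radial_solution (Suc n) f g l' (c * l') W Z" "t \<in> {0..1}" for l l' W Z t
  proof -
    have "l < lam" "c * l \<le> c * l'" using that c by auto
    then show ?thesis using p[OF that(1)] that by (simp add: P_def Q_def)
  qed
  have UP: "U l x = P l ((norm x)\<^sup>2)" "V l x = Q l ((norm x)\<^sup>2)" if "lam / 2 < l" "l < lam" "norm x \<le> 1" for l x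
    using p[OF that(1,2)] that(3) by (simp_all add: P_def Q_def dot_square_norm)
  have half_nn: "0 \<le> lam / 2" using lg by simp
  have ap: "approximable n f g l (c * l) (\<lambda>r. P l (r\<^sup>2)) (\<lambda>r. Q l (r\<^sup>2))" if "lam / 2 < l" "l < lam" for l
  proof (rule minimal_family_approximable[where P = P and Q = Q and a = "lam / 2" and b = lam, OF fg half_nn c(1)])
    show "P l t \<le> W t \<and> Q l t \<le> Z t"
      if "lam / 2 < l" "l \<le> l'" "l' < lam" "radial_solution (Suc n) f g l' (c * l') W Z" "t \<in> {0..1}" for l l' W Z t
      using least[OF that] .
  qed (use sol that in auto)
  define k where "k l = (\<lambda>r. ball_mean n (src f g l (P l) (Q l)) (r\<^sup>2))" for l
  define j where "j l = (\<lambda>r. ball_mean n (src g f (c * l) (Q l) (P l)) (r\<^sup>2))" for l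
  have o: "radial_ode n f g l (c * l) (\<lambda>r. P l (r\<^sup>2)) (\<lambda>r. Q l (r\<^sup>2)) (k l) (j l)" if "lam / 2 < l" "l < lam" for l
    unfolding k_def j_def by (rule radial_solution_imp_radial_ode[OF fg _ _ sol[OF that]]) (use that lg c in auto)
  \<comment> \<open>Since l > lam/2 and c l > gam/2, both parameters stay between \<open>l0\<close>
    and \<open>L\<close> along the branch, and one set of constants serves all
    \<open>l\<close>.\<close>
  define l0 where "l0 = min (lam / 2) (gam / 2)"
  define L where "L = max lam gam"
  have l0: "0 < l0" using lg by (simp add: l0_def)
  have range: "l0 \<le> l" "l0 \<le> c * l" "l \<le> L" "c * l \<le> L" if "lam / 2 < l" "l < lam" for l
  proof -
    have "c * (lam / 2) \<le> c * l" "c * l \<le> c * lam" using that c(1) by (simp_all add: mult_left_mono)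
    then show "l0 \<le> l" "l0 \<le> c * l" "l \<le> L" "c * l \<le> L" using that c(2) by (auto simp: l0_def L_def)
  qed
  define \<beta> where "\<beta> = - real CARD('n) / 2 + sqrt (real CARD('n) - 1) + 2"
  have \<beta>: "(1 - real n) / 2 + sqrt (real n) = \<beta> - 1" by (simp add: \<beta>_def n(2) field_simps)
  obtain C1 M1 where 1: "0 \<le> C1" "0 \<le> M1"
    "\<And>l m u v k j. l0 \<le> l \<Longrightarrow> l0 \<le> m \<Longrightarrow> l \<le> L \<Longrightarrow> m \<le> L \<Longrightarrow> radial_ode n f g l m u v k j \<Longrightarrow> approximable n f g l m u v \<Longrightarrow>
       u (1/4) \<le> M1 \<and> (\<forall>r. 0 < r \<longrightarrow> r \<le> 1/4 \<longrightarrow> r * k r \<le> C1 * r powr (\<beta> - 1))"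
    using approximable_derivative_bound[OF fg n(3) l0, of L] unfolding \<beta> by blast
  obtain C2 M2 where 2: "0 \<le> C2" "0 \<le> M2"
    "\<And>l m u v k j. l0 \<le> l \<Longrightarrow> l0 \<le> m \<Longrightarrow> l \<le> L \<Longrightarrow> m \<le> L \<Longrightarrow> radial_ode n g f l m u v k j \<Longrightarrow> approximable n g f l m u v \<Longrightarrow>
       u (1/4) \<le> M2 \<and> (\<forall>r. 0 < r \<longrightarrow> r \<le> 1/4 \<longrightarrow> r * k r \<le> C2 * r powr (\<beta> - 1))"
    using approximable_derivative_bound[OF fg(2,1) n(3) l0, of L] unfolding \<beta> by blast
  define C where "C = max C1 C2"
  define M where "M = max M1 M2"
  have CM: "0 \<le> C" "0 \<le> M" using 1 2 by (simp_all add: C_def M_def)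
  have dP: "P l ((1/4)\<^sup>2) \<le> M" "\<And>r. 0 < r \<Longrightarrow> r \<le> 1/4 \<Longrightarrow> r * k l r \<le> C * r powr (\<beta> - 1)"
    if "lam / 2 < l" "l < lam" for l
  proof -
    have *: "P l ((1/4)\<^sup>2) \<le> M1 \<and> (\<forall>r. 0 < r \<longrightarrow> r \<le> 1/4 \<longrightarrow> r * k l r \<le> C1 * r powr (\<beta> - 1))"
      using 1(3)[OF range[OF that] o[OF that] ap[OF that]] .
    then show "P l ((1/4)\<^sup>2) \<le> M" by (simp add: M_def le_max_iff_disj)
    fix r :: real assume "0 < r" "r \<le> 1/4"
    then have "r * k l r \<le> C1 * r powr (\<beta> - 1)" using * by blast
    also have "\<dots> \<le> C * r powr (\<beta> - 1)" by (rule mult_right_mono) (simp_all add: C_def)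
    finally show "r * k l r \<le> C * r powr (\<beta> - 1)" .
  qed
  have dQ: "Q l ((1/4)\<^sup>2) \<le> M" "\<And>r. 0 < r \<Longrightarrow> r \<le> 1/4 \<Longrightarrow> r * j l r \<le> C * r powr (\<beta> - 1)"
    if "lam / 2 < l" "l < lam" for l
  proof -
    have *: "Q l ((1/4)\<^sup>2) \<le> M2 \<and> (\<forall>r. 0 < r \<longrightarrow> r \<le> 1/4 \<longrightarrow> r * j l r \<le> C2 * r powr (\<beta> - 1))"
      using 2(3)[OF range(2,1,4,3)[OF that] radial_ode_swap[OF o[OF that]] approximable_swap[OF ap[OF that]]] .
    then show "Q l ((1/4)\<^sup>2) \<le> M" by (simp add: M_def le_max_iff_disj)
    fix r :: real assume "0 < r" "r \<le> 1/4"
    then have "r * j l r \<le> C2 * r powr (\<beta> - 1)" using * by blast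
    also have "\<dots> \<le> C * r powr (\<beta> - 1)" by (rule mult_right_mono) (simp_all add: C_def)
    finally show "r * j l r \<le> C * r powr (\<beta> - 1)" .
  qed
  have growth:
    "0 < \<beta> \<Longrightarrow> 0 \<le> r \<Longrightarrow> r \<le> 1 \<Longrightarrow> P l (r\<^sup>2) \<le> M + C / \<beta> \<and> Q l (r\<^sup>2) \<le> M + C / \<beta>"
    "\<beta> = 0 \<Longrightarrow> 0 < r \<Longrightarrow> r \<le> 1 \<Longrightarrow>
       P l (r\<^sup>2) \<le> (M + C) * (1 + \<bar>ln r\<bar>) \<and> Q l (r\<^sup>2) \<le> (M + C) * (1 + \<bar>ln r\<bar>)"
    "\<beta> < 0 \<Longrightarrow> 0 < r \<Longrightarrow> r \<le> 1 \<Longrightarrow>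
       P l (r\<^sup>2) \<le> (M + C / - \<beta>) * r powr \<beta> \<and> Q l (r\<^sup>2) \<le> (M + C / - \<beta>) * r powr \<beta>"
    if l: "lam / 2 < l" "l < lam" for l r
    using profile_growth[OF o[OF l] CM(2) dP(1)[OF l] CM(1) dP(2)[OF l], of r]
      profile_growth[OF radial_ode_swap[OF o[OF l]] CM(2) dQ(1)[OF l] CM(1) dQ(2)[OF l], of r] by blast+
  have ev: "\<forall>\<^sub>F l in at_left lam. lam / 2 < l \<and> l < lam"
    unfolding eventually_at_left_field using lg by (intro exI[of _ "lam / 2"]) auto
  have bound: "us x \<le> ereal b \<and> vs x \<le> ereal b"
    if x: "norm x \<le> 1" and b: "\<And>l. lam / 2 < l \<Longrightarrow> l < lam \<Longrightarrow> P l ((norm x)\<^sup>2) \<le> b \<and> Q l ((norm x)\<^sup>2) \<le> b" for x b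
  proof
    have "\<forall>\<^sub>F l in at_left lam. ereal (U l x) \<le> ereal b" "\<forall>\<^sub>F l in at_left lam. ereal (V l x) \<le> ereal b"
      using ev by (eventually_elim, use UP b x in simp)+
    then show "us x \<le> ereal b" "vs x \<le> ereal b"
      using tendsto_upperbound[OF lim(1)[OF x]] tendsto_upperbound[OF lim(2)[OF x]] by simp_all
  qed
  have small: "L_infinity (ball 0 1) us \<and> L_infinity (ball 0 1) vs" if N: "CARD('n) < 10"
  proof -
    \<comment> \<open>In terms of n = N - 1, \<beta> = sqrt n - (n - 3)/2, and (n - 3)^2 / 4 < n is
      equivalent to (n - 1)(n - 9) < 0.\<close>
    have b: "0 < \<beta>"
    proof -
      have "real n / 2 - 3 / 2 < sqrt (real n)"
      proof (rule real_less_rsqrt)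
        have "(real n - 1) * (real n - 9) < 0" using N n by (intro mult_pos_neg) auto
        then show "(real n / 2 - 3 / 2)\<^sup>2 < real n" by (simp add: power2_eq_square field_simps)
      qed
      then show ?thesis by (simp add: \<beta>_def n(2) field_simps)
    qed
    \<comment> \<open>The limit from the left is sampled along a sequence, as measurability
      requires; the offset 2 keeps its first term above \<open>lam / 2\<close>.\<close>
    define y where "y i = lam - (lam / 2) / (real i + 2)" for i :: nat
    have y: "lam / 2 < y i" "y i < lam" for i
    proof -
      have "(lam / 2) / (real i + 2) < (lam / 2) / 1" by (rule divide_strict_left_mono) (use lg in auto)
      then show "lam / 2 < y i" by (simp add: y_def)
      show "y i < lam" using lg by (simp add: y_def)
    qed
    have "y \<longlonglongrightarrow> lam" unfolding y_def by real_asymp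
    then have ylim: "filterlim y (at_left lam) sequentially"
      using y by (auto simp: filterlim_at less_imp_neq)
    have sm: "continuous_on (ball 0 1) (U (y i))" "continuous_on (ball 0 1) (V (y i))"
        "\<And>x. x \<in> ball 0 1 \<Longrightarrow> 0 \<le> U (y i) x \<and> 0 \<le> V (y i) x" for i
      using UV[OF y, of i] smooth_on_imp_continuous_on
      by (auto simp: minimal_solution_def smooth_solution_def)
    have bd: "U (y i) x \<le> M + C / \<beta> \<and> V (y i) x \<le> M + C / \<beta>" if "x \<in> ball 0 1" for i x
      using growth(1)[OF y b, of "norm x" i] UP[OF y, of x i] that by simp
    have "L_infinity (ball 0 1) us"
    proof (rule L_infinity_limit[where W = "\<lambda>i. U (y i)" and C = "M + C / \<beta>"])
      show "(\<lambda>i. ereal (U (y i) x)) \<longlonglongrightarrow> us x" if "x \<in> ball 0 1" for x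
        using filterlim_compose[OF lim(1) ylim] that by simp
    qed (use sm bd in auto)
    moreover have "L_infinity (ball 0 1) vs"
    proof (rule L_infinity_limit[where W = "\<lambda>i. V (y i)" and C = "M + C / \<beta>"])
      show "(\<lambda>i. ereal (V (y i) x)) \<longlonglongrightarrow> vs x" if "x \<in> ball 0 1" for x
        using filterlim_compose[OF lim(2) ylim] that by simp
    qed (use sm bd in auto)
    ultimately show ?thesis ..
  qed
  have critical: "\<exists>C::real. \<forall>r\<in>{0<..1}. \<forall>x. norm x = r \<longrightarrow>
               us x \<le> ereal (C * (1 + \<bar>ln r\<bar>)) \<and> vs x \<le> ereal (C * (1 + \<bar>ln r\<bar>))" if N: "CARD('n) = 10"
  proof (intro exI ballI allI impI)
    fix r :: real and x :: "real ^ 'n" assume r: "r \<in> {0<..1}" and x: "norm x = r"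
    have "sqrt 9 = (3::real)" by (rule real_sqrt_unique) auto
    then have b: "\<beta> = 0" using N by (simp add: \<beta>_def)
    show "us x \<le> ereal ((M + C) * (1 + \<bar>ln r\<bar>)) \<and> vs x \<le> ereal ((M + C) * (1 + \<bar>ln r\<bar>))"
      by (rule bound) (use growth(2)[OF _ _ b] r x in auto)
  qed
  have large: "\<exists>C::real. \<forall>r\<in>{0<..1}. \<forall>x. norm x = r \<longrightarrow>
               us x \<le> ereal (C * r powr \<beta>) \<and> vs x \<le> ereal (C * r powr \<beta>)" if N: "CARD('n) > 10"
  proof (intro exI ballI allI impI)
    fix r :: real and x :: "real ^ 'n" assume r: "r \<in> {0<..1}" and x: "norm x = r"
    have b: "\<beta> < 0"
    proof -
      have "sqrt (real n) < real n / 2 - 3 / 2"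
      proof (rule real_less_lsqrt)
        have "0 < (real n - 1) * (real n - 9)" using N n by (intro mult_pos_pos) auto
        then show "real n < (real n / 2 - 3 / 2)\<^sup>2" by (simp add: power2_eq_square field_simps)
      qed (use N n in auto)
      then show ?thesis by (simp add: \<beta>_def n(2) field_simps)
    qed
    show "us x \<le> ereal ((M + C / - \<beta>) * r powr \<beta>) \<and> vs x \<le> ereal ((M + C / - \<beta>) * r powr \<beta>)"
      by (rule bound) (use growth(3)[OF _ _ b] r x in auto)
  qed
  show ?thesis using small critical large unfolding \<beta>_def by blast
qed

end
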